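(* Let $X$ be a resonant Hopf surface with parameters $b$ and $r>1$. The nowhere-vanishing $(L_b)^r$-twisted trace-free Higgs bundles of the form $(\mathcal{O}_X\oplus H,\phi)$ with $H\in\mathrm{Pic}(X)$, $\deg(H)\le0$, up to conjugation by an automorphism of $\mathcal{O}_X\oplus H$, are as follows: (1) $H\simeq\mathcal{O}_X$ and $$\phi=\begin{pmatrix}tx&sx+uy^r\\ y^r&-tx\end{pmatrix},$$ where $s,t,u\in\mathbb{C}$ and $s^2-4t^2u\ne0$, up to replacing $t$ with $-t$. This Higgs field always has irreducible spectral curve. (2) $H\simeq(L_b)^{-r}$ and $$\phi=\begin{pmatrix}0&\beta\\1&0\end{pmatrix}$$ with $\beta\in H^0(X,(L_b)^{2r})$. This Higgs field has irreducible spectral curve when $\beta$ is not a square. When $\beta=t^2$ for some $t\in H^0(X,(L_b)^r)$, the invariant sub-line bundles are $(L_b)^{-r}$ under the inclusions $(\pm t,1)$. (3) $H\simeq(L_b)^{-kr}$ for some $k\ge0$ and $$\phi=\begin{pmatrix}ux+vy^r&(\overline{v}x-\overline{u}y^r)^{1+k}\\0&-ux-vy^r\end{pmatrix}$$ for $u,v\in\mathbb{C}$ not both zero. The $\phi$-invariant sub-line bundles are the first direct summand $\mathcal{O}_X$ and $(L_b)^{-r(1+k)}$ under the inclusion $((\overline{v}x-\overline{u}y^r)^{1+k},-2ux-2vy^r)$. (4) $H\simeq(L_b)^{-k}$ with $0<k<r$ and $$\phi=\begin{pmatrix}sx&\beta\\ y^{r-k}&-sx\end{pmatrix}$$ for $s\in\mathbb{C}^*$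 and $\beta\in H^0(X,(L_b)^{r+k})$. This Higgs field has irreducible spectral curve if there is no constant $t\in\mathbb{C}$ such that $\beta=2stxy^k+t^2y^{r+k}$. For $\beta=2stxy^k+t^2y^{r+k}$, the $\phi$-invariant sub-line bundles are $(L_b)^{-k}$ under the inclusion $(ty^k,-1)$ and $(L_b)^{-r}$ under the inclusion $(2sx+ty^r,y^{r-k})$. (5) $H\simeq(L_b)^{-k}$ for $k>0$ with $k$ not a multiple of $r$ and $$\phi=\begin{pmatrix}\alpha&y^{r+k}\\0&-\alpha\end{pmatrix}$$ for $\alpha\in H^0(X,(L_b)^r)$ with $\alpha(1,0)\ne0$. The $\phi$-invariant sub-line bundles are the first direct summand $\mathcal{O}_X$ and $(L_b)^{-r-k}$ under the inclusion $(y^{r+k},-2\alpha)$.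
   Context: A resonant Hopf surface is $X=(\mathbb{C}^2\setminus\{0\})/\langle F\rangle$ with $F(x,y)=(b^rx,by)$, $0<|b|<1$, $r>1$ an integer. For $\tau\in\mathbb{C}^*$, $L_\tau$ is the line bundle on $X$ obtained from $(\mathbb{C}^2\setminus\{0\})\times\mathbb{C}$ by identifying $(p,v)\sim(F(p),\tau v)$; every line bundle is isomorphic to a unique $L_\tau$. Sections of $L_\tau$ are identified with holomorphic functions $s$ on $\mathbb{C}^2\setminus\{0\}$ with $s\circ F=\tau s$. The degree is $\deg(L_\tau)=\log|\tau|/\log|b|$. A $\lambda$-twisted trace-free Higgs bundle is a pair $(E,\phi)$ with $E$ a rank-2 bundle and $\phi\in H^0(X,\mathcal{E}nd_0(E)\otimes\lambda)$, where $\mathcal{E}nd_0(E)$ denotes trace-free endomorphisms. For $E=\mathcal{O}_X\oplus H$, $\phi$ is written as a matrix $\begin{pmatrix}p&q\\ w&-p\end{pmatrix}$ acting on column vectors, with $p\in H^0(X,\lambda)$, $q\in H^0(X,\lambda\otimes H^{-1})$, $w\in H^0(X,\lambda\otimes H)$. An inclusion $(f,g)$ of a line bundle $M$ means the map $M\to\mathcal{O}_X\oplus H$ with components $f\in H^0(X,M^{-1})$, $g\in H^0(X,M^{-1}\otimes H)$. A sub-line bundle $M$ (taken with torsion-free quotient) is $\phi$-invariant if $\phi(M)\subseteq M\otimes\lambda$. The spectral curve is the zero locus of the characteristic polynomial of $\phi$ in the total space of $\lambda$. Listed Higgs fields are determined by their parameters up to conjugation by automorphisms of $E$ unless otherwise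 indicated. *)

theory Defs
  imports "HOL-Analysis.Analysis"
begin

(* Everything on the Hopf surface X = (C^2 - {0}) / <F> is written on C^2 - {0}: a line bundle on
   X is represented by the multiplier tau \<noteq> 0 of L_tau, so that tensor product, dual and
   (L_b)^m become product, inverse and b powi m, and L_tau, L_tau' are isomorphic iff
   tau = tau'.  A function on C^2 stands for its restriction to C^2 - {0}; its value at the
   origin is irrelevant, and sections are compared on C^2 - {0} only. *)

definition punctured :: "(complex \<times> complex) set" where
  "punctured = UNIV - {(0, 0)}"

definition hopf_map :: "complex \<Rightarrow> nat \<Rightarrow> complex \<times> complex \<Rightarrow> complex \<times> complex" where
  "hopf_map b r = (\<lambda>(x, y). (b ^ r * x, b * y))"

(* Complex differentiability in two, resp. three variables; used for open sets only. *)

definition holo2_on :: "(complex \<times> complex) set \<Rightarrow> (complex \<times> complex \<Rightarrow> complex) \<Rightarrow> bool" where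
  "holo2_on U f \<longleftrightarrow> (\<forall>z\<in>U. \<exists>c1 c2. (f has_derivative (\<lambda>(h, k). c1 * h + c2 * k)) (at z))"

definition holo3_on ::
  "((complex \<times> complex) \<times> complex) set \<Rightarrow> ((complex \<times> complex) \<times> complex \<Rightarrow> complex) \<Rightarrow> bool" where
  "holo3_on U f \<longleftrightarrow> (\<forall>z\<in>U. \<exists>c1 c2 c3.
     (f has_derivative (\<lambda>((h, k), l). c1 * h + c2 * k + c3 * l)) (at z))"

(* H^0(X, L_tau) *)
definition H0 :: "complex \<Rightarrow> nat \<Rightarrow> complex \<Rightarrow> (complex \<times> complex \<Rightarrow> complex) set" where
  "H0 b r \<tau> = {s. holo2_on punctured s \<and> (\<forall>z\<in>punctured. s (hopf_map b r z) = \<tau> * s z)}"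

definition lb_degree :: "complex \<Rightarrow> complex \<Rightarrow> real" where
  "lb_degree b \<tau> = ln (cmod \<tau>) / ln (cmod b)"

(* H^0(X, End(E) \<otimes> L_mu) for E = O \<oplus> L_tau; matrices act on column vectors *)
definition End_sections ::
  "complex \<Rightarrow> nat \<Rightarrow> complex \<Rightarrow> complex \<Rightarrow> (complex \<times> complex \<Rightarrow> complex^2^2) set" where
  "End_sections b r \<mu> \<tau> = {\<phi>.
     (\<lambda>z. \<phi> z $ 1 $ 1) \<in> H0 b r \<mu> \<and> (\<lambda>z. \<phi> z $ 1 $ 2) \<in> H0 b r (\<mu> / \<tau>) \<and>
     (\<lambda>z. \<phi> z $ 2 $ 1) \<in> H0 b r (\<mu> * \<tau>) \<and> (\<lambda>z. \<phi> z $ 2 $ 2) \<in> H0 b r \<mu>}"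

(* L_mu-twisted trace-free Higgs fields on O \<oplus> L_tau *)
definition higgs_field ::
  "complex \<Rightarrow> nat \<Rightarrow> complex \<Rightarrow> complex \<Rightarrow> (complex \<times> complex \<Rightarrow> complex^2^2) \<Rightarrow> bool" where
  "higgs_field b r \<mu> \<tau> \<phi> \<longleftrightarrow>
     \<phi> \<in> End_sections b r \<mu> \<tau> \<and> (\<forall>z\<in>punctured. trace (\<phi> z) = 0)"

definition nowhere_vanishing :: "(complex \<times> complex \<Rightarrow> complex^2^2) \<Rightarrow> bool" where
  "nowhere_vanishing \<phi> \<longleftrightarrow> (\<forall>z\<in>punctured. \<phi> z \<noteq> 0)"

definition automorphism ::
  "complex \<Rightarrow> nat \<Rightarrow> complex \<Rightarrow> (complex \<times> complex \<Rightarrow> complex^2^2) \<Rightarrow> bool" where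
  "automorphism b r \<tau> \<psi> \<longleftrightarrow> \<psi> \<in> End_sections b r 1 \<tau> \<and> (\<forall>z\<in>punctured. invertible (\<psi> z))"

definition conjugate ::
  "complex \<Rightarrow> nat \<Rightarrow> complex \<Rightarrow> (complex \<times> complex \<Rightarrow> complex^2^2) \<Rightarrow>
     (complex \<times> complex \<Rightarrow> complex^2^2) \<Rightarrow> bool" where
  "conjugate b r \<tau> \<phi> \<phi>' \<longleftrightarrow>
     (\<exists>\<psi>. automorphism b r \<tau> \<psi> \<and>
       (\<forall>z\<in>punctured. \<phi>' z = \<psi> z ** \<phi> z ** matrix_inv (\<psi> z)))"


(* The cokernel of (f, g) : M \<rightarrow> E is torsion-free: if h is a nonzerodivisor and h times the local
   section (s1, s2) of E lies in M, then (s1, s2) already lies in M. *)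
definition torsion_free_quotient ::
  "(complex \<times> complex \<Rightarrow> complex) \<Rightarrow> (complex \<times> complex \<Rightarrow> complex) \<Rightarrow> bool" where
  "torsion_free_quotient f g \<longleftrightarrow>
     (\<forall>U h s1 s2 m. open U \<and> U \<subseteq> punctured \<and>
        holo2_on U h \<and> holo2_on U s1 \<and> holo2_on U s2 \<and> holo2_on U m \<and>
        (\<forall>W. open W \<and> W \<noteq> {} \<and> W \<subseteq> U \<longrightarrow> (\<exists>z\<in>W. h z \<noteq> 0)) \<and>
        (\<forall>z\<in>U. h z * s1 z = m z * f z \<and> h z * s2 z = m z * g z) \<longrightarrow>
        (\<forall>p\<in>U. \<exists>V e. open V \<and> p \<in> V \<and> V \<subseteq> U \<and> holo2_on V e \<and>
           (\<forall>z\<in>V. s1 z = e z * f z \<and> s2 z = e z * g z)))"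

(* (f, g) includes L_sigma into O \<oplus> L_tau as a sub-line bundle with torsion-free quotient *)
definition sub_line_bundle ::
  "complex \<Rightarrow> nat \<Rightarrow> complex \<Rightarrow>
     complex \<times> (complex \<times> complex \<Rightarrow> complex) \<times> (complex \<times> complex \<Rightarrow> complex) \<Rightarrow> bool" where
  "sub_line_bundle b r \<tau> = (\<lambda>(\<sigma>, f, g).
     \<sigma> \<noteq> 0 \<and> f \<in> H0 b r (inverse \<sigma>) \<and> g \<in> H0 b r (inverse \<sigma> * \<tau>) \<and>
     (\<exists>z\<in>punctured. f z \<noteq> 0 \<or> g z \<noteq> 0) \<and> torsion_free_quotient f g)"

(* phi restricts to a morphism M \<rightarrow> M \<otimes> L_mu, which is multiplication by a section m of L_mu *)
definition invariant_under ::
  "complex \<Rightarrow> nat \<Rightarrow> complex \<Rightarrow> (complex \<times> complex \<Rightarrow> complex^2^2) \<Rightarrow>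
     complex \<times> (complex \<times> complex \<Rightarrow> complex) \<times> (complex \<times> complex \<Rightarrow> complex) \<Rightarrow> bool" where
  "invariant_under b r \<mu> \<phi> = (\<lambda>(\<sigma>, f, g).
     \<exists>m\<in>H0 b r \<mu>. \<forall>z\<in>punctured.
       \<phi> z *v vector [f z, g z] = m z *s vector [f z, g z])"

(* Two inclusions have the same image iff they differ by an isomorphism L_sigma \<cong> L_sigma', that
   is, by a nowhere-vanishing section c of L_(sigma'/sigma). *)
definition same_sub_line_bundle ::
  "complex \<Rightarrow> nat \<Rightarrow>
     complex \<times> (complex \<times> complex \<Rightarrow> complex) \<times> (complex \<times> complex \<Rightarrow> complex) \<Rightarrow>
     complex \<times> (complex \<times> complex \<Rightarrow> complex) \<times> (complex \<times> complex \<Rightarrow> complex) \<Rightarrow> bool" where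
  "same_sub_line_bundle b r = (\<lambda>(\<sigma>, f, g) (\<sigma>', f', g').
     \<exists>c\<in>H0 b r (\<sigma>' / \<sigma>). \<forall>z\<in>punctured. c z \<noteq> 0 \<and> f z = c z * f' z \<and> g z = c z * g' z)"

definition invariant_sub_line_bundles_are ::
  "complex \<Rightarrow> nat \<Rightarrow> complex \<Rightarrow> complex \<Rightarrow> (complex \<times> complex \<Rightarrow> complex^2^2) \<Rightarrow>
     (complex \<times> (complex \<times> complex \<Rightarrow> complex) \<times> (complex \<times> complex \<Rightarrow> complex)) set \<Rightarrow> bool" where
  "invariant_sub_line_bundles_are b r \<mu> \<tau> \<phi> S \<longleftrightarrow>
     (\<forall>M. sub_line_bundle b r \<tau> M \<and> invariant_under b r \<mu> \<phi> M \<longleftrightarrow>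
        (\<exists>N\<in>S. same_sub_line_bundle b r M N))"


definition total_space_rel ::
  "complex \<Rightarrow> nat \<Rightarrow> complex \<Rightarrow> ((complex \<times> complex) \<times> complex) rel" where
  "total_space_rel b r \<mu> =
     (let R = {((p, v), (hopf_map b r p, \<mu> * v)) | p v. p \<in> punctured} in (R \<union> R\<inverse>)\<^sup>*)"

definition total_space ::
  "complex \<Rightarrow> nat \<Rightarrow> complex \<Rightarrow> ((complex \<times> complex) \<times> complex) set set" where
  "total_space b r \<mu> = (punctured \<times> UNIV) // total_space_rel b r \<mu>"

(* mat \<eta> is the scalar matrix \<eta> I *)
definition spectral_curve ::
  "complex \<Rightarrow> nat \<Rightarrow> complex \<Rightarrow> (complex \<times> complex \<Rightarrow> complex^2^2) \<Rightarrow>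
     ((complex \<times> complex) \<times> complex) set set" where
  "spectral_curve b r \<mu> \<phi> =
     {(p, \<eta>). p \<in> punctured \<and> det (mat \<eta> - \<phi> p) = 0} // total_space_rel b r \<mu>"

definition analytic_subset3 ::
  "((complex \<times> complex) \<times> complex) set \<Rightarrow> ((complex \<times> complex) \<times> complex) set \<Rightarrow> bool" where
  "analytic_subset3 W A \<longleftrightarrow> A \<subseteq> W \<and>
     (\<forall>x\<in>W. \<exists>U fs. open U \<and> x \<in> U \<and> U \<subseteq> W \<and> finite fs \<and> (\<forall>f\<in>fs. holo3_on U f) \<and>
        A \<inter> U = {z\<in>U. \<forall>f\<in>fs. f z = 0})"

(* The quotient map (C^2 - {0}) x C \<rightarrow> Tot(L_mu) is a local biholomorphism, so a subset Z of the
   total space is analytic iff its preimage \<Union>Z is. *)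
definition analytic_subset_tot ::
  "complex \<Rightarrow> nat \<Rightarrow> complex \<Rightarrow> ((complex \<times> complex) \<times> complex) set set \<Rightarrow> bool" where
  "analytic_subset_tot b r \<mu> Z \<longleftrightarrow>
     Z \<subseteq> total_space b r \<mu> \<and> analytic_subset3 (punctured \<times> UNIV) (\<Union>Z)"

definition irreducible_in_tot ::
  "complex \<Rightarrow> nat \<Rightarrow> complex \<Rightarrow> ((complex \<times> complex) \<times> complex) set set \<Rightarrow> bool" where
  "irreducible_in_tot b r \<mu> Z \<longleftrightarrow> analytic_subset_tot b r \<mu> Z \<and> Z \<noteq> {} \<and>
     (\<forall>Z1 Z2. analytic_subset_tot b r \<mu> Z1 \<and> analytic_subset_tot b r \<mu> Z2 \<and> Z = Z1 \<union> Z2 \<longrightarrow>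
        Z = Z1 \<or> Z = Z2)"


definition mat2 :: "complex \<Rightarrow> complex \<Rightarrow> complex \<Rightarrow> complex \<Rightarrow> complex^2^2" where
  "mat2 p q w v = vector [vector [p, q], vector [w, v]]"

datatype normal_form =
    NF1 complex complex complex
  | NF2 "complex \<times> complex \<Rightarrow> complex"
  | NF3 nat complex complex
  | NF4 nat complex "complex \<times> complex \<Rightarrow> complex"
  | NF5 nat "complex \<times> complex \<Rightarrow> complex"

fun nf_admissible :: "complex \<Rightarrow> nat \<Rightarrow> normal_form \<Rightarrow> bool" where
  "nf_admissible b r (NF1 s t u) \<longleftrightarrow> s\<^sup>2 - 4 * t\<^sup>2 * u \<noteq> 0"
| "nf_admissible b r (NF2 \<beta>) \<longleftrightarrow> \<beta> \<in> H0 b r (b ^ (2 * r))"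
| "nf_admissible b r (NF3 k u v) \<longleftrightarrow> \<not> (u = 0 \<and> v = 0)"
| "nf_admissible b r (NF4 k s \<beta>) \<longleftrightarrow>
     0 < k \<and> k < r \<and> s \<noteq> 0 \<and> \<beta> \<in> H0 b r (b ^ (r + k))"
| "nf_admissible b r (NF5 k \<alpha>) \<longleftrightarrow>
     0 < k \<and> \<not> r dvd k \<and> \<alpha> \<in> H0 b r (b ^ r) \<and> \<alpha> (1, 0) \<noteq> 0"

(* the multiplier of H *)
fun nf_bundle :: "complex \<Rightarrow> nat \<Rightarrow> normal_form \<Rightarrow> complex" where
  "nf_bundle b r (NF1 s t u) = 1"
| "nf_bundle b r (NF2 \<beta>) = b powi (- int r)"
| "nf_bundle b r (NF3 k u v) = b powi (- int (k * r))"
| "nf_bundle b r (NF4 k s \<beta>) = b powi (- int k)"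
| "nf_bundle b r (NF5 k \<alpha>) = b powi (- int k)"

fun nf_field :: "nat \<Rightarrow> normal_form \<Rightarrow> complex \<times> complex \<Rightarrow> complex^2^2" where
  "nf_field r (NF1 s t u) = (\<lambda>(x, y).
     mat2 (t * x) (s * x + u * y ^ r)
          (y ^ r) (- t * x))"
| "nf_field r (NF2 \<beta>) = (\<lambda>z.
     mat2 0 (\<beta> z)
          1 0)"
| "nf_field r (NF3 k u v) = (\<lambda>(x, y).
     mat2 (u * x + v * y ^ r) ((cnj v * x - cnj u * y ^ r) ^ (1 + k))
          0 (- u * x - v * y ^ r))"
| "nf_field r (NF4 k s \<beta>) = (\<lambda>(x, y).
     mat2 (s * x) (\<beta> (x, y))
          (y ^ (r - k)) (- s * x))"
| "nf_field r (NF5 k \<alpha>) = (\<lambda>(x, y).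
     mat2 (\<alpha> (x, y)) (y ^ (r + k))
          0 (- \<alpha> (x, y)))"

(* equality of parameters, up to the sign of t in the first family *)
fun nf_same :: "normal_form \<Rightarrow> normal_form \<Rightarrow> bool" where
  "nf_same (NF1 s t u) (NF1 s' t' u') \<longleftrightarrow> s = s' \<and> (t = t' \<or> t = - t') \<and> u = u'"
| "nf_same (NF2 \<beta>) (NF2 \<beta>') \<longleftrightarrow> (\<forall>z\<in>punctured. \<beta> z = \<beta>' z)"
| "nf_same (NF3 k u v) (NF3 k' u' v') \<longleftrightarrow> k = k' \<and> u = u' \<and> v = v'"
| "nf_same (NF4 k s \<beta>) (NF4 k' s' \<beta>') \<longleftrightarrow> k = k' \<and> s = s' \<and> (\<forall>z\<in>punctured. \<beta> z = \<beta>' z)"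
| "nf_same (NF5 k \<alpha>) (NF5 k' \<alpha>') \<longleftrightarrow> k = k' \<and> (\<forall>z\<in>punctured. \<alpha> z = \<alpha>' z)"
| "nf_same _ _ \<longleftrightarrow> False"

end

theory Submission
  imports Defs "HOL-Complex_Analysis.Complex_Analysis"
begin

text \<open>Along an orbit of the weighted scaling action, a section of a line bundle on X is a function
  g on the punctured plane with g (b t) = tau g(t). Such a g has at worst a pole at 0, so comparing
  Taylor coefficients shows that it is a monomial t^n with tau = b^n. Hence sections are weighted
  homogeneous polynomials, and no extension theorem for two variables is needed.

  For H = O the Higgs field is a pencil x A + y^r B of trace-free matrices. If A and B have a common
  eigenvector the pencil is triangular; otherwise an eigenvector e1 of A and B e1 form a basis in
  which it has the shape (1). For H of negative degree the automorphisms are triangular, and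
  one normalises the entry below the diagonal, or, if that vanishes, the entry above it modulo the
  multiples of the diagonal one. Uniqueness follows from the invariance of the determinant and the
  triangularity of automorphisms.

  The spectral curve is always a double cover given by a binary quadratic form in x and y^r. If the
  form is not a square, the curve has a polynomial parametrisation by the punctured plane, so the
  identity theorem gives irreducibility.\<close>


subsection \<open>Holomorphic functions of two and three variables\<close>

text \<open>In the existence part, non-vanishing is exploited at chosen points: at a zero of one
  entry, where another must survive, and at (1, 0), where every monomial containing y vanishes. Such
  evaluations yield all the conditions of the form \<open>c \<noteq> 0\<close> and
  \<open>s \<noteq> 0\<close>. Call n the weight of a section of (L_b)^n. Whether r divides k
  decides between families (3) and (5), because weight r + k contains a pure power of x exactly when
  it does. If it does not, the diagonal entry must have an x-term, and modulo that entry every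
  section of weight r + k is a multiple of y^(r + k). If it does, the diagonal entry may be a
  multiple of y^r, and neither a power of y nor a power of x represents the quotient for all (u, v).
  The power of the conjugate form does, since it shares no zero with u x + v y^r. Uniqueness is most
  delicate in (3) with k = 0: the determinant fixes (u, v) only up to sign, and automorphisms are
  not triangular there.\<close>

lemma open_punctured: "open punctured"
  by (simp add: punctured_def open_delete)

lemma connected_punctured: "connected punctured"
proof -
  have "punctured = - {(0, 0)}" by (auto simp: punctured_def)
  moreover have "connected (- {(0, 0) :: complex \<times> complex})"
    by (rule connected_punctured_universe) simp
  ultimately show ?thesis by (simp only:)
qed

lemma in_punctured [simp]: "(x, y) \<in> punctured \<longleftrightarrow> x \<noteq> 0 \<or> y \<noteq> 0"
  by (auto simp: punctured_def)

lemma holo2_on_subset: "holo2_on U f \<Longrightarrow> V \<subseteq> U \<Longrightarrow> holo2_on V f"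
  by (auto simp: holo2_on_def)

lemma holo2_on_const [simp]: "holo2_on U (\<lambda>_. c)"
  unfolding holo2_on_def
  by (intro ballI exI[of _ 0]) (auto intro!: derivative_eq_intros)

lemma holo2_on_fst: "holo2_on U fst"
  unfolding holo2_on_def
  by (intro ballI exI[of _ 1] exI[of _ 0]) (auto intro!: derivative_eq_intros)

lemma holo2_on_snd: "holo2_on U snd"
  unfolding holo2_on_def
  by (intro ballI exI[of _ 0] exI[of _ 1]) (auto intro!: derivative_eq_intros)

lemma holo2_on_add:
  assumes "holo2_on U f" "holo2_on U g"
  shows "holo2_on U (\<lambda>z. f z + g z)"
  unfolding holo2_on_def
proof
  fix z assume "z \<in> U"
  then obtain c1 c2 d1 d2 where
      f: "(f has_derivative (\<lambda>(h, k). c1 * h + c2 * k)) (at z)" and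
      g: "(g has_derivative (\<lambda>(h, k). d1 * h + d2 * k)) (at z)"
    using assms unfolding holo2_on_def by meson
  show "\<exists>c1 c2. ((\<lambda>z. f z + g z) has_derivative (\<lambda>(h, k). c1 * h + c2 * k)) (at z)"
    by (rule exI[of _ "c1 + d1"], rule exI[of _ "c2 + d2"],
        rule has_derivative_eq_rhs[OF has_derivative_add[OF f g]])
      (auto simp: fun_eq_iff algebra_simps)
qed

lemma holo2_on_mult:
  assumes "holo2_on U f" "holo2_on U g"
  shows "holo2_on U (\<lambda>z. f z * g z)"
  unfolding holo2_on_def
proof
  fix z assume "z \<in> U"
  then obtain c1 c2 d1 d2 where
      f: "(f has_derivative (\<lambda>(h, k). c1 * h + c2 * k)) (at z)" and
      g: "(g has_derivative (\<lambda>(h, k). d1 * h + d2 * k)) (at z)"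
    using assms unfolding holo2_on_def by meson
  show "\<exists>c1 c2. ((\<lambda>z. f z * g z) has_derivative (\<lambda>(h, k). c1 * h + c2 * k)) (at z)"
    by (rule exI[of _ "f z * d1 + c1 * g z"], rule exI[of _ "f z * d2 + c2 * g z"],
        rule has_derivative_eq_rhs[OF has_derivative_mult[OF f g]])
      (auto simp: fun_eq_iff algebra_simps)
qed

lemma holo2_on_compose:
  assumes "holo2_on U f" "\<And>z. z \<in> U \<Longrightarrow> g field_differentiable (at (f z))"
  shows "holo2_on U (\<lambda>z. g (f z))"
  unfolding holo2_on_def
proof
  fix z assume "z \<in> U"
  then obtain c1 c2 d where
      f: "(f has_derivative (\<lambda>(h, k). c1 * h + c2 * k)) (at z)" and
      g: "(g has_field_derivative d) (at (f z))"
    using assms unfolding holo2_on_def field_differentiable_def by meson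
  show "\<exists>c1 c2. ((\<lambda>z. g (f z)) has_derivative (\<lambda>(h, k). c1 * h + c2 * k)) (at z)"
    by (rule exI[of _ "d * c1"], rule exI[of _ "d * c2"],
        rule has_derivative_eq_rhs[OF has_derivative_compose[OF f g[unfolded has_field_derivative_def]]])
      (auto simp: fun_eq_iff algebra_simps)
qed

lemma holo2_on_power: "holo2_on U f \<Longrightarrow> holo2_on U (\<lambda>z. f z ^ n)"
  by (rule holo2_on_compose[where g = "\<lambda>w. w ^ n"]) (auto intro!: derivative_intros)

lemma holo2_on_uminus: "holo2_on U f \<Longrightarrow> holo2_on U (\<lambda>z. - f z)"
  by (rule holo2_on_compose[where g = uminus]) (auto intro!: derivative_intros)

lemma holo2_on_diff: "holo2_on U f \<Longrightarrow> holo2_on U g \<Longrightarrow> holo2_on U (\<lambda>z. f z - g z)"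
  using holo2_on_add[of U f "\<lambda>z. - g z"] holo2_on_uminus[of U g] by simp

lemma holo2_on_divide:
  assumes "holo2_on U f" "holo2_on U g" "\<And>z. z \<in> U \<Longrightarrow> g z \<noteq> 0"
  shows "holo2_on U (\<lambda>z. f z / g z)"
proof -
  have "holo2_on U (\<lambda>z. inverse (g z))"
    using assms by (intro holo2_on_compose[where g = inverse]) (auto intro!: derivative_intros)
  from holo2_on_mult[OF assms(1) this] show ?thesis by (simp add: divide_inverse)
qed

lemmas holo2_on_intros = holo2_on_const holo2_on_fst holo2_on_snd
  holo2_on_add holo2_on_mult holo2_on_power holo2_on_uminus holo2_on_diff

lemma holo2_on_cong:
  assumes "open U" "\<And>z. z \<in> U \<Longrightarrow> f z = g z" "holo2_on U f"
  shows "holo2_on U g"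
  unfolding holo2_on_def
proof
  fix z assume z: "z \<in> U"
  then obtain c1 c2 where "(f has_derivative (\<lambda>(h, k). c1 * h + c2 * k)) (at z)"
    using assms(3) unfolding holo2_on_def by meson
  then have "(g has_derivative (\<lambda>(h, k). c1 * h + c2 * k)) (at z)"
    by (rule has_derivative_transform_within_open[OF _ assms(1) z assms(2)])
  then show "\<exists>c1 c2. (g has_derivative (\<lambda>(h, k). c1 * h + c2 * k)) (at z)" by blast
qed

lemma holo2_on_local:
  assumes "\<And>z. z \<in> U \<Longrightarrow> \<exists>V. z \<in> V \<and> holo2_on V f"
  shows "holo2_on U f"
  using assms unfolding holo2_on_def by blast

lemma holo2_on_continuous: "holo2_on U f \<Longrightarrow> continuous_on U f"
  unfolding holo2_on_def
  by (meson continuous_at_imp_continuous_on has_derivative_continuous)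

lemma open_nonzero_holo2:
  assumes "open U" "holo2_on U f"
  shows "open {z \<in> U. f z \<noteq> 0}"
proof -
  have "{z \<in> U. f z \<noteq> 0} = U \<inter> f -` (- {0})" by auto
  then show ?thesis
    using continuous_open_preimage[OF holo2_on_continuous[OF assms(2)] assms(1) open_Compl[OF closed_singleton]]
    by (simp only:)
qed

section \<open>Restriction to holomorphic curves and the identity theorem\<close>

lemma holo2_on_curve:
  assumes f: "holo2_on U f" and "open T" "\<gamma> holomorphic_on T" "\<delta> holomorphic_on T"
    and in_U: "\<And>t. t \<in> T \<Longrightarrow> (\<gamma> t, \<delta> t) \<in> U"
  shows "(\<lambda>t. f (\<gamma> t, \<delta> t)) holomorphic_on T"
proof (rule holomorphic_on_open[THEN iffD2, OF \<open>open T\<close>], rule ballI)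
  fix t assume t: "t \<in> T"
  obtain g d where g: "(\<gamma> has_field_derivative g) (at t)" and d: "(\<delta> has_field_derivative d) (at t)"
    using assms t by (meson holomorphic_on_open)
  obtain c1 c2 where c: "(f has_derivative (\<lambda>(h, k). c1 * h + c2 * k)) (at (\<gamma> t, \<delta> t))"
    using f in_U[OF t] unfolding holo2_on_def by meson
  have "((\<lambda>t. f (\<gamma> t, \<delta> t)) has_field_derivative (c1 * g + c2 * d)) (at t)"
    unfolding has_field_derivative_def
    by (rule has_derivative_eq_rhs[OF has_derivative_compose[OF has_derivative_Pair[OF
          g[unfolded has_field_derivative_def] d[unfolded has_field_derivative_def]] c]])
      (simp add: fun_eq_iff algebra_simps)
  then show "\<exists>f'. ((\<lambda>t. f (\<gamma> t, \<delta> t)) has_field_derivative f') (at t)" by blast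
qed

text \<open>Reduced to the identity theorem in one variable by restricting to complex lines.\<close>
lemma analytic_subset_with_interior:
  assumes U: "open U" "connected U"
    and loc: "\<And>x. x \<in> U \<Longrightarrow> \<exists>V fs. open V \<and> x \<in> V \<and> V \<subseteq> U \<and> (\<forall>f\<in>fs. holo2_on V f) \<and>
        S \<inter> V = {z \<in> V. \<forall>f\<in>fs. f z = 0}"
    and W: "open W" "W \<noteq> {}" "W \<subseteq> S \<inter> U"
  shows "U \<subseteq> S"
proof -
  \<comment> \<open>The set \<open>interior S\<close> is open, so by connectedness of U it only
    remains to see that it is relatively closed in U.\<close>
  have key: "x \<in> interior S" if x: "x \<in> U" "x \<in> closure (interior S)" for x
  proof -
    from loc[OF x(1)] obtain V fs where "open V \<and> x \<in> V \<and> V \<subseteq> U \<and> (\<forall>f\<in>fs. holo2_on V f) \<and>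
        S \<inter> V = {z \<in> V. \<forall>f\<in>fs. f z = 0}"
      by (elim exE)
    then have V: "open V" "x \<in> V" "V \<subseteq> U" and fs: "\<And>f. f \<in> fs \<Longrightarrow> holo2_on V f"
      and SV: "S \<inter> V = {z \<in> V. \<forall>f\<in>fs. f z = 0}"
      by blast+
    obtain e where e: "e > 0" "ball x e \<subseteq> V" using V(1,2) by (meson openE)
    obtain w0 where w0: "w0 \<in> interior S" "w0 \<in> ball x e"
      using x(2) e(1) by (metis closure_approachable dist_commute mem_ball)
    have "ball x e \<subseteq> S"
    proof
      fix w assume w: "w \<in> ball x e"
      \<comment> \<open>The complex line with w0 at t = 0 and w at t = 1. Since w0 is interior to S,
        each local equation vanishes for t near 0, and continuation inside the ball reaches t =
        1.\<close>
      define \<gamma> where "\<gamma> = (\<lambda>t. fst w0 + t * (fst w - fst w0))"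
      define \<delta> where "\<delta> = (\<lambda>t. snd w0 + t * (snd w - snd w0))"
      define P where "P = (\<lambda>t. (\<gamma> t, \<delta> t))"
      have contP: "continuous_on UNIV P"
        unfolding P_def \<gamma>_def \<delta>_def by (intro continuous_intros)
      define T where "T = P -` ball x e"
      define T0 where "T0 = T \<inter> P -` interior S"
      have oT: "open T" unfolding T_def by (intro open_vimage contP) auto
      have oT0: "open T0" unfolding T0_def by (intro open_Int oT open_vimage contP) auto
      \<comment> \<open>The line is affine in t, so its part inside the ball is convex; this
        supplies the connectedness that the continuation needs.\<close>
      have "convex T"
      proof (rule convexI)
        fix s t :: complex and u v :: real
        assume st: "s \<in> T" "t \<in> T" and uv: "0 \<le> u" "0 \<le> v" "u + v = 1"
        have u: "u = 1 - v" using uv by simp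
        have "P (u *\<^sub>R s + v *\<^sub>R t) = u *\<^sub>R P s + v *\<^sub>R P t"
          unfolding P_def \<gamma>_def \<delta>_def u by (simp add: scaleR_conv_of_real algebra_simps)
        moreover have "u *\<^sub>R P s + v *\<^sub>R P t \<in> ball x e"
          using st uv convexD[OF convex_ball] unfolding T_def by blast
        ultimately show "u *\<^sub>R s + v *\<^sub>R t \<in> T" by (simp add: T_def)
      qed
      then have cT: "connected T" by (rule convex_connected)
      have P01: "P 0 = w0" "P 1 = w" by (simp_all add: P_def \<gamma>_def \<delta>_def)
      have "f w = 0" if f: "f \<in> fs" for f
      proof -
        have "(\<lambda>t. f (\<gamma> t, \<delta> t)) holomorphic_on T"
          using e(2) by (intro holo2_on_curve[OF fs[OF f] oT])
            (auto simp: T_def P_def \<gamma>_def \<delta>_def intro!: holomorphic_intros)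
        then have "(\<lambda>t. f (P t)) holomorphic_on T" by (simp add: P_def)
        moreover have "f (P t) = 0" if "t \<in> T0" for t
          using that f SV e(2) interior_subset[of S] unfolding T0_def T_def by blast
        moreover have "0 \<in> T0" "1 \<in> T" using w w0 P01 by (auto simp: T0_def T_def)
        ultimately have "f (P 1) = 0"
          using analytic_continuation_open[OF oT0 oT _ cT, of "\<lambda>t. f (P t)" "\<lambda>_. 0" 1]
          by (auto simp: T0_def)
        then show ?thesis using P01 by simp
      qed
      then show "w \<in> S" using SV w e(2) by blast
    qed
    then show ?thesis using e(1) by (meson centre_in_ball interior_maximal open_ball subsetD)
  qed
  have "interior S \<inter> U = {} \<or> (- closure (interior S)) \<inter> U = {}"
  proof (rule connectedD[OF U(2)])
    show "U \<subseteq> interior S \<union> - closure (interior S)" using key by blast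
    show "interior S \<inter> - closure (interior S) \<inter> U = {}" using closure_subset by blast
  qed auto
  moreover have "W \<subseteq> interior S \<inter> U" using W by (simp add: interior_maximal)
  ultimately have "U \<subseteq> closure (interior S)" using W(2) by blast
  then show ?thesis using key interior_subset by blast
qed

lemma holo2_identity:
  assumes "open U" "connected U" "holo2_on U f" "open W" "W \<noteq> {}" "W \<subseteq> U"
    and "\<And>z. z \<in> W \<Longrightarrow> f z = 0" "z \<in> U"
  shows "f z = 0"
proof -
  have "U \<subseteq> {z. f z = 0}"
  proof (rule analytic_subset_with_interior[OF assms(1,2) _ assms(4,5)])
    show "\<exists>V fs. open V \<and> x \<in> V \<and> V \<subseteq> U \<and> (\<forall>f\<in>fs. holo2_on V f) \<and>
        {z. f z = 0} \<inter> V = {z \<in> V. \<forall>f\<in>fs. f z = 0}" if "x \<in> U" for x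
      using that assms(1,3) by (intro exI[of _ U] exI[of _ "{f}"]) auto
  qed (use assms in auto)
  then show ?thesis using assms(8) by blast
qed


subsection \<open>Sections of line bundles on a Hopf surface\<close>

lemma holo2_on_sum:
  "(\<And>i. i \<in> I \<Longrightarrow> holo2_on U (f i)) \<Longrightarrow> holo2_on U (\<lambda>z. \<Sum>i\<in>I. f i z)"
  by (induction I rule: infinite_finite_induct) (auto intro: holo2_on_add)

text \<open>The set y \<noteq> 0 is open and nonempty, so the identity theorem extends an equality
  from there. On it the scaling action can bring every point to y = 1.\<close>

lemma holo2_eq_on_punctured:
  assumes "holo2_on punctured f" "holo2_on punctured g"
    and eq: "\<And>x y. y \<noteq> 0 \<Longrightarrow> f (x, y) = g (x, y)" and z: "z \<in> punctured"
  shows "f z = g z"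
proof -
  have "open {z :: complex \<times> complex. snd z \<noteq> 0}"
    by (intro open_Collect_neq continuous_intros)
  moreover have "(0, 1) \<in> {z :: complex \<times> complex. snd z \<noteq> 0}" by simp
  moreover have "{z :: complex \<times> complex. snd z \<noteq> 0} \<subseteq> punctured" by auto
  moreover have "f w - g w = 0" if "w \<in> {z. snd z \<noteq> 0}" for w
    using eq that by (cases w) simp
  ultimately have "f z - g z = 0"
    using holo2_identity[OF open_punctured connected_punctured holo2_on_diff[OF assms(1,2)]] z
    by blast
  then show ?thesis by simp
qed

locale hopf_surface =
  fixes b :: complex and r :: nat
  assumes b_pos: "0 < cmod b" and b_less: "cmod b < 1" and r_gt_1: "r > 1"
begin

lemma b_nz [simp]: "b \<noteq> 0"
  using b_pos by auto

lemma r_nz [simp]: "r \<noteq> 0" "0 < r"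
  using r_gt_1 by auto

text \<open>The moduli |b|^m strictly decrease in m. This makes the weight of a bundle well defined
  and separates Taylor coefficients below.\<close>

lemma powi_b_inj: "b powi m = b powi n \<longleftrightarrow> m = n"
proof
  assume "b powi m = b powi n"
  then have eq: "cmod b powi m = cmod b powi n" by (metis norm_power_int)
  show "m = n"
    using power_int_strict_decreasing[of m n "cmod b"] power_int_strict_decreasing[of n m "cmod b"]
      b_pos b_less eq by (cases m n rule: linorder_cases) auto
qed simp

lemma hopf_map_punctured: "z \<in> punctured \<Longrightarrow> hopf_map b r z \<in> punctured"
  by (cases z) (auto simp: hopf_map_def)

lemma hopf_map_Pair [simp]: "hopf_map b r (x, y) = (b ^ r * x, b * y)"
  by (simp add: hopf_map_def)

section \<open>Sums, products and monomials of sections\<close>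

lemma H0_holo: "s \<in> H0 b r \<tau> \<Longrightarrow> holo2_on punctured s"
  by (simp add: H0_def)

lemma H0_cong:
  assumes "s \<in> H0 b r \<tau>" "\<And>z. z \<in> punctured \<Longrightarrow> s z = s' z"
  shows "s' \<in> H0 b r \<tau>"
proof -
  have "holo2_on punctured s'"
    using holo2_on_cong[OF open_punctured assms(2) H0_holo[OF assms(1)]] by simp
  moreover have "s' (hopf_map b r z) = \<tau> * s' z" if "z \<in> punctured" for z
    using assms(1) assms(2)[OF that] assms(2)[OF hopf_map_punctured[OF that]] that
    by (simp add: H0_def)
  ultimately show ?thesis by (simp add: H0_def)
qed

lemma H0_zero [simp]: "(\<lambda>_. 0) \<in> H0 b r \<tau>"
  by (simp add: H0_def)

lemma H0_const [simp]: "(\<lambda>_. c) \<in> H0 b r 1"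
  by (simp add: H0_def)

lemma H0_add: "s \<in> H0 b r \<tau> \<Longrightarrow> s' \<in> H0 b r \<tau> \<Longrightarrow> (\<lambda>z. s z + s' z) \<in> H0 b r \<tau>"
  by (simp add: H0_def holo2_on_add algebra_simps)

lemma H0_mult: "s \<in> H0 b r \<tau> \<Longrightarrow> s' \<in> H0 b r \<sigma> \<Longrightarrow> (\<lambda>z. s z * s' z) \<in> H0 b r (\<tau> * \<sigma>)"
  by (simp add: H0_def holo2_on_mult)

lemma H0_cmult: "s \<in> H0 b r \<tau> \<Longrightarrow> (\<lambda>z. c * s z) \<in> H0 b r \<tau>"
  using H0_mult[OF H0_const] by simp

lemma H0_uminus: "s \<in> H0 b r \<tau> \<Longrightarrow> (\<lambda>z. - s z) \<in> H0 b r \<tau>"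
  using H0_cmult[of s \<tau> "-1"] by simp

lemma H0_diff: "s \<in> H0 b r \<tau> \<Longrightarrow> s' \<in> H0 b r \<tau> \<Longrightarrow> (\<lambda>z. s z - s' z) \<in> H0 b r \<tau>"
  using H0_add[OF _ H0_uminus, of s \<tau> s'] by simp

lemma H0_power: "s \<in> H0 b r \<tau> \<Longrightarrow> (\<lambda>z. s z ^ n) \<in> H0 b r (\<tau> ^ n)"
  by (simp add: H0_def holo2_on_power power_mult_distrib)

lemma H0_sum: "(\<And>i. i \<in> I \<Longrightarrow> s i \<in> H0 b r \<tau>) \<Longrightarrow> (\<lambda>z. \<Sum>i\<in>I. s i z) \<in> H0 b r \<tau>"
  by (induction I rule: infinite_finite_induct) (auto intro: H0_add)

lemma H0_fst: "fst \<in> H0 b r (b ^ r)"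
  by (auto simp: H0_def holo2_on_fst hopf_map_def split: prod.splits)

lemma H0_snd: "snd \<in> H0 b r b"
  by (auto simp: H0_def holo2_on_snd hopf_map_def split: prod.splits)

lemma H0_monomial:
  assumes "n = r * i + j"
  shows "(\<lambda>(x, y). c * x ^ i * y ^ j) \<in> H0 b r (b ^ n)"
  using H0_cmult[OF H0_mult[OF H0_power[OF H0_fst] H0_power[OF H0_snd]], of c i j]
  by (simp add: assms case_prod_beta' power_add power_mult mult.assoc)

text \<open>Restricted to an orbit of the weighted scaling action, a section becomes such a function g;
  its pole at 0 has finite order because |g| is bounded on a fundamental annulus.\<close>
lemma equivariant_on_punctured_plane:
  assumes g: "g holomorphic_on - {0}" and fe: "\<And>t. t \<noteq> 0 \<Longrightarrow> g (b * t) = \<tau> * g t" and "\<tau> \<noteq> 0"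
  shows "(\<forall>t. t \<noteq> 0 \<longrightarrow> g t = 0) \<or>
    (\<exists>n::int. \<tau> = b powi n \<and> (\<forall>t. t \<noteq> 0 \<longrightarrow> g t = t powi n * g 1))"
proof -
  \<comment> \<open>Multiplying g by t^N replaces the multiplier \<tau> by b^N \<tau>. N is so large
    that this has modulus at most 1; then the values cannot grow along t, b t, b^2 t, ...\<close>
  obtain N where "cmod b ^ N < 1 / cmod \<tau>"
    using real_arch_pow_inv[of "1 / cmod \<tau>" "cmod b"] b_less \<open>\<tau> \<noteq> 0\<close> by auto
  then have N: "cmod (b ^ N * \<tau>) \<le> 1"
    using \<open>\<tau> \<noteq> 0\<close> by (simp add: norm_mult norm_power field_simps)
  define \<mu> where "\<mu> = b ^ N * \<tau>"
  define h where "h = (\<lambda>t. t ^ N * g t)"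
  have hfe: "h (b * t) = \<mu> * h t" if "t \<noteq> 0" for t
    using fe[OF that] by (simp add: h_def \<mu>_def power_mult_distrib)
  have hfe_pow: "h (b ^ k * t) = \<mu> ^ k * h t" if "t \<noteq> 0" for t k
  proof (induction k)
    case (Suc k)
    then show ?case using hfe[of "b ^ k * t"] that by (simp add: mult.assoc)
  qed simp
  have holh: "h holomorphic_on - {0}"
    unfolding h_def by (intro holomorphic_intros g)
  \<comment> \<open>Every t with 0 < |t| <= 1 is b^k t' with t' in this annulus, so the maximum of
    |h| on it bounds h near 0 and the singularity is removable.\<close>
  define K where "K = cball (0::complex) 1 - ball 0 (cmod b)"
  have "compact K" unfolding K_def by (intro compact_diff) auto
  moreover have "continuous_on K h"
    using holomorphic_on_imp_continuous_on[OF holh]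
    by (rule continuous_on_subset) (use b_pos in \<open>auto simp: K_def\<close>)
  ultimately have "bounded (h ` K)"
    by (intro compact_imp_bounded compact_continuous_image)
  then obtain B where "\<forall>w\<in>h ` K. cmod w \<le> B"
    unfolding bounded_iff by (elim exE)
  then have B: "cmod (h t) \<le> B" if "t \<in> K" for t
    using that by (simp only: ball_simps)
  have bound: "cmod (h t) \<le> B" if t: "t \<noteq> 0" "cmod t \<le> 1" for t
  proof -
    obtain n where n: "cmod b ^ n < cmod t" using real_arch_pow_inv[of "cmod t" "cmod b"] b_less t by auto
    \<comment> \<open>The exponent with |b|^(k + 1) < |t| <= |b|^k, which puts t / b^k into
      K.\<close>
    define k where "k = (LEAST n. cmod b ^ Suc n < cmod t)"
    have "cmod b ^ Suc n \<le> cmod b ^ n" using b_pos b_less by (intro power_decreasing) auto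
    then have ex: "cmod b ^ Suc n < cmod t" using n by (rule le_less_trans)
    have k: "cmod b ^ Suc k < cmod t" unfolding k_def by (rule LeastI[of "\<lambda>n. cmod b ^ Suc n < cmod t", OF ex])
    have k': "cmod t \<le> cmod b ^ k"
    proof (cases k)
      case 0 then show ?thesis using t by simp
    next
      case (Suc m)
      then have "\<not> cmod b ^ Suc m < cmod t" using not_less_Least[of m "\<lambda>n. cmod b ^ Suc n < cmod t"]
        unfolding k_def[symmetric] by simp
      then show ?thesis using Suc by simp
    qed
    define t' where "t' = t / b ^ k"
    have tt: "t = b ^ k * t'" "t' \<noteq> 0" using t by (simp_all add: t'_def)
    have "cmod b \<le> cmod t'" "cmod t' \<le> 1"
      using k k' b_pos by (simp_all add: t'_def norm_divide norm_power field_simps)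
    then have "t' \<in> K" by (simp add: K_def)
    moreover have "cmod (h t) \<le> cmod (h t')"
      unfolding tt(1) hfe_pow[OF tt(2)] norm_mult norm_power
      using N by (intro mult_left_le_one_le) (auto simp: \<mu>_def power_le_one)
    ultimately show ?thesis using B by fastforce
  qed
  have "\<exists>H. H holomorphic_on UNIV \<and> (\<forall>z\<in>UNIV - {0}. H z = h z)"
  proof (subst holomorphic_on_extend_bounded)
    show "h holomorphic_on UNIV - {0}" using holh by (simp add: Compl_eq_Diff_UNIV)
    show "\<exists>B. \<forall>\<^sub>F z in at 0. cmod (h z) \<le> B"
      using bound by (intro exI[of _ B]) (auto simp: eventually_at intro!: exI[of _ 1])
  qed auto
  then obtain H where H: "H holomorphic_on UNIV" and Hh: "\<And>z. z \<noteq> 0 \<Longrightarrow> H z = h z" by auto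
  have Hfe: "H (b * z) = \<mu> * H z" for z
  proof (rule analytic_continuation_open[of "- {0}" UNIV "\<lambda>z. H (b * z)" "\<lambda>z. \<mu> * H z"])
    show "(\<lambda>z. H (b * z)) holomorphic_on UNIV" "(\<lambda>z. \<mu> * H z) holomorphic_on UNIV"
      using H by (auto intro!: holomorphic_intros holomorphic_on_compose[of "\<lambda>z. b * z" UNIV H, unfolded o_def]
          intro: holomorphic_on_subset)
    show "- {0 :: complex} \<noteq> {}" by (metis Compl_iff empty_iff singletonD zero_neq_one)
  qed (use Hh hfe in auto)
  \<comment> \<open>Differentiating H(b z) = \<mu> H(z) j times at 0 gives b^j D j = \<mu> D j. The
    powers of b are distinct, so at most one coefficient survives.\<close>
  define D where "D = (\<lambda>j. (deriv ^^ j) H 0)"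
  have D: "b ^ j = \<mu>" if "D j \<noteq> 0" for j
  proof -
    have "b ^ j * D j = (deriv ^^ j) (\<lambda>w. H (b * w)) 0"
      using higher_deriv_compose_linear[OF H, of UNIV 0 b j] by (simp add: D_def)
    also have "\<dots> = \<mu> * D j"
      unfolding Hfe D_def using higher_deriv_cmult[OF H, of 0 j \<mu>] by simp
    finally show ?thesis using that by simp
  qed
  have ps: "(\<lambda>j. D j / fact j * w ^ j) sums H w" for w
    using holomorphic_power_series[of H 0 "cmod w + 1" w] H
    by (auto simp: D_def intro: holomorphic_on_subset)
  show ?thesis
  proof (cases "\<exists>m. D m \<noteq> 0")
    case False
    then have "H w = 0" for w using ps[of w] sums_unique2[of "\<lambda>_. 0"] by auto
    then show ?thesis using Hh by (auto simp: h_def)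
  next
    case True
    then obtain m where m: "D m \<noteq> 0" by blast
    have "D j = 0" if "j \<noteq> m" for j
    proof (rule ccontr)
      assume "D j \<noteq> 0"
      then have "b powi int j = b powi int m" using D m by simp
      then show False using that by (simp only: powi_b_inj)
    qed
    then have "(\<lambda>j. D j / fact j * w ^ j) = (\<lambda>j. if j = m then D m / fact m * w ^ m else 0)" for w
      by auto
    then have Hw: "H w = D m / fact m * w ^ m" for w
      using sums_unique2[OF ps[of w]] sums_single[of m "\<lambda>j. D m / fact m * w ^ m"] by simp
    \<comment> \<open>Undoes the factor t^N; the exponent may be negative.\<close>
    define n where "n = int m - int N"
    have "b ^ N * \<tau> = b ^ m" using D[OF m] by (simp add: \<mu>_def)
    then have "\<tau> = b powi n" by (simp add: n_def power_int_diff field_simps)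
    moreover have "g t = t powi n * g 1" if "t \<noteq> 0" for t
    proof -
      have "t ^ N * g t = D m / fact m * t ^ m" using Hw[of t] Hh[OF that] by (simp add: h_def)
      also have "D m / fact m = g 1" using Hw[of 1] Hh[of 1] by (simp add: h_def)
      finally show ?thesis using that by (simp add: n_def power_int_diff field_simps)
    qed
    ultimately show ?thesis by blast
  qed
qed

section \<open>Weighted homogeneity and expansion into monomials\<close>

lemma H0_on_orbit:
  assumes s: "s \<in> H0 b r \<tau>" and "\<tau> \<noteq> 0" and z: "(x, y) \<in> punctured"
  shows "(\<forall>t. t \<noteq> 0 \<longrightarrow> s (t ^ r * x, t * y) = 0) \<or>
    (\<exists>n::int. \<tau> = b powi n \<and> (\<forall>t. t \<noteq> 0 \<longrightarrow> s (t ^ r * x, t * y) = t powi n * s (x, y)))"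
proof -
  have "(\<lambda>t. s (t ^ r * x, t * y)) holomorphic_on - {0}"
    using z by (intro holo2_on_curve[OF H0_holo[OF s]] holomorphic_intros) auto
  moreover have "s ((b * t) ^ r * x, (b * t) * y) = \<tau> * s (t ^ r * x, t * y)" if "t \<noteq> 0" for t
  proof -
    have "s (hopf_map b r (t ^ r * x, t * y)) = \<tau> * s (t ^ r * x, t * y)"
      using s z that by (simp add: H0_def del: hopf_map_Pair)
    then show ?thesis by (simp add: power_mult_distrib mult.assoc)
  qed
  ultimately show ?thesis
    using equivariant_on_punctured_plane[of "\<lambda>t. s (t ^ r * x, t * y)" \<tau>] \<open>\<tau> \<noteq> 0\<close> by simp
qed

lemma H0_trivial:
  assumes "s \<in> H0 b r \<tau>" "\<tau> \<noteq> 0" "\<And>n. \<tau> \<noteq> b powi n" "z \<in> punctured"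
  shows "s z = 0"
proof (cases z)
  case (Pair x y)
  then show ?thesis using H0_on_orbit[OF assms(1,2), of x y] assms(3,4) by (auto dest: spec[of _ 1])
qed

lemma H0_weighted:
  assumes "s \<in> H0 b r (b powi n)" "(x, y) \<in> punctured" "t \<noteq> 0"
  shows "s (t ^ r * x, t * y) = t powi n * s (x, y)"
  using H0_on_orbit[OF assms(1) _ assms(2)]
proof
  assume 0: "\<forall>t. t \<noteq> 0 \<longrightarrow> s (t ^ r * x, t * y) = 0"
  from spec[OF 0, of 1] have "s (x, y) = 0" by simp
  then show ?thesis using spec[OF 0, of t] assms(3) by simp
qed (use assms(3) in \<open>auto simp: powi_b_inj\<close>)

text \<open>On the line y = 1 the section restricts to an entire function u. Scaling carries (X, 1)
  with X large to a point (1, y) with |y| <= 1, where s is bounded by compactness. Hence u grows at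
  most like |X|^(n / r), and Cauchy's estimates leave only the coefficients with r i <= n. Scaling
  back recovers s where y \<noteq> 0.\<close>

lemma H0_expansion:
  assumes s: "s \<in> H0 b r (b powi n)"
  obtains c where "\<And>x y. (x, y) \<in> punctured \<Longrightarrow>
    s (x, y) = (\<Sum>i | int (r * i) \<le> n. c i * x ^ i * y ^ nat (n - int (r * i)))"
proof -
  define I where "I = {i. int (r * i) \<le> n}"
  have "I \<subseteq> {..nat n}"
  proof
    fix i assume "i \<in> I"
    then have "int (1 * i) \<le> n"
      using mult_right_mono[of 1 "int r" "int i"] r_gt_1 unfolding I_def by (simp del: of_nat_Suc)
    then show "i \<in> {..nat n}" by auto
  qed
  then have finI: "finite I" by (rule finite_subset) simp
  define u where "u = (\<lambda>X. s (X, 1))"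
  have holu: "u holomorphic_on UNIV"
    unfolding u_def by (intro holo2_on_curve[OF H0_holo[OF s]] holomorphic_intros) auto
  define D where "D = (\<lambda>j. (deriv ^^ j) u 0)"
  have "compact ({1 :: complex} \<times> cball (0 :: complex) 1)" by (intro compact_Times) auto
  moreover have "continuous_on ({1} \<times> cball 0 1) s"
    using holo2_on_continuous[OF H0_holo[OF s]] by (rule continuous_on_subset) auto
  ultimately have "bounded (s ` ({1} \<times> cball 0 1))"
    by (intro compact_imp_bounded compact_continuous_image)
  then obtain B where "\<forall>w\<in>s ` ({1} \<times> cball 0 1). cmod w \<le> B"
    unfolding bounded_iff by (elim exE)
  then have B: "cmod (s z) \<le> B" if "z \<in> {1} \<times> cball 0 1" for z
    using that by (simp only: ball_simps)
  have "0 \<le> cmod (s (1, 0))" by simp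
  also have "\<dots> \<le> B" by (rule B) simp
  finally have "0 \<le> B" .
  have D0: "D i = 0" if "i \<notin> I" for i
  proof (rule ccontr)
    assume "D i \<noteq> 0"
    \<comment> \<open>The circle has radius \<rho>^r, so that the growth bound is the integral power
      \<rho>^n. As \<open>i \<notin> I\<close>, the exponent n - r i is at most -1 and the estimate
      decays like 1 / \<rho>.\<close>
    have le: "cmod (D i) * \<rho> \<le> fact i * B" if "\<rho> \<ge> 1" for \<rho>
    proof -
      have "cmod (D i) \<le> fact i * (B * \<rho> powi n) / (\<rho> ^ r) ^ i"
        unfolding D_def
      proof (rule Cauchy_inequality)
        show "u holomorphic_on ball 0 (\<rho> ^ r)" "continuous_on (cball 0 (\<rho> ^ r)) u"
          using holu by (auto intro: holomorphic_on_subset holomorphic_on_imp_continuous_on)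
        show "0 < \<rho> ^ r" using \<open>\<rho> \<ge> 1\<close> by simp
        show "cmod (u X) \<le> B * \<rho> powi n" if X: "cmod (0 - X) = \<rho> ^ r" for X
        proof -
          \<comment> \<open>Scaling by an r-th root y of 1 / X moves (X, 1) to (1, y), and |y| = 1 /
            \<rho>.\<close>
          obtain y where y: "inverse X = y ^ r" using exists_complex_root[of r "inverse X"] by auto
          have "X \<noteq> 0" using X \<open>\<rho> \<ge> 1\<close> by auto
          have "y \<noteq> 0"
          proof
            assume "y = 0"
            then have "inverse X = 0" using y r_gt_1 by (simp add: power_0_left)
            then show False using \<open>X \<noteq> 0\<close> by simp
          qed
          have "cmod (inverse X) = inverse \<rho> ^ r" unfolding norm_inverse power_inverse using X by simp
          then have "cmod y ^ r = inverse \<rho> ^ r" using y by (simp add: norm_power)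
          then have ny: "cmod y = inverse \<rho>"
          proof (rule power_eq_imp_eq_base)
            show "0 \<le> inverse \<rho>" using \<open>\<rho> \<ge> 1\<close> by simp
          qed simp_all
          have "s (y ^ r * X, y * 1) = y powi n * u X"
            unfolding u_def using H0_weighted[OF s, of X 1 y] \<open>y \<noteq> 0\<close> by simp
          moreover have "y ^ r * X = 1" using y[symmetric] \<open>X \<noteq> 0\<close> by simp
          ultimately have "s (1, y) = y powi n * u X" by simp
          then have "u X = s (1, y) * inverse (y powi n)" using \<open>y \<noteq> 0\<close> by simp
          then have "cmod (u X) = cmod (s (1, y)) * \<rho> powi n"
            by (simp add: norm_mult norm_inverse norm_power_int ny power_int_inverse)
          also have "\<dots> \<le> B * \<rho> powi n"
            using B[of "(1, y)"] \<open>\<rho> \<ge> 1\<close> ny by (intro mult_right_mono) (auto simp: inverse_le_1_iff)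
          finally show ?thesis .
        qed
      qed
      also have "(\<rho> ^ r) ^ i = \<rho> powi int (r * i)"
        unfolding power_int_of_nat by (rule power_mult[symmetric])
      also have "fact i * (B * \<rho> powi n) / \<rho> powi int (r * i) = fact i * B * \<rho> powi (n - int (r * i))"
        using \<open>\<rho> \<ge> 1\<close> by (simp add: power_int_diff)
      also have "\<dots> \<le> fact i * B * \<rho> powi (- 1)"
        using \<open>0 \<le> B\<close> \<open>\<rho> \<ge> 1\<close> that \<open>i \<notin> I\<close>
        by (intro mult_left_mono power_int_increasing) (auto simp: I_def)
      finally show ?thesis using \<open>\<rho> \<ge> 1\<close> by (simp add: power_int_minus field_simps)
    qed
    \<comment> \<open>For this \<rho> the left side equals \<open>fact i * B\<close> plus |D i|, a
      contradiction.\<close>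
    have "cmod (D i) * (1 + fact i * B / cmod (D i)) \<le> fact i * B"
      using \<open>0 \<le> B\<close> by (intro le) auto
    then have "cmod (D i) + fact i * B \<le> fact i * B"
      using \<open>D i \<noteq> 0\<close> by (simp add: distrib_left)
    then show False using \<open>D i \<noteq> 0\<close> by simp
  qed
  define c where "c = (\<lambda>i. D i / fact i)"
  have u: "u X = (\<Sum>i\<in>I. c i * X ^ i)" for X
  proof -
    have "(\<lambda>j. D j / fact j * X ^ j) sums u X"
      using holomorphic_power_series[of u 0 "cmod X + 1" X] holu
      by (auto simp: D_def intro: holomorphic_on_subset)
    moreover have "(\<lambda>j. D j / fact j * X ^ j) sums (\<Sum>i\<in>I. D i / fact i * X ^ i)"
      using finI D0 by (intro sums_finite) auto
    ultimately show ?thesis unfolding c_def using sums_unique2 by blast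
  qed
  define p where "p = (\<lambda>z::complex \<times> complex. \<Sum>i\<in>I. c i * fst z ^ i * snd z ^ nat (n - int (r * i)))"
  have "s z = p z" if "z \<in> punctured" for z
  proof (rule holo2_eq_on_punctured[OF H0_holo[OF s] _ _ that])
    show "holo2_on punctured p"
      unfolding p_def by (intro holo2_on_sum holo2_on_intros)
    show "s (x, y) = p (x, y)" if "y \<noteq> 0" for x y
    proof -
      have "s (y ^ r * (x / y ^ r), y * 1) = y powi n * u (x / y ^ r)"
        unfolding u_def using H0_weighted[OF s, of "x / y ^ r" 1 y] that by simp
      then have "s (x, y) = y powi n * u (x / y ^ r)" using that by simp
      also have "\<dots> = p (x, y)"
        unfolding u p_def sum_distrib_left
      proof (rule sum.cong)
        fix i assume i: "i \<in> I"
        have "y ^ nat (n - int (r * i)) = y powi (n - int (r * i))"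
          using i by (simp add: I_def power_int_def)
        also have "\<dots> = y powi n / y powi int (r * i)" using that by (simp add: power_int_diff)
        also have "y powi int (r * i) = (y ^ r) ^ i"
          unfolding power_int_of_nat by (rule power_mult)
        finally show "y powi n * (c i * (x / y ^ r) ^ i) = c i * fst (x, y) ^ i * snd (x, y) ^ nat (n - int (r * i))"
          by (simp add: power_divide)
      qed simp
      finally show ?thesis .
    qed
  qed
  then show ?thesis using that[of c] by (simp add: p_def I_def)
qed

text \<open>The index set of the expansion is empty. This kills the lower left entry of every
  automorphism when deg H < 0, and that of the Higgs field when k > r.\<close>

lemma H0_negative:
  assumes "s \<in> H0 b r (b powi n)" "n < 0" "z \<in> punctured"
  shows "s z = 0"
proof (cases z)
  case (Pair x y)
  have "{i. int (r * i) \<le> n} = {}" using assms(2) by (smt (verit) empty_Collect_eq of_nat_0_le_iff)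
  then show ?thesis using H0_expansion[OF assms(1)] assms(3) Pair by (metis sum.empty)
qed

lemma H0_nat_expansion:
  assumes s: "s \<in> H0 b r (b ^ n)"
  obtains c where "\<And>x y. (x, y) \<in> punctured \<Longrightarrow>
    s (x, y) = (\<Sum>i | r * i \<le> n. c i * x ^ i * y ^ (n - r * i))"
proof -
  have "s \<in> H0 b r (b powi int n)" using s by simp
  then obtain c where c: "\<And>x y. (x, y) \<in> punctured \<Longrightarrow>
    s (x, y) = (\<Sum>i | int (r * i) \<le> int n. c i * x ^ i * y ^ nat (int n - int (r * i)))"
    using H0_expansion by blast
  have "nat (int n - int (r * i)) = n - r * i" for i by (metis nat_int of_nat_diff_if nat_minus_as_int)
  then show ?thesis using that[of c] c by (simp only: of_nat_le_iff) 
qed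

lemma H0_small:
  assumes "s \<in> H0 b r (b ^ n)" "n < r"
  obtains c where "\<And>x y. (x, y) \<in> punctured \<Longrightarrow> s (x, y) = c * y ^ n"
proof -
  obtain c where "\<And>x y. (x, y) \<in> punctured \<Longrightarrow>
    s (x, y) = (\<Sum>i | r * i \<le> n. c i * x ^ i * y ^ (n - r * i))" using H0_nat_expansion[OF assms(1)] by blast
  moreover have "{i. r * i \<le> n} = {0}"
  proof -
    have "i = 0" if "r * i \<le> n" for i using that assms(2) by (cases i) auto
    then show ?thesis by auto
  qed
  ultimately show ?thesis using that[of "c 0"] by simp
qed

lemma H0_middle:
  assumes "s \<in> H0 b r (b ^ n)" "r \<le> n" "n < 2 * r"
  obtains c d where "\<And>x y. (x, y) \<in> punctured \<Longrightarrow> s (x, y) = c * x * y ^ (n - r) + d * y ^ n"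
proof -
  obtain c where "\<And>x y. (x, y) \<in> punctured \<Longrightarrow>
    s (x, y) = (\<Sum>i | r * i \<le> n. c i * x ^ i * y ^ (n - r * i))" using H0_nat_expansion[OF assms(1)] by blast
  moreover have "{i. r * i \<le> n} = {0, 1}"
  proof -
    have "i \<le> 1" if "r * i \<le> n" for i
    proof (rule ccontr)
      assume "\<not> i \<le> 1"
      then have "r * 2 \<le> r * i" by (intro mult_le_mono2) auto
      then have "r * 2 \<le> n" using that by (rule le_trans)
      then show False using assms(3) by simp
    qed
    then show ?thesis using assms(2) by (auto simp: le_Suc_eq)
  qed
  ultimately show ?thesis using that[of "c 1" "c 0"] by (simp add: add.commute)
qed

lemma H0_degree_r:
  assumes "s \<in> H0 b r (b ^ r)"
  obtains c d where "\<And>x y. (x, y) \<in> punctured \<Longrightarrow> s (x, y) = c * x + d * y ^ r"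
  using H0_middle[OF assms] r_gt_1 by auto

lemma H0_degree_2r:
  assumes "s \<in> H0 b r (b ^ (2 * r))"
  obtains a c d where "\<And>x y. (x, y) \<in> punctured \<Longrightarrow> s (x, y) = a * x\<^sup>2 + c * x * y ^ r + d * (y ^ r)\<^sup>2"
proof -
  obtain c where "\<And>x y. (x, y) \<in> punctured \<Longrightarrow>
    s (x, y) = (\<Sum>i | r * i \<le> 2 * r. c i * x ^ i * y ^ (2 * r - r * i))" using H0_nat_expansion[OF assms] by blast
  moreover have "{i. r * i \<le> 2 * r} = {0, 1, 2}" by auto
  ultimately show ?thesis using that[of "c 2" "c 1" "c 0"]
    by (simp add: power_mult[symmetric] mult.commute add_ac)
qed

lemma H0_linear: "(\<lambda>(x, y). u * x + v * y ^ r) \<in> H0 b r (b ^ r)"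
  using H0_add[OF H0_monomial[of r 1 0 u] H0_monomial[of r 0 r v]] by (simp add: case_prod_beta')

end


subsection \<open>Two-by-two matrices\<close>

lemma mat2_nth [simp]:
  "mat2 p q w v $ 1 $ 1 = p" "mat2 p q w v $ 1 $ 2 = q"
  "mat2 p q w v $ 2 $ 1 = w" "mat2 p q w v $ 2 $ 2 = v"
  by (simp_all add: mat2_def)

lemma eq_mat2_iff: "A = mat2 p q w v \<longleftrightarrow> A $ 1 $ 1 = p \<and> A $ 1 $ 2 = q \<and> A $ 2 $ 1 = w \<and> A $ 2 $ 2 = v"
  by (simp add: vec_eq_iff forall_2)

lemma mat2_eq_iff [simp]: "mat2 p q w v = mat2 p' q' w' v' \<longleftrightarrow> p = p' \<and> q = q' \<and> w = w' \<and> v = v'"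
  by (simp add: eq_mat2_iff)

lemma mat2_eq_0_iff [simp]: "mat2 p q w v = 0 \<longleftrightarrow> p = 0 \<and> q = 0 \<and> w = 0 \<and> v = 0"
  by (simp add: vec_eq_iff forall_2)

lemma mat2_mult [simp]:
  "mat2 p q w v ** mat2 p' q' w' v' =
     mat2 (p * p' + q * w') (p * q' + q * v') (w * p' + v * w') (w * q' + v * v')"
  by (simp add: eq_mat2_iff matrix_matrix_mult_def sum_2)

lemma det_mat2 [simp]: "det (mat2 p q w v) = p * v - q * w"
  by (simp add: det_2)

lemma trace_mat2 [simp]: "trace (mat2 p q w v) = p + v"
  by (simp add: trace_def sum_2)

lemma mat_minus_mat2: "mat \<eta> - mat2 p q w v = mat2 (\<eta> - p) (- q) (- w) (\<eta> - v)"
  by (simp add: eq_mat2_iff mat_def)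

lemma mat2_mult_vector_eq_iff:
  "mat2 p q w v *v vector [f, g] = m *s vector [f, g] \<longleftrightarrow> p * f + q * g = m * f \<and> w * f + v * g = m * g"
  by (simp add: vec_eq_iff forall_2 matrix_vector_mult_def sum_2)

lemma matrix_inv_right_left:
  assumes "invertible A"
  shows "A ** matrix_inv A = mat 1" "matrix_inv A ** A = mat 1"
proof -
  have "\<exists>A'. A ** A' = mat 1 \<and> A' ** A = mat 1"
    using assms by (simp add: invertible_def)
  then have "A ** matrix_inv A = mat 1 \<and> matrix_inv A ** A = mat 1"
    unfolding matrix_inv_def by (rule someI_ex)
  then show "A ** matrix_inv A = mat 1" "matrix_inv A ** A = mat 1" by blast+
qed

lemma eq_conjugate_matrix_iff:
  assumes "invertible P"
  shows "B = P ** A ** matrix_inv P \<longleftrightarrow> B ** P = P ** A"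
proof
  assume B: "B = P ** A ** matrix_inv P"
  show "B ** P = P ** A"
    unfolding B by (simp add: matrix_mul_assoc[symmetric] matrix_inv_right_left[OF assms])
next
  assume BP: "B ** P = P ** A"
  have "B = B ** P ** matrix_inv P"
    by (simp add: matrix_mul_assoc[symmetric] matrix_inv_right_left[OF assms])
  then show "B = P ** A ** matrix_inv P" unfolding BP .
qed

section \<open>Conjugation of Higgs fields\<close>

context hopf_surface
begin

text \<open>Multiplying by the automorphism from the right removes the inverse, so that conjugacy
  becomes an intertwining relation to be compared entry by entry; invertibility becomes a condition
  on the determinant.\<close>

lemma conjugate_iff:
  "conjugate b r \<tau> \<phi> \<phi>' \<longleftrightarrow> (\<exists>a e c d. a \<in> H0 b r 1 \<and> e \<in> H0 b r (1 / \<tau>) \<and> c \<in> H0 b r \<tau> \<and> d \<in> H0 b r 1 \<and>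
     (\<forall>z\<in>punctured. a z * d z - e z * c z \<noteq> 0 \<and>
        \<phi>' z ** mat2 (a z) (e z) (c z) (d z) = mat2 (a z) (e z) (c z) (d z) ** \<phi> z))"
    (is "?L \<longleftrightarrow> ?R")
proof
  assume ?L
  then obtain \<psi> where \<psi>: "automorphism b r \<tau> \<psi>"
    and eq: "\<And>z. z \<in> punctured \<Longrightarrow> \<phi>' z = \<psi> z ** \<phi> z ** matrix_inv (\<psi> z)"
    unfolding conjugate_def by blast
  have e: "mat2 (\<psi> z $ 1 $ 1) (\<psi> z $ 1 $ 2) (\<psi> z $ 2 $ 1) (\<psi> z $ 2 $ 2) = \<psi> z" for z
    using eq_mat2_iff[of "\<psi> z"] by metis
  have "\<psi> z $ 1 $ 1 * \<psi> z $ 2 $ 2 - \<psi> z $ 1 $ 2 * \<psi> z $ 2 $ 1 \<noteq> 0 \<and> \<phi>' z ** \<psi> z = \<psi> z ** \<phi> z"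
    if "z \<in> punctured" for z
  proof
    have inv: "invertible (\<psi> z)" using \<psi> that by (simp add: automorphism_def)
    then show "\<phi>' z ** \<psi> z = \<psi> z ** \<phi> z" using eq[OF that] eq_conjugate_matrix_iff by blast
    show "\<psi> z $ 1 $ 1 * \<psi> z $ 2 $ 2 - \<psi> z $ 1 $ 2 * \<psi> z $ 2 $ 1 \<noteq> 0"
      using inv by (simp add: invertible_det_nz det_2)
  qed
  then show ?R
    using \<psi> unfolding automorphism_def End_sections_def
    by (intro exI[of _ "\<lambda>z. \<psi> z $ 1 $ 1"] exI[of _ "\<lambda>z. \<psi> z $ 1 $ 2"]
        exI[of _ "\<lambda>z. \<psi> z $ 2 $ 1"] exI[of _ "\<lambda>z. \<psi> z $ 2 $ 2"]) (simp add: e)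
next
  assume ?R
  then obtain a e c d where H: "a \<in> H0 b r 1" "e \<in> H0 b r (1 / \<tau>)" "c \<in> H0 b r \<tau>" "d \<in> H0 b r 1"
    and eq: "\<And>z. z \<in> punctured \<Longrightarrow> a z * d z - e z * c z \<noteq> 0 \<and>
        \<phi>' z ** mat2 (a z) (e z) (c z) (d z) = mat2 (a z) (e z) (c z) (d z) ** \<phi> z" by metis
  define \<psi> where "\<psi> = (\<lambda>z. mat2 (a z) (e z) (c z) (d z))"
  have "automorphism b r \<tau> \<psi>"
    using H eq by (simp add: automorphism_def End_sections_def \<psi>_def invertible_det_nz)
  moreover have "\<phi>' z = \<psi> z ** \<phi> z ** matrix_inv (\<psi> z)" if "z \<in> punctured" for z
    using eq[OF that] eq_conjugate_matrix_iff[of "\<psi> z"] by (simp add: \<psi>_def invertible_det_nz)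
  ultimately show ?L unfolding conjugate_def by blast
qed

lemma conjugateI:
  assumes "a \<in> H0 b r 1" "e \<in> H0 b r (1 / \<tau>)" "c \<in> H0 b r \<tau>" "d \<in> H0 b r 1"
    and "\<And>x y. (x, y) \<in> punctured \<Longrightarrow> a (x, y) * d (x, y) - e (x, y) * c (x, y) \<noteq> 0"
    and "\<And>x y. (x, y) \<in> punctured \<Longrightarrow>
      \<phi>' (x, y) ** mat2 (a (x, y)) (e (x, y)) (c (x, y)) (d (x, y)) =
      mat2 (a (x, y)) (e (x, y)) (c (x, y)) (d (x, y)) ** \<phi> (x, y)"
  shows "conjugate b r \<tau> \<phi> \<phi>'"
  unfolding conjugate_iff using assms by (intro exI[of _ a] exI[of _ e] exI[of _ c] exI[of _ d]) auto

lemma conjugate_refl_on: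
  assumes "\<And>x y. (x, y) \<in> punctured \<Longrightarrow> \<phi>' (x, y) = \<phi> (x, y)"
  shows "conjugate b r \<tau> \<phi> \<phi>'"
proof (rule conjugateI[of "\<lambda>_. 1" "\<lambda>_. 0" _ "\<lambda>_. 0" "\<lambda>_. 1"])
  have "mat2 1 0 0 1 = mat 1" by (rule sym) (simp add: eq_mat2_iff mat_def)
  then show "\<phi>' (x, y) ** mat2 1 0 0 1 = mat2 1 0 0 1 ** \<phi> (x, y)" if "(x, y) \<in> punctured" for x y
    using assms[OF that] by simp
qed simp_all

lemma conjugate_trans:
  assumes "\<tau> \<noteq> 0" "conjugate b r \<tau> \<phi> \<phi>'" "conjugate b r \<tau> \<phi>' \<phi>''"
  shows "conjugate b r \<tau> \<phi> \<phi>''"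
proof -
  from assms(2) obtain a e c d where H: "a \<in> H0 b r 1" "e \<in> H0 b r (1 / \<tau>)" "c \<in> H0 b r \<tau>" "d \<in> H0 b r 1"
    and eq: "\<And>z. z \<in> punctured \<Longrightarrow> a z * d z - e z * c z \<noteq> 0 \<and>
        \<phi>' z ** mat2 (a z) (e z) (c z) (d z) = mat2 (a z) (e z) (c z) (d z) ** \<phi> z" unfolding conjugate_iff by metis
  from assms(3) obtain a' e' c' d' where H': "a' \<in> H0 b r 1" "e' \<in> H0 b r (1 / \<tau>)" "c' \<in> H0 b r \<tau>" "d' \<in> H0 b r 1"
    and eq': "\<And>z. z \<in> punctured \<Longrightarrow> a' z * d' z - e' z * c' z \<noteq> 0 \<and>
        \<phi>'' z ** mat2 (a' z) (e' z) (c' z) (d' z) = mat2 (a' z) (e' z) (c' z) (d' z) ** \<phi>' z"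
    unfolding conjugate_iff by metis
  show ?thesis
  proof (rule conjugateI[of "\<lambda>z. a' z * a z + e' z * c z" "\<lambda>z. a' z * e z + e' z * d z" _
      "\<lambda>z. c' z * a z + d' z * c z" "\<lambda>z. c' z * e z + d' z * d z"])
    show "(\<lambda>z. a' z * a z + e' z * c z) \<in> H0 b r 1"
      using H0_add[OF H0_mult[OF H'(1) H(1)], of "\<lambda>z. e' z * c z"] H0_mult[OF H'(2) H(3)] assms(1) by simp
    show "(\<lambda>z. a' z * e z + e' z * d z) \<in> H0 b r (1 / \<tau>)"
      using H0_add[OF H0_mult[OF H'(1) H(2)], of "\<lambda>z. e' z * d z"] H0_mult[OF H'(2) H(4)] assms(1) by simp
    show "(\<lambda>z. c' z * a z + d' z * c z) \<in> H0 b r \<tau>"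
      using H0_add[OF H0_mult[OF H'(3) H(1)], of "\<lambda>z. d' z * c z"] H0_mult[OF H'(4) H(3)] assms(1) by simp
    show "(\<lambda>z. c' z * e z + d' z * d z) \<in> H0 b r 1"
      using H0_add[OF H0_mult[OF H'(4) H(4)], of "\<lambda>z. c' z * e z"] H0_mult[OF H'(3) H(2)] assms(1)
      by (simp add: add.commute)
  next
    fix x y :: complex assume "(x, y) \<in> punctured"
    from eq[OF this] eq'[OF this]
    obtain M M' where M: "M = mat2 (a (x, y)) (e (x, y)) (c (x, y)) (d (x, y))"
        "M' = mat2 (a' (x, y)) (e' (x, y)) (c' (x, y)) (d' (x, y))"
      and nz: "det M \<noteq> 0" "det M' \<noteq> 0"
      and e1: "\<phi>' (x, y) ** M = M ** \<phi> (x, y)" and e2: "\<phi>'' (x, y) ** M' = M' ** \<phi>' (x, y)" by simp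
    have MM: "mat2 (a' (x, y) * a (x, y) + e' (x, y) * c (x, y)) (a' (x, y) * e (x, y) + e' (x, y) * d (x, y))
        (c' (x, y) * a (x, y) + d' (x, y) * c (x, y)) (c' (x, y) * e (x, y) + d' (x, y) * d (x, y)) = M' ** M"
      by (simp add: M)
    have "det (M' ** M) \<noteq> 0" using nz by (simp add: det_mul)
    then show "(a' (x, y) * a (x, y) + e' (x, y) * c (x, y)) * (c' (x, y) * e (x, y) + d' (x, y) * d (x, y)) -
       (a' (x, y) * e (x, y) + e' (x, y) * d (x, y)) * (c' (x, y) * a (x, y) + d' (x, y) * c (x, y)) \<noteq> 0"
      unfolding MM[symmetric] by simp
    have "\<phi>'' (x, y) ** (M' ** M) = M' ** \<phi>' (x, y) ** M" by (simp add: matrix_mul_assoc e2)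
    also have "\<dots> = M' ** M ** \<phi> (x, y)" by (simp only: matrix_mul_assoc[symmetric] e1)
    finally show "\<phi>'' (x, y) ** mat2 (a' (x, y) * a (x, y) + e' (x, y) * c (x, y)) (a' (x, y) * e (x, y) + e' (x, y) * d (x, y))
        (c' (x, y) * a (x, y) + d' (x, y) * c (x, y)) (c' (x, y) * e (x, y) + d' (x, y) * d (x, y)) =
      mat2 (a' (x, y) * a (x, y) + e' (x, y) * c (x, y)) (a' (x, y) * e (x, y) + e' (x, y) * d (x, y))
        (c' (x, y) * a (x, y) + d' (x, y) * c (x, y)) (c' (x, y) * e (x, y) + d' (x, y) * d (x, y)) ** \<phi> (x, y)"
      unfolding MM .
  qed
qed

lemma det_conjugate:
  assumes "conjugate b r \<tau> \<phi> \<phi>'" "z \<in> punctured"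
  shows "det (\<phi>' z) = det (\<phi> z)"
proof -
  from assms obtain M where "det M \<noteq> 0" "\<phi>' z ** M = M ** \<phi> z"
    unfolding conjugate_iff by (metis det_mat2)
  then have "det (\<phi>' z) * det M = det M * det (\<phi> z)" by (metis det_mul)
  then show ?thesis using \<open>det M \<noteq> 0\<close> by simp
qed

lemma nowhere_vanishing_conjugate:
  assumes "conjugate b r \<tau> \<phi> \<phi>'" "nowhere_vanishing \<phi>"
  shows "nowhere_vanishing \<phi>'"
  unfolding nowhere_vanishing_def
proof (intro ballI notI)
  fix z assume z: "z \<in> punctured" "\<phi>' z = 0"
  from assms z obtain M where M: "det M \<noteq> 0" "0 ** M = M ** \<phi> z"
    unfolding conjugate_iff by (metis det_mat2)
  then have "invertible M" by (simp add: invertible_det_nz)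
  then have "\<phi> z = matrix_inv M ** (M ** \<phi> z)"
    by (simp add: matrix_mul_assoc matrix_inv_right_left)
  also have "\<dots> = 0" unfolding M(2)[symmetric] by simp
  finally show False using assms(2) z by (simp add: nowhere_vanishing_def)
qed

subsection \<open>Reduction of sections modulo a section of degree r\<close>

lemma power_minus_b: "b ^ r / b powi (- int k) = b ^ (r + k)"
  by (simp add: power_int_minus power_add divide_inverse)

lemma inverse_powi_b: "1 / b powi (- int k) = b ^ k"
  by (simp add: power_int_minus divide_inverse)

text \<open>Modulo u x + v y^r one may replace x by -(v / u) y^r. Each induction step trades one
  factor x for y^r, which has the same weight, until only a multiple of y^(r + k) is left.\<close>

lemma monomial_reduce:
  assumes "u \<noteq> 0" "r * i + j = r + k"
  shows "\<exists>c g. g \<in> H0 b r (b ^ k) \<and>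
    (\<forall>x y. x ^ i * y ^ j = c * y ^ (r + k) + (u * x + v * y ^ r) * g (x, y))"
  using assms(2)
proof (induction i arbitrary: j)
  case 0
  then show ?case by (intro exI[of _ 1] exI[of _ "\<lambda>_. 0"]) simp
next
  case (Suc i)
  then have "r * i + (r + j) = r + k" by simp
  from Suc.IH[OF this] obtain c g where g: "g \<in> H0 b r (b ^ k)"
    and eq: "\<And>x y. x ^ i * y ^ (r + j) = c * y ^ (r + k) + (u * x + v * y ^ r) * g (x, y)"
    by blast
  define g' where "g' = (\<lambda>z. (\<lambda>(x, y). (1 / u) * x ^ i * y ^ j) z + (- v / u) * g z)"
  have "g' \<in> H0 b r (b ^ k)"
    unfolding g'_def using Suc.prems by (intro H0_add H0_cmult g H0_monomial) simp
  moreover have "x ^ Suc i * y ^ j = (- v / u * c) * y ^ (r + k) + (u * x + v * y ^ r) * g' (x, y)" for x y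
  proof -
    have "u * (x ^ Suc i * y ^ j) = (u * x + v * y ^ r) * (x ^ i * y ^ j) - v * (x ^ i * y ^ (r + j))"
      by (simp add: algebra_simps power_add)
    also have "\<dots> = u * ((- v / u * c) * y ^ (r + k) + (u * x + v * y ^ r) * g' (x, y))"
      unfolding eq g'_def using assms(1) by (simp add: field_simps)
    finally show ?thesis using assms(1) by simp
  qed
  ultimately show ?case by blast
qed

lemma H0_reduce:
  assumes "u \<noteq> 0" "q \<in> H0 b r (b ^ (r + k))"
  obtains c g where "g \<in> H0 b r (b ^ k)"
    "\<And>x y. (x, y) \<in> punctured \<Longrightarrow> q (x, y) = c * y ^ (r + k) + (u * x + v * y ^ r) * g (x, y)"
proof -
  obtain a where q: "\<And>x y. (x, y) \<in> punctured \<Longrightarrow>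
    q (x, y) = (\<Sum>i | r * i \<le> r + k. a i * x ^ i * y ^ (r + k - r * i))" using H0_nat_expansion[OF assms(2)] by blast
  have "\<forall>i. r * i \<le> r + k \<longrightarrow> (\<exists>c g. g \<in> H0 b r (b ^ k) \<and>
      (\<forall>x y. x ^ i * y ^ (r + k - r * i) = c * y ^ (r + k) + (u * x + v * y ^ r) * g (x, y)))"
    using monomial_reduce[OF assms(1)] by simp
  then obtain C G where G: "\<And>i. r * i \<le> r + k \<Longrightarrow> G i \<in> H0 b r (b ^ k)"
    and eq: "\<And>i x y. r * i \<le> r + k \<Longrightarrow>
      x ^ i * y ^ (r + k - r * i) = C i * y ^ (r + k) + (u * x + v * y ^ r) * G i (x, y)"
    by metis
  show ?thesis
  proof (rule that[of "\<lambda>z. \<Sum>i | r * i \<le> r + k. a i * G i z" "\<Sum>i | r * i \<le> r + k. a i * C i"])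
    show "(\<lambda>z. \<Sum>i | r * i \<le> r + k. a i * G i z) \<in> H0 b r (b ^ k)"
      using G by (intro H0_sum H0_cmult) simp
    show "q (x, y) = (\<Sum>i | r * i \<le> r + k. a i * C i) * y ^ (r + k) +
        (u * x + v * y ^ r) * (\<Sum>i | r * i \<le> r + k. a i * G i (x, y))" if "(x, y) \<in> punctured" for x y
      unfolding q[OF that] sum_distrib_left sum_distrib_right sum.distrib[symmetric]
    proof (rule sum.cong)
      fix i assume "i \<in> {i. r * i \<le> r + k}"
      then have i: "r * i \<le> r + k" by simp
      have "a i * x ^ i * y ^ (r + k - r * i) = a i * (C i * y ^ (r + k) + (u * x + v * y ^ r) * G i (x, y))"
        using eq[OF i, of x y] by (simp add: mult.assoc)
      then show "a i * x ^ i * y ^ (r + k - r * i) =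
          a i * C i * y ^ (r + k) + (u * x + v * y ^ r) * (a i * G i (x, y))"
        by (simp add: algebra_simps)
    qed simp
  qed
qed

text \<open>The substitute for \<open>H0_reduce\<close> when the linear form is a multiple of y^r
  and x cannot be eliminated: weight r + j r contains the pure power x^(1 + j), and all its other
  monomials are divisible by y^r.\<close>

lemma H0_reduce_y:
  assumes "q \<in> H0 b r (b ^ (r + j * r))"
  obtains c g where "g \<in> H0 b r (b ^ (j * r))"
    "\<And>x y. (x, y) \<in> punctured \<Longrightarrow> q (x, y) = c * x ^ (1 + j) + y ^ r * g (x, y)"
proof -
  obtain a where q: "\<And>x y. (x, y) \<in> punctured \<Longrightarrow>
    q (x, y) = (\<Sum>i | r * i \<le> r + j * r. a i * x ^ i * y ^ (r + j * r - r * i))"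
    using H0_nat_expansion[OF assms(1)] by blast
  have "r * i \<le> r + j * r \<longleftrightarrow> i \<le> Suc j" for i
    using r_nz(2) mult_le_cancel1[of r i "Suc j"] by (simp add: mult.commute)
  then have I: "{i. r * i \<le> r + j * r} = insert (Suc j) {..j}"
    by (simp only: le_Suc_eq) (auto simp only: insert_iff atMost_iff mem_Collect_eq)
  show ?thesis
  proof (rule that[of "\<lambda>z. \<Sum>i\<le>j. (\<lambda>(x, y). a i * x ^ i * y ^ (j * r - r * i)) z" "a (Suc j)"])
    have "r * i \<le> j * r" if "i \<le> j" for i using that by (simp add: mult.commute)
    then show "(\<lambda>z. \<Sum>i\<le>j. (\<lambda>(x, y). a i * x ^ i * y ^ (j * r - r * i)) z) \<in> H0 b r (b ^ (j * r))"
      by (intro H0_sum H0_monomial) simp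
    show "q (x, y) = a (Suc j) * x ^ (1 + j) + y ^ r * (\<Sum>i\<le>j. (\<lambda>(x, y). a i * x ^ i * y ^ (j * r - r * i)) (x, y))"
      if "(x, y) \<in> punctured" for x y
    proof -
      have "q (x, y) = a (Suc j) * x ^ Suc j + (\<Sum>i\<le>j. a i * x ^ i * y ^ (r + j * r - r * i))"
        unfolding q[OF that] I by (subst sum.insert) (simp_all add: mult.commute)
      also have "(\<Sum>i\<le>j. a i * x ^ i * y ^ (r + j * r - r * i)) = (\<Sum>i\<le>j. y ^ r * (a i * x ^ i * y ^ (j * r - r * i)))"
      proof (rule sum.cong)
        fix i assume "i \<in> {..j}"
        then have "r * i \<le> j * r" by (simp add: mult.commute)
        then have "y ^ (r + j * r - r * i) = y ^ r * y ^ (j * r - r * i)" by (simp add: power_add[symmetric])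
        then show "a i * x ^ i * y ^ (r + j * r - r * i) = y ^ r * (a i * x ^ i * y ^ (j * r - r * i))"
          by simp
      qed simp
      finally show ?thesis by (simp add: sum_distrib_left)
    qed
  qed
qed

text \<open>The expression is |u|^2 + |v|^2. It is also, up to sign, the determinant of the pair u x
  + v y, \<open>cnj v\<close> x - \<open>cnj u\<close> y, so these two forms are
  independent.\<close>

lemma cnj_form_nz:
  assumes "u \<noteq> 0 \<or> v \<noteq> 0"
  shows "cnj u * u + cnj v * v \<noteq> 0"
proof -
  have "cnj u * u + cnj v * v = complex_of_real ((cmod u)\<^sup>2 + (cmod v)\<^sup>2)"
    by (simp only: of_real_add complex_norm_square mult.commute)
  then show ?thesis using assms by (simp add: sum_power2_eq_zero_iff del: of_real_add)
qed

lemma linear_form_has_zero: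
  obtains x y where "(x, y) \<in> punctured" "u * x + v * y ^ r = 0"
proof (cases "u = 0")
  case True
  then show ?thesis using that[of 1 0] by simp
next
  case False
  then show ?thesis using that[of "- v / u" 1] by simp
qed

text \<open>The conjugate form has no common zero with u x + v y^r, so its power is nonzero in the
  one-dimensional quotient by that form and generates it for all (u, v) alike. The power of y is
  zero there when u = 0, and the power of x when v = 0.\<close>

lemma H0_reduce_orthogonal:
  assumes uv: "u \<noteq> 0 \<or> v \<noteq> 0" and q: "q \<in> H0 b r (b ^ (r + j * r))"
  obtains c g where "g \<in> H0 b r (b ^ (j * r))"
    "\<And>x y. (x, y) \<in> punctured \<Longrightarrow>
      q (x, y) = c * (cnj v * x - cnj u * y ^ r) ^ (1 + j) + (u * x + v * y ^ r) * g (x, y)"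
proof (cases "u = 0")
  case True
  then have v: "v \<noteq> 0" using uv by simp
  obtain c g where g: "g \<in> H0 b r (b ^ (j * r))"
    and eq: "\<And>x y. (x, y) \<in> punctured \<Longrightarrow> q (x, y) = c * x ^ (1 + j) + y ^ r * g (x, y)"
  proof (rule H0_reduce_y[OF q])
    fix c g
    assume "g \<in> H0 b r (b ^ (j * r))"
      "\<And>x y. (x, y) \<in> punctured \<Longrightarrow> q (x, y) = c * x ^ (1 + j) + y ^ r * g (x, y)"
    then show thesis by (rule that)
  qed
  show ?thesis
    by (rule that[OF H0_cmult[OF g, of "1 / v"], of "c / cnj v ^ (1 + j)"])
      (use v True in \<open>simp add: eq field_simps\<close>)
next
  case u: False
  define R where "R = (\<lambda>(x, y). (cnj v * x - cnj u * y ^ r) ^ (1 + j))"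
  have HR: "R \<in> H0 b r (b ^ (r + j * r))"
    using H0_power[OF H0_linear[of "cnj v" "- cnj u"], of "1 + j"]
    by (simp add: R_def case_prod_beta' power_add power_mult[symmetric] mult.commute)
  obtain c' g' where g': "g' \<in> H0 b r (b ^ (j * r))"
    and eq': "\<And>x y. (x, y) \<in> punctured \<Longrightarrow> R (x, y) = c' * y ^ (r + j * r) + (u * x + v * y ^ r) * g' (x, y)"
  proof (rule H0_reduce[OF u HR, of v])
    fix c g
    assume "g \<in> H0 b r (b ^ (j * r))"
      "\<And>x y. (x, y) \<in> punctured \<Longrightarrow> R (x, y) = c * y ^ (r + j * r) + (u * x + v * y ^ r) * g (x, y)"
    then show thesis by (rule that)
  qed
  obtain c g where g: "g \<in> H0 b r (b ^ (j * r))"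
    and eq: "\<And>x y. (x, y) \<in> punctured \<Longrightarrow> q (x, y) = c * y ^ (r + j * r) + (u * x + v * y ^ r) * g (x, y)"
  proof (rule H0_reduce[OF u q, of v])
    fix c g
    assume "g \<in> H0 b r (b ^ (j * r))"
      "\<And>x y. (x, y) \<in> punctured \<Longrightarrow> q (x, y) = c * y ^ (r + j * r) + (u * x + v * y ^ r) * g (x, y)"
    then show thesis by (rule that)
  qed
  \<comment> \<open>The point (-v / u, 1) is a zero of u x + v y^r with y = 1, so evaluating R there
    returns exactly c'.\<close>
  have "u * (cnj v * (- v / u) - cnj u) = - (cnj u * u + cnj v * v)" using u by (simp add: field_simps)
  then have "cnj v * (- v / u) - cnj u \<noteq> 0"
    using cnj_form_nz[OF uv] by (metis mult_zero_right neg_equal_0_iff_equal)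
  then have "R (- v / u, 1) \<noteq> 0" by (simp add: R_def)
  moreover have "R (- v / u, 1) = c'" using u by (simp add: eq')
  ultimately have c': "c' \<noteq> 0" by simp
  show ?thesis
  proof (rule that[of "\<lambda>z. g z - (c / c') * g' z" "c / c'"])
    show "(\<lambda>z. g z - (c / c') * g' z) \<in> H0 b r (b ^ (j * r))"
      by (intro H0_diff g H0_cmult g')
    show "q (x, y) = c / c' * (cnj v * x - cnj u * y ^ r) ^ (1 + j) +
        (u * x + v * y ^ r) * (g (x, y) - c / c' * g' (x, y))" if "(x, y) \<in> punctured" for x y
    proof -
      have "c / c' * R (x, y) = c * y ^ (r + j * r) + (u * x + v * y ^ r) * (c / c' * g' (x, y))"
        unfolding eq'[OF that] using c' by (simp add: field_simps)
      then show ?thesis unfolding eq[OF that] R_def by (simp add: algebra_simps)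
    qed
  qed
qed

text \<open>On y = 1 the section is a polynomial in x, which has a root unless it is a nonzero
  constant. In that case the section is a multiple of y^n and vanishes at (1, 0).\<close>

lemma H0_has_zero:
  assumes "q \<in> H0 b r (b ^ n)" "n > 0"
  obtains z where "z \<in> punctured" "q z = 0"
proof -
  obtain a where q: "\<And>x y. (x, y) \<in> punctured \<Longrightarrow>
    q (x, y) = (\<Sum>i | r * i \<le> n. a i * x ^ i * y ^ (n - r * i))"
    using H0_nat_expansion[OF assms(1)] by blast
  have I: "{i. r * i \<le> n} = {..n div r}"
    using r_nz(2) by (auto simp: less_eq_div_iff_mult_less_eq mult.commute)
  show ?thesis
  proof (cases "a 0 = 0 \<or> (\<exists>i\<in>{1..n div r}. a i \<noteq> 0)")
    case True
    then obtain x where "(\<Sum>i\<le>n div r. a i * x ^ i) = 0" by (rule fundamental_theorem_of_algebra)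
    then show ?thesis using that[of "(x, 1)"] by (simp add: q I)
  next
    case False
    have "q (1, 0) = (\<Sum>i\<le>n div r. 0)"
      unfolding q[OF in_punctured[THEN iffD2], of 1 0, OF disjI1[OF one_neq_zero]] I
    proof (rule sum.cong)
      fix i assume "i \<in> {..n div r}"
      then show "a i * 1 ^ i * 0 ^ (n - r * i) = 0"
        using False assms(2) by (cases "i = 0") (auto simp: power_0_left)
    qed simp
    then show ?thesis using that[of "(1, 0)"] by simp
  qed
qed


subsection \<open>Existence of the normal form\<close>

lemma lb_degree_powi: "lb_degree b (b powi m) = of_int m"
proof -
  have ln: "ln (cmod b) < 0" using b_pos b_less by simp
  have "ln (cmod b powi m) = of_int m * ln (cmod b)"
    using b_pos by (simp add: power_int_def ln_realpow ln_inverse)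
  then show ?thesis using ln by (simp add: lb_degree_def norm_power_int)
qed

definition has_normal_form :: "complex \<Rightarrow> (complex \<times> complex \<Rightarrow> complex^2^2) \<Rightarrow> bool" where
  "has_normal_form \<tau> \<phi> \<longleftrightarrow>
     (\<exists>N. nf_admissible b r N \<and> \<tau> = nf_bundle b r N \<and> conjugate b r \<tau> \<phi> (nf_field r N))"

lemma nowhere_vanishingD: "nowhere_vanishing \<phi> \<Longrightarrow> z \<in> punctured \<Longrightarrow> \<phi> z = 0 \<Longrightarrow> False"
  by (auto simp: nowhere_vanishing_def)

lemma has_normal_form_conjugate:
  "\<tau> \<noteq> 0 \<Longrightarrow> conjugate b r \<tau> \<phi> \<phi>' \<Longrightarrow> has_normal_form \<tau> \<phi>' \<Longrightarrow> has_normal_form \<tau> \<phi>"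
  unfolding has_normal_form_def using conjugate_trans by blast

lemma conjugate_triangular:
  assumes "a \<noteq> 0" "g \<in> H0 b r (1 / \<tau>)"
    and "\<And>x y. (x, y) \<in> punctured \<Longrightarrow> \<phi> (x, y) = mat2 (p (x, y)) (q (x, y)) 0 (- p (x, y))"
    and "\<And>x y. (x, y) \<in> punctured \<Longrightarrow> \<phi>' (x, y) = mat2 (p (x, y)) (q' (x, y)) 0 (- p (x, y))"
    and "\<And>x y. (x, y) \<in> punctured \<Longrightarrow> q (x, y) = a * q' (x, y) + p (x, y) * g (x, y)"
  shows "conjugate b r \<tau> \<phi> \<phi>'"
\<comment> \<open>The eigenvalues p and -p differ by 2 p, so a unipotent matrix with off-diagonal
  entry e changes the upper right entry by -2 p e; hence the factor 1 / 2.\<close>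
proof (rule conjugateI[of "\<lambda>_. 1 / a" "\<lambda>z. (1 / (2 * a)) * g z" _ "\<lambda>_. 0" "\<lambda>_. 1"])
  show "(\<lambda>z. (1 / (2 * a)) * g z) \<in> H0 b r (1 / \<tau>)" by (rule H0_cmult) fact
next
  fix x y :: complex assume z: "(x, y) \<in> punctured"
  show "\<phi>' (x, y) ** mat2 (1 / a) (1 / (2 * a) * g (x, y)) 0 1 =
      mat2 (1 / a) (1 / (2 * a) * g (x, y)) 0 1 ** \<phi> (x, y)"
    unfolding assms(3)[OF z] assms(4)[OF z] assms(5)[OF z] using assms(1) by (simp add: field_simps)
qed (use assms in simp_all)

text \<open>Sections of positive weight have zeros. At a zero of Q the diagonal cannot vanish, so
  (u, v) is nonzero; at a zero of the diagonal Q cannot vanish, so the residue c is nonzero and can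
  be scaled to 1. The trivial bundle is included as j = 0.\<close>

lemma triangular_normal_form:
  assumes Q: "Q \<in> H0 b r (b ^ (r + j * r))" and nv: "nowhere_vanishing \<phi>"
    and \<phi>: "\<And>x y. (x, y) \<in> punctured \<Longrightarrow> \<phi> (x, y) = mat2 (u * x + v * y ^ r) (Q (x, y)) 0 (- (u * x + v * y ^ r))"
  shows "has_normal_form (b powi (- int (j * r))) \<phi>"
proof -
  have uv: "u \<noteq> 0 \<or> v \<noteq> 0"
  proof (rule ccontr)
    assume *: "\<not> (u \<noteq> 0 \<or> v \<noteq> 0)"
    obtain z where z: "z \<in> punctured" "Q z = 0" using H0_has_zero[OF Q] by auto
    then have "\<phi> z = 0" using \<phi>[of "fst z" "snd z"] * by simp
    then show False using nv z by (simp add: nowhere_vanishing_def)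
  qed
  obtain c g where g: "g \<in> H0 b r (b ^ (j * r))" and q: "\<And>x y. (x, y) \<in> punctured \<Longrightarrow>
      Q (x, y) = c * (cnj v * x - cnj u * y ^ r) ^ (1 + j) + (u * x + v * y ^ r) * g (x, y)"
  proof (rule H0_reduce_orthogonal[OF uv Q])
    fix c g
    assume "g \<in> H0 b r (b ^ (j * r))" "\<And>x y. (x, y) \<in> punctured \<Longrightarrow>
      Q (x, y) = c * (cnj v * x - cnj u * y ^ r) ^ (1 + j) + (u * x + v * y ^ r) * g (x, y)"
    then show thesis by (rule that)
  qed
  have c: "c \<noteq> 0"
  proof
    assume c: "c = 0"
    obtain x y where z: "(x, y) \<in> punctured" "u * x + v * y ^ r = 0" by (rule linear_form_has_zero)
    then have "\<phi> (x, y) = 0" using \<phi>[OF z(1)] q[OF z(1)] c by simp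
    then show False using nv z by (simp add: nowhere_vanishing_def)
  qed
  have "conjugate b r (b powi (- int (j * r))) \<phi> (nf_field r (NF3 j u v))"
  proof (rule conjugate_triangular[OF c])
    show "g \<in> H0 b r (1 / b powi (- int (j * r)))" using g by (simp only: inverse_powi_b)
    show "\<phi> (x, y) = mat2 ((\<lambda>(x, y). u * x + v * y ^ r) (x, y)) (Q (x, y)) 0 (- (\<lambda>(x, y). u * x + v * y ^ r) (x, y))"
      if "(x, y) \<in> punctured" for x y using \<phi>[OF that] by simp
    show "nf_field r (NF3 j u v) (x, y) = mat2 ((\<lambda>(x, y). u * x + v * y ^ r) (x, y))
        ((\<lambda>(x, y). (cnj v * x - cnj u * y ^ r) ^ (1 + j)) (x, y)) 0 (- (\<lambda>(x, y). u * x + v * y ^ r) (x, y))" for x y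
      by simp
    show "Q (x, y) = c * (\<lambda>(x, y). (cnj v * x - cnj u * y ^ r) ^ (1 + j)) (x, y) +
        (\<lambda>(x, y). u * x + v * y ^ r) (x, y) * g (x, y)" if "(x, y) \<in> punctured" for x y
      using q[OF that] by simp
  qed
  then show ?thesis
    unfolding has_normal_form_def using uv by (intro exI[of _ "NF3 j u v"]) simp
qed

section \<open>The trivial bundle: pencils of trace-free matrices\<close>

lemma conjugate_swap:
  assumes "\<And>z. z \<in> punctured \<Longrightarrow> \<phi> z = mat2 (p z) (q z) (w z) (- p z)"
  shows "conjugate b r 1 \<phi> (\<lambda>z. mat2 (- p z) (w z) (q z) (p z))"
  by (rule conjugateI[of "\<lambda>_. 0" "\<lambda>_. 1" _ "\<lambda>_. 1" "\<lambda>_. 0"]) (use assms in simp_all)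

text \<open>The conjugating matrix sends (1, l) to the first basis vector, so the new lower left
  entry vanishes exactly when (1, l) is an eigenvector. The one direction not of this shape, (0, 1),
  is covered by \<open>conjugate_swap\<close>.\<close>

lemma conjugate_shear:
  assumes "\<And>z. z \<in> punctured \<Longrightarrow> \<phi> z = mat2 (p z) (q z) (w z) (- p z)"
  shows "conjugate b r 1 \<phi> (\<lambda>z. mat2 (p z + l * q z) (q z) (w z - 2 * l * p z - l\<^sup>2 * q z) (- (p z + l * q z)))"
  by (rule conjugateI[of "\<lambda>_. 1" "\<lambda>_. 0" _ "\<lambda>_. - l" "\<lambda>_. 1"])
    (use assms in \<open>simp_all add: algebra_simps power2_eq_square\<close>)

text \<open>For the pencil x A + y^r B, the first basis vector e1 is an eigenvector of A but not of B; the
  new basis is e1, B e1.\<close>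
lemma conjugate_companion:
  assumes "w0 \<noteq> 0" and "\<And>x y. (x, y) \<in> punctured \<Longrightarrow> \<phi> (x, y) =
      mat2 (p1 * x + p0 * y ^ r) (q1 * x + q0 * y ^ r) (w0 * y ^ r) (- (p1 * x + p0 * y ^ r))"
  shows "conjugate b r 1 \<phi> (nf_field r (NF1 (w0 * q1 + 2 * p0 * p1) p1 (w0 * q0 + p0\<^sup>2)))"
  by (rule conjugateI[of "\<lambda>_. w0" "\<lambda>_. - p0" _ "\<lambda>_. 0" "\<lambda>_. 1"])
    (use assms in \<open>simp_all add: algebra_simps power2_eq_square\<close>)

text \<open>The alternatives of \<open>red\<close> say that the constant vector (0, 1), respectively
  (1, l), is an eigenvector at every point; moving it to the first place makes the field upper
  triangular.\<close>

lemma reducible_trivial_bundle: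
  assumes q: "q \<in> H0 b r (b ^ r)" and w: "w \<in> H0 b r (b ^ r)" and nv: "nowhere_vanishing \<phi>"
    and \<phi>: "\<And>x y. (x, y) \<in> punctured \<Longrightarrow>
      \<phi> (x, y) = mat2 (u * x + v * y ^ r) (q (x, y)) (w (x, y)) (- (u * x + v * y ^ r))"
    and red: "(\<forall>z\<in>punctured. q z = 0) \<or>
      (\<exists>l. \<forall>(x, y)\<in>punctured. w (x, y) - 2 * l * (u * x + v * y ^ r) - l\<^sup>2 * q (x, y) = 0)"
  shows "has_normal_form 1 \<phi>"
proof -
  define p where "p = (\<lambda>(x, y). u * x + v * y ^ r)"
  have \<phi>': "\<phi> z = mat2 (p z) (q z) (w z) (- p z)" if "z \<in> punctured" for z
    using that \<phi> by (cases z) (simp add: p_def)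
  from red show ?thesis
  proof
    assume q0: "\<forall>z\<in>punctured. q z = 0"
    note conj = conjugate_swap[OF \<phi>']
    have "has_normal_form (b powi (- int (0 * r))) (\<lambda>z. mat2 (- p z) (w z) (q z) (p z))"
      by (rule triangular_normal_form[of w 0 _ "- u" "- v"])
        (use w q0 nowhere_vanishing_conjugate[OF conj nv] in \<open>simp_all add: p_def\<close>)
    then show ?thesis using has_normal_form_conjugate[OF _ conj] by simp
  next
    assume "\<exists>l. \<forall>(x, y)\<in>punctured. w (x, y) - 2 * l * (u * x + v * y ^ r) - l\<^sup>2 * q (x, y) = 0"
    then obtain l where "\<forall>(x, y)\<in>punctured. w (x, y) - 2 * l * (u * x + v * y ^ r) - l\<^sup>2 * q (x, y) = 0"
      by blast
    then have l: "w (x, y) - 2 * l * p (x, y) - l\<^sup>2 * q (x, y) = 0" if "(x, y) \<in> punctured" for x y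
      using that by (simp only: p_def prod.case) blast
    note conj = conjugate_shear[where l = l, OF \<phi>']
    obtain q1 q0 where q': "\<And>x y. (x, y) \<in> punctured \<Longrightarrow> q (x, y) = q1 * x + q0 * y ^ r"
      using H0_degree_r[OF q] by blast
    have "has_normal_form (b powi (- int (0 * r)))
        (\<lambda>z. mat2 (p z + l * q z) (q z) (w z - 2 * l * p z - l\<^sup>2 * q z) (- (p z + l * q z)))"
    proof (rule triangular_normal_form[of q 0 _ "u + l * q1" "v + l * q0"])
      show "q \<in> H0 b r (b ^ (r + 0 * r))" using q by simp
      fix x y :: complex assume z: "(x, y) \<in> punctured"
      have "p (x, y) + l * q (x, y) = (u + l * q1) * x + (v + l * q0) * y ^ r"
        using q'[OF z] by (simp add: p_def algebra_simps)
      then show "mat2 (p (x, y) + l * q (x, y)) (q (x, y)) (w (x, y) - 2 * l * p (x, y) - l\<^sup>2 * q (x, y))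
          (- (p (x, y) + l * q (x, y))) =
          mat2 ((u + l * q1) * x + (v + l * q0) * y ^ r) (q (x, y)) 0 (- ((u + l * q1) * x + (v + l * q0) * y ^ r))"
        using l[OF z] by simp
    qed (rule nowhere_vanishing_conjugate[OF conj nv])
    then show ?thesis using has_normal_form_conjugate[OF _ conj] by simp
  qed
qed

lemma quadratic_root:
  fixes a c d :: complex
  assumes "a \<noteq> 0"
  obtains l where "a * l\<^sup>2 + c * l + d = 0"
proof -
  have "(\<exists>i\<in>{1..2::nat}. (\<lambda>i. if i = 0 then d else if i = 1 then c else a) i \<noteq> 0)"
    using assms by (intro bexI[of _ 2]) auto
  then obtain l where "(\<Sum>i\<le>2. (if i = 0 then d else if i = 1 then c else a) * l ^ i) = 0"
    using fundamental_theorem_of_algebra[of "\<lambda>i. if i = 0 then d else if i = 1 then c else a" 2] by auto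
  then show ?thesis using that[of l] by (simp add: numeral_2_eq_2 algebra_simps)
qed

text \<open>If the discriminant vanishes, both coefficients of the pencil have a common eigenvector
  after all, and the triangular reduction applies. The case s = t = 0 is excluded because the field
  would vanish at (1, 0).\<close>

lemma companion_normal_form:
  assumes nv: "nowhere_vanishing (nf_field r (NF1 s t u))"
  shows "has_normal_form 1 (nf_field r (NF1 s t u))"
proof (cases "s\<^sup>2 - 4 * t\<^sup>2 * u = 0")
  case False
  then show ?thesis
    unfolding has_normal_form_def using conjugate_refl_on by (intro exI[of _ "NF1 s t u"]) simp
next
  case True
  have st: "s \<noteq> 0 \<or> t \<noteq> 0"
  proof (rule ccontr)
    assume "\<not> (s \<noteq> 0 \<or> t \<noteq> 0)"
    then have "nf_field r (NF1 s t u) (1, 0) = 0" by (simp add: power_0_left)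
    then show False using nowhere_vanishingD[OF nv, of "(1, 0)"] by simp
  qed
  then have t: "t \<noteq> 0" using True by auto
  define q where "q = (\<lambda>(x, y). s * x + u * y ^ r)"
  define w where "w = (\<lambda>(x::complex, y::complex). 0 * x + 1 * y ^ r)"
  show ?thesis
  proof (rule reducible_trivial_bundle[of q w _ t 0])
    show "q \<in> H0 b r (b ^ r)" "w \<in> H0 b r (b ^ r)"
      unfolding q_def w_def by (rule H0_linear)+
    show "nf_field r (NF1 s t u) (x, y) = mat2 (t * x + 0 * y ^ r) (q (x, y)) (w (x, y)) (- (t * x + 0 * y ^ r))" for x y
      by (simp add: q_def w_def)
    show "(\<forall>z\<in>punctured. q z = 0) \<or>
      (\<exists>l. \<forall>(x, y)\<in>punctured. w (x, y) - 2 * l * (t * x + 0 * y ^ r) - l\<^sup>2 * q (x, y) = 0)"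
    proof (cases "s = 0")
      case True
      then have "u = 0" using \<open>s\<^sup>2 - 4 * t\<^sup>2 * u = 0\<close> t by simp
      then show ?thesis using True by (auto simp: q_def)
    next
      case False
      \<comment> \<open>For this l the coefficient of x in w - 2 l t x - l^2 q vanishes, and that of
        y^r is 1 - l^2 u, which is zero by the vanishing discriminant.\<close>
      define l where "l = - 2 * t / s"
      have "l\<^sup>2 * u = (4 * t\<^sup>2 * u) / s\<^sup>2" by (simp add: l_def power_divide power_mult_distrib)
      also have "4 * t\<^sup>2 * u = s\<^sup>2" using True by simp
      finally have "l\<^sup>2 * u = 1" using False by simp
      moreover have "l\<^sup>2 * s = - 2 * l * t" using False by (simp add: l_def field_simps power2_eq_square)
      ultimately have "w (x, y) - 2 * l * (t * x + 0 * y ^ r) - l\<^sup>2 * q (x, y) = 0" for x y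
        by (simp add: w_def q_def distrib_left mult.assoc[symmetric])
      then show ?thesis by blast
    qed
  qed fact
qed

lemma normal_form_trivial_bundle:
  assumes q: "q \<in> H0 b r (b ^ r)" and w: "w \<in> H0 b r (b ^ r)" and p: "p \<in> H0 b r (b ^ r)"
    and nv: "nowhere_vanishing \<phi>"
    and \<phi>: "\<And>z. z \<in> punctured \<Longrightarrow> \<phi> z = mat2 (p z) (q z) (w z) (- p z)"
  shows "has_normal_form 1 \<phi>"
proof -
  \<comment> \<open>The shape reached once the first basis vector is an eigenvector of the
    coefficient of x. If w0 = 0 it is an eigenvector of the coefficient of y^r too, and the field is
    triangular.\<close>
  have eigen: "has_normal_form 1 \<phi>" if nv: "nowhere_vanishing \<phi>" and
    \<phi>: "\<And>x y. (x, y) \<in> punctured \<Longrightarrow> \<phi> (x, y) =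
      mat2 (p1 * x + p0 * y ^ r) (q1 * x + q0 * y ^ r) (w0 * y ^ r) (- (p1 * x + p0 * y ^ r))"
    for \<phi> p1 p0 q1 q0 w0
  proof (cases "w0 = 0")
    case True
    have "has_normal_form (b powi (- int (0 * r))) \<phi>"
      by (rule triangular_normal_form[of "\<lambda>(x, y). q1 * x + q0 * y ^ r" 0 _ p1 p0])
        (use \<phi> True nv H0_linear[of q1 q0] in \<open>simp_all\<close>)
    then show ?thesis by simp
  next
    case False
    note conj = conjugate_companion[where \<phi> = \<phi>, OF False \<phi>]
    have "has_normal_form 1 (nf_field r (NF1 (w0 * q1 + 2 * p0 * p1) p1 (w0 * q0 + p0\<^sup>2)))"
      by (rule companion_normal_form[OF nowhere_vanishing_conjugate[OF conj nv]])
    then show ?thesis using has_normal_form_conjugate[OF _ conj] by simp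
  qed
  obtain p1 p0 where p': "\<And>x y. (x, y) \<in> punctured \<Longrightarrow> p (x, y) = p1 * x + p0 * y ^ r"
    using H0_degree_r[OF p] by blast
  obtain q1 q0 where q': "\<And>x y. (x, y) \<in> punctured \<Longrightarrow> q (x, y) = q1 * x + q0 * y ^ r"
    using H0_degree_r[OF q] by blast
  obtain w1 w0 where w': "\<And>x y. (x, y) \<in> punctured \<Longrightarrow> w (x, y) = w1 * x + w0 * y ^ r"
    using H0_degree_r[OF w] by blast
  show ?thesis
  proof (cases "q1 = 0")
    case True
    note conj = conjugate_swap[OF \<phi>]
    have "has_normal_form 1 (\<lambda>z. mat2 (- p z) (w z) (q z) (p z))"
      by (rule eigen[of _ "- p1" "- p0" w1 w0 q0])
        (use True nowhere_vanishing_conjugate[OF conj nv] in \<open>simp_all add: p' q' w'\<close>)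
    then show ?thesis using has_normal_form_conjugate[OF _ conj] by simp
  next
    case False
    \<comment> \<open>With this l, (1, l) is an eigenvector of the coefficient of x; in the case q1
      = 0 the vector (0, 1) was one.\<close>
    then obtain l where l: "q1 * l\<^sup>2 + 2 * p1 * l + (- w1) = 0" by (rule quadratic_root)
    note conj = conjugate_shear[where l = l, OF \<phi>]
    have "has_normal_form 1 (\<lambda>z. mat2 (p z + l * q z) (q z) (w z - 2 * l * p z - l\<^sup>2 * q z) (- (p z + l * q z)))"
    proof (rule eigen[of _ "p1 + l * q1" "p0 + l * q0" q1 q0 "w0 - 2 * l * p0 - l\<^sup>2 * q0"])
      fix x y :: complex assume z: "(x, y) \<in> punctured"
      have w1: "w1 = q1 * l\<^sup>2 + 2 * p1 * l" using l by (simp add: algebra_simps)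
      show "mat2 (p (x, y) + l * q (x, y)) (q (x, y)) (w (x, y) - 2 * l * p (x, y) - l\<^sup>2 * q (x, y))
          (- (p (x, y) + l * q (x, y))) =
        mat2 ((p1 + l * q1) * x + (p0 + l * q0) * y ^ r) (q1 * x + q0 * y ^ r)
          ((w0 - 2 * l * p0 - l\<^sup>2 * q0) * y ^ r) (- ((p1 + l * q1) * x + (p0 + l * q0) * y ^ r))"
        unfolding p'[OF z] q'[OF z] w'[OF z] w1 by (simp add: algebra_simps)
    qed (rule nowhere_vanishing_conjugate[OF conj nv])
    then show ?thesis using has_normal_form_conjugate[OF _ conj] by simp
  qed
qed

section \<open>Bundles of negative degree: lower left entry zero, constant or a power of y\<close>

lemma normal_form_w_zero:
  assumes p: "p \<in> H0 b r (b ^ r)" and q: "q \<in> H0 b r (b ^ (r + k))" and k: "k > 0" "\<not> r dvd k"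
    and nv: "nowhere_vanishing \<phi>"
    and \<phi>: "\<And>x y. (x, y) \<in> punctured \<Longrightarrow> \<phi> (x, y) = mat2 (p (x, y)) (q (x, y)) 0 (- p (x, y))"
  shows "has_normal_form (b powi (- int k)) \<phi>"
proof -
  obtain u v where p': "\<And>x y. (x, y) \<in> punctured \<Longrightarrow> p (x, y) = u * x + v * y ^ r"
    using H0_degree_r[OF p] by blast
  obtain a where a: "\<And>x y. (x, y) \<in> punctured \<Longrightarrow>
    q (x, y) = (\<Sum>i | r * i \<le> r + k. a i * x ^ i * y ^ (r + k - r * i))" using H0_nat_expansion[OF q] by blast
  \<comment> \<open>A pure power of x would require r i = r + k, impossible as r does not divide k.
    So q vanishes at (1, 0) and p does not; having an x-term, p can be used to eliminate x from
    q.\<close>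
  have "q (1, 0) = (\<Sum>i | r * i \<le> r + k. a i * 1 ^ i * 0 ^ (r + k - r * i))" by (rule a) simp
  also have "\<dots> = (\<Sum>i | r * i \<le> r + k. 0)"
  proof (rule sum.cong)
    fix i assume i: "i \<in> {i. r * i \<le> r + k}"
    have "r + k \<noteq> r * i"
    proof
      assume "r + k = r * i"
      then have "r dvd r + k" by simp
      then show False using k by simp
    qed
    then have "r + k - r * i > 0" using i by simp
    then show "a i * 1 ^ i * 0 ^ (r + k - r * i) = 0" by (simp add: power_0_left)
  qed simp
  finally have q10: "q (1, 0) = 0" by simp
  have "\<phi> (1, 0) \<noteq> 0" using nv by (simp add: nowhere_vanishing_def)
  then have p10: "p (1, 0) \<noteq> 0" using \<phi>[of 1 0] q10 by simp
  then have u: "u \<noteq> 0" using p'[of 1 0] by (simp add: power_0_left)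
  obtain c g where g: "g \<in> H0 b r (b ^ k)" and q': "\<And>x y. (x, y) \<in> punctured \<Longrightarrow>
      q (x, y) = c * y ^ (r + k) + (u * x + v * y ^ r) * g (x, y)"
  proof (rule H0_reduce[OF u q, of v])
    fix c g
    assume "g \<in> H0 b r (b ^ k)" "\<And>x y. (x, y) \<in> punctured \<Longrightarrow>
      q (x, y) = c * y ^ (r + k) + (u * x + v * y ^ r) * g (x, y)"
    then show thesis by (rule that)
  qed
  have c: "c \<noteq> 0"
  proof
    assume c: "c = 0"
    obtain x y where z: "(x, y) \<in> punctured" "u * x + v * y ^ r = 0" by (rule linear_form_has_zero)
    then have "\<phi> (x, y) = 0" using \<phi>[OF z(1)] q'[OF z(1)] p'[OF z(1)] c by simp
    then show False using nv z by (simp add: nowhere_vanishing_def)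
  qed
  have "conjugate b r (b powi (- int k)) \<phi> (nf_field r (NF5 k p))"
  proof (rule conjugate_triangular[OF c])
    show "g \<in> H0 b r (1 / b powi (- int k))" using g by (simp only: inverse_powi_b)
    show "nf_field r (NF5 k p) (x, y) = mat2 (p (x, y)) ((\<lambda>(x, y). y ^ (r + k)) (x, y)) 0 (- p (x, y))" for x y
      by simp
    show "q (x, y) = c * (\<lambda>(x, y). y ^ (r + k)) (x, y) + p (x, y) * g (x, y)" if "(x, y) \<in> punctured" for x y
      using q'[OF that] p'[OF that] by simp
  qed (rule \<phi>)
  then show ?thesis
    unfolding has_normal_form_def using k p p10 by (intro exI[of _ "NF5 k p"]) simp
qed

text \<open>For this H the diagonal entry p is itself an admissible off-diagonal entry of an
  automorphism, so it can be cleared completely. What remains in the upper right is minus the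
  determinant, which conjugation preserves.\<close>

lemma normal_form_w_constant:
  assumes p: "p \<in> H0 b r (b ^ r)" and q: "q \<in> H0 b r (b ^ (2 * r))" and w: "w0 \<noteq> 0"
    and \<phi>: "\<And>x y. (x, y) \<in> punctured \<Longrightarrow> \<phi> (x, y) = mat2 (p (x, y)) (q (x, y)) w0 (- p (x, y))"
  shows "has_normal_form (b powi (- int r)) \<phi>"
proof -
  define \<beta> where "\<beta> = (\<lambda>z. w0 * q z + p z * p z)"
  have "\<beta> \<in> H0 b r (b ^ (2 * r))"
    unfolding \<beta>_def using H0_add[OF H0_cmult[OF q, of w0], of "\<lambda>z. p z * p z"] H0_mult[OF p p]
    by (simp add: power_add[symmetric] mult_2)
  moreover have "conjugate b r (b powi (- int r)) \<phi> (nf_field r (NF2 \<beta>))"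
  proof (rule conjugateI[of "\<lambda>_. w0" "\<lambda>z. - p z" _ "\<lambda>_. 0" "\<lambda>_. 1"])
    show "(\<lambda>z. - p z) \<in> H0 b r (1 / b powi - int r)"
      unfolding inverse_powi_b by (rule H0_uminus[OF p])
  qed (use w in \<open>simp_all add: \<phi> \<beta>_def algebra_simps\<close>)
  ultimately show ?thesis
    unfolding has_normal_form_def by (intro exI[of _ "NF2 \<beta>"]) simp
qed

text \<open>Off-diagonal automorphism entries are multiples of y^k, and y^(r - k) y^k = y^r, so
  exactly the y^r-term of p can be cleared. At (1, 0) both off-diagonal entries of the field vanish,
  hence the x-coefficient s does not.\<close>

lemma normal_form_w_power:
  assumes p: "p \<in> H0 b r (b ^ r)" and q: "q \<in> H0 b r (b ^ (r + k))" and w: "w0 \<noteq> 0"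
    and k: "0 < k" "k < r" and nv: "nowhere_vanishing \<phi>"
    and \<phi>: "\<And>x y. (x, y) \<in> punctured \<Longrightarrow>
      \<phi> (x, y) = mat2 (p (x, y)) (q (x, y)) (w0 * y ^ (r - k)) (- p (x, y))"
  shows "has_normal_form (b powi (- int k)) \<phi>"
proof -
  obtain s e where p': "\<And>x y. (x, y) \<in> punctured \<Longrightarrow> p (x, y) = s * x + e * y ^ r"
    using H0_degree_r[OF p] by blast
  obtain q1 q0 where q': "\<And>x y. (x, y) \<in> punctured \<Longrightarrow> q (x, y) = q1 * x * y ^ (r + k - r) + q0 * y ^ (r + k)"
    using H0_middle[OF q] k by auto
  have "\<phi> (1, 0) = mat2 s 0 0 (- s)"
    using \<phi>[of 1 0] p'[of 1 0] q'[of 1 0] k by (simp add: power_0_left)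
  then have s: "s \<noteq> 0" using nowhere_vanishingD[OF nv, of "(1, 0)"] by auto
  have yr: "y ^ (r - k) * y ^ k = y ^ r" for y :: complex
    using k by (simp add: power_add[symmetric])
  define m :: "complex \<times> complex \<Rightarrow> complex" where "m = (\<lambda>(x, y). 1 * x ^ 0 * y ^ k)"
  have m: "m \<in> H0 b r (b ^ k)" unfolding m_def by (rule H0_monomial) simp
  \<comment> \<open>This is w0 q + e y^k (p + s x), as the invariant determinant dictates: p^2 - (s
    x)^2 = e y^r (p + s x), divided by y^(r - k).\<close>
  define \<beta> where "\<beta> = (\<lambda>z. w0 * q z - (- e) * (m z * p z) + e * (m z * (\<lambda>(x, y). s * x + 0 * y ^ r) z))"
  have mp: "(\<lambda>z. m z * p z) \<in> H0 b r (b ^ (r + k))"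
    using H0_mult[OF m p] by (simp add: power_add mult.commute)
  have ml: "(\<lambda>z. m z * (\<lambda>(x, y). s * x + 0 * y ^ r) z) \<in> H0 b r (b ^ (r + k))"
    using H0_mult[OF m H0_linear[of s 0]] by (simp only: power_add mult.commute)
  have "\<beta> \<in> H0 b r (b ^ (r + k))"
    unfolding \<beta>_def by (intro H0_add H0_diff H0_cmult q mp ml)
  moreover have "conjugate b r (b powi (- int k)) \<phi> (nf_field r (NF4 k s \<beta>))"
  proof (rule conjugateI[of "\<lambda>_. w0" "\<lambda>z. (- e) * m z" _ "\<lambda>_. 0" "\<lambda>_. 1"])
    show "(\<lambda>z. (- e) * m z) \<in> H0 b r (1 / b powi - int k)"
      unfolding inverse_powi_b by (rule H0_cmult[OF m])
    fix x y :: complex assume z: "(x, y) \<in> punctured"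
    show "nf_field r (NF4 k s \<beta>) (x, y) ** mat2 w0 (- e * m (x, y)) 0 1 = mat2 w0 (- e * m (x, y)) 0 1 ** \<phi> (x, y)"
      unfolding \<phi>[OF z] by (simp add: \<beta>_def m_def p'[OF z] yr[symmetric] algebra_simps)
  qed (use w in simp_all)
  ultimately show ?thesis
    unfolding has_normal_form_def using s k by (intro exI[of _ "NF4 k s \<beta>"]) simp
qed

lemma normal_form_exists:
  assumes \<tau>: "\<tau> \<noteq> 0" "lb_degree b \<tau> \<le> 0" and higgs: "higgs_field b r (b ^ r) \<tau> \<phi>"
    and nv: "nowhere_vanishing \<phi>"
  shows "has_normal_form \<tau> \<phi>"
proof -
  define p where "p = (\<lambda>z. \<phi> z $ 1 $ 1)"
  define q where "q = (\<lambda>z. \<phi> z $ 1 $ 2)"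
  define w where "w = (\<lambda>z. \<phi> z $ 2 $ 1)"
  have p: "p \<in> H0 b r (b ^ r)" and q: "q \<in> H0 b r (b ^ r / \<tau>)" and w: "w \<in> H0 b r (b ^ r * \<tau>)"
    using higgs by (simp_all add: higgs_field_def End_sections_def p_def q_def w_def)
  have \<phi>: "\<phi> z = mat2 (p z) (q z) (w z) (- p z)" if "z \<in> punctured" for z
  proof -
    have "trace (\<phi> z) = 0" using higgs that by (simp add: higgs_field_def)
    then show ?thesis
      by (simp add: eq_mat2_iff p_def q_def w_def trace_def sum_2 eq_neg_iff_add_eq_0 add.commute)
  qed
  \<comment> \<open>At a zero of p one of q and w is nonzero, and a bundle with a nonzero section
    has a power of b as multiplier; so \<tau> is a power of b.\<close>
  obtain x0 y0 where z0: "(x0, y0) \<in> punctured" "p (x0, y0) = 0"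
  proof -
    obtain u v where "\<And>x y. (x, y) \<in> punctured \<Longrightarrow> p (x, y) = u * x + v * y ^ r"
      using H0_degree_r[OF p] by blast
    then show thesis using linear_form_has_zero[of u v thesis] that by metis
  qed
  have "q (x0, y0) \<noteq> 0 \<or> w (x0, y0) \<noteq> 0"
    using nowhere_vanishingD[OF nv z0(1)] z0(2) \<phi>[OF z0(1)] by auto
  then have "\<exists>m. \<tau> = b powi m"
  proof
    assume "q (x0, y0) \<noteq> 0"
    then obtain n where "b ^ r / \<tau> = b powi n" using H0_trivial[OF q _ _ z0(1)] \<tau> by auto
    then have "\<tau> = b powi (int r - n)" using \<tau>(1) by (simp add: power_int_diff field_simps)
    then show ?thesis by blast
  next
    assume "w (x0, y0) \<noteq> 0"
    then obtain n where "b ^ r * \<tau> = b powi n" using H0_trivial[OF w _ _ z0(1)] \<tau> by auto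
    then have "\<tau> = b powi (n - int r)" using \<tau>(1) by (simp add: power_int_diff field_simps)
    then show ?thesis by blast
  qed
  then obtain m where m: "\<tau> = b powi m" by blast
  then have "m \<le> 0" using \<tau>(2) by (simp add: lb_degree_powi)
  define k where "k = nat (- m)"
  have \<tau>_eq: "\<tau> = b powi (- int k)" using m \<open>m \<le> 0\<close> by (simp add: k_def)
  have q': "q \<in> H0 b r (b ^ (r + k))" using q unfolding \<tau>_eq power_minus_b .
  have "b ^ r * \<tau> = b powi (int r - int k)" unfolding \<tau>_eq by (simp add: power_int_diff power_int_minus divide_inverse)
  then have w': "w \<in> H0 b r (b powi (int r - int k))" using w by simp
  have w0: "\<phi> (x, y) = mat2 (p (x, y)) (q (x, y)) 0 (- p (x, y))"
    if "\<forall>z\<in>punctured. w z = 0" "(x, y) \<in> punctured" for x y using \<phi>[OF that(2)] that by simp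
  consider "k = 0" | "k > 0" "\<forall>z\<in>punctured. w z = 0" | "k > 0" "\<not> (\<forall>z\<in>punctured. w z = 0)" by blast
  then show ?thesis
  proof cases
    case 1
    have "has_normal_form 1 \<phi>"
      by (rule normal_form_trivial_bundle[of q w p])
        (use q' w' p nv \<phi> 1 in simp_all)
    then show ?thesis using 1 by (simp add: \<tau>_eq)
  next
    case 2
    show ?thesis
    proof (cases "r dvd k")
      case True
      then obtain j where k: "k = j * r" by (metis dvd_def mult.commute)
      obtain u v where "\<And>x y. (x, y) \<in> punctured \<Longrightarrow> p (x, y) = u * x + v * y ^ r"
        using H0_degree_r[OF p] by blast
      then show ?thesis
        unfolding \<tau>_eq k using q' w0[OF 2(2)] nv
        by (intro triangular_normal_form[of q j \<phi> u v]) (simp_all add: k)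
    next
      case False
      show ?thesis
        unfolding \<tau>_eq by (rule normal_form_w_zero[OF p q' 2(1) False nv w0[OF 2(2)]])
    qed
  next
    case 3
    \<comment> \<open>Otherwise w would be a section of negative weight and vanish.\<close>
    have kr: "k \<le> r"
    proof (rule ccontr)
      assume "\<not> k \<le> r"
      then have "w z = 0" if "z \<in> punctured" for z using H0_negative[OF w' _ that] by simp
      then show False using 3 by blast
    qed
    have rk: "int r - int k = int (r - k)" using kr by simp
    have w'': "w \<in> H0 b r (b ^ (r - k))" using w' unfolding rk power_int_of_nat .
    have "r - k < r" using 3 by simp
    then obtain c where c: "\<And>x y. (x, y) \<in> punctured \<Longrightarrow> w (x, y) = c * y ^ (r - k)"
      using H0_small[OF w''] by blast
    then have c0: "c \<noteq> 0" using 3 by auto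
    have \<phi>c: "\<phi> (x, y) = mat2 (p (x, y)) (q (x, y)) (c * y ^ (r - k)) (- p (x, y))"
      if "(x, y) \<in> punctured" for x y using \<phi>[OF that] c[OF that] by simp
    show ?thesis
    proof (cases "k = r")
      case True
      show ?thesis
        unfolding \<tau>_eq True
        by (rule normal_form_w_constant[OF p _ c0, of q]) (use q' \<phi>c True in \<open>simp_all add: mult_2\<close>)
    next
      case False
      then show ?thesis
        unfolding \<tau>_eq using kr 3
        by (intro normal_form_w_power[OF p q' c0 _ _ nv \<phi>c]) simp_all
    qed
  qed
qed


subsection \<open>The normal forms are nowhere-vanishing Higgs fields\<close>

text \<open>The k with H = (L_b)^(-k), so that comparing bundles becomes comparing natural
  numbers.\<close>

primrec nf_weight :: "normal_form \<Rightarrow> nat" where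
  "nf_weight (NF1 s t u) = 0"
| "nf_weight (NF2 \<beta>) = r"
| "nf_weight (NF3 k u v) = k * r"
| "nf_weight (NF4 k s \<beta>) = k"
| "nf_weight (NF5 k \<alpha>) = k"

lemma nf_bundle_eq_powi: "nf_bundle b r N = b powi (- int (nf_weight N))"
  by (cases N) simp_all

lemma nf_bundle_eq_iff: "nf_bundle b r N = nf_bundle b r N' \<longleftrightarrow> nf_weight N = nf_weight N'"
  by (simp only: nf_bundle_eq_powi powi_b_inj) simp

lemma nf_bundle_nz: "nf_bundle b r N \<noteq> 0"
  by (simp add: nf_bundle_eq_powi)

lemma nf_bundle_degree: "lb_degree b (nf_bundle b r N) \<le> 0"
  by (simp add: nf_bundle_eq_powi lb_degree_powi del: nf_bundle.simps)

lemma higgs_field_mat2I: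
  assumes "p \<in> H0 b r (b ^ r)" "q \<in> H0 b r (b ^ (r + k))"
    and "w \<in> H0 b r (b powi (int r - int k))"
    and "\<And>x y. \<phi> (x, y) = mat2 (p (x, y)) (q (x, y)) (w (x, y)) (- p (x, y))"
  shows "higgs_field b r (b ^ r) (b powi (- int k)) \<phi>"
proof -
  have \<phi>: "\<phi> = (\<lambda>z. mat2 (p z) (q z) (w z) (- p z))" using assms(4) by auto
  have t: "b ^ r * b powi (- int k) = b powi (int r - int k)"
    by (simp add: power_int_diff power_int_minus divide_inverse)
  show ?thesis
    unfolding higgs_field_def End_sections_def \<phi> t power_minus_b
    using assms(1-3) H0_uminus[OF assms(1)] by simp
qed

lemma nf_field_higgs:
  assumes "nf_admissible b r N"
  shows "higgs_field b r (b ^ r) (nf_bundle b r N) (nf_field r N)"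
proof (cases N)
  case (NF1 s t u)
  have "higgs_field b r (b ^ r) (b powi (- int 0)) (nf_field r N)"
    by (rule higgs_field_mat2I[OF H0_linear[of t 0] _ _, of "\<lambda>(x, y). s * x + u * y ^ r" _ "\<lambda>(x, y). 0 * x + 1 * y ^ r"])
      (use H0_linear[of s u] H0_linear[of 0 1] in \<open>simp_all add: NF1\<close>)
  then show ?thesis by (simp add: NF1)
next
  case (NF2 \<beta>)
  show ?thesis
    unfolding NF2 nf_bundle.simps
    by (rule higgs_field_mat2I[of "\<lambda>_. 0" \<beta> _ "\<lambda>_. 1"]) (use assms in \<open>simp_all add: NF2 mult_2\<close>)
next
  case (NF3 k u v)
  show ?thesis
    unfolding NF3 nf_bundle.simps
  proof (rule higgs_field_mat2I[OF H0_linear[of u v] _ H0_zero])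
    show "(\<lambda>(x, y). (cnj v * x + (- cnj u) * y ^ r) ^ (1 + k)) \<in> H0 b r (b ^ (r + k * r))"
      using H0_power[OF H0_linear[of "cnj v" "- cnj u"], of "1 + k"]
      by (simp add: case_prod_beta' power_add power_mult[symmetric] mult.commute)
  qed simp
next
  case (NF4 k s \<beta>)
  then have k: "0 < k" "k < r" using assms by simp_all
  show ?thesis
    unfolding NF4 nf_bundle.simps
  proof (rule higgs_field_mat2I[OF H0_linear[of s 0]])
    have "int r - int k = int (r - k)" using k by simp
    then show "(\<lambda>(x, y). 1 * x ^ 0 * y ^ (r - k)) \<in> H0 b r (b powi (int r - int k))"
      by (simp only: power_int_of_nat) (rule H0_monomial, simp)
  qed (use assms NF4 in simp_all)
next
  case (NF5 k \<alpha>)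
  show ?thesis
    unfolding NF5 nf_bundle.simps
  proof (rule higgs_field_mat2I[of \<alpha> _ _ "\<lambda>_. 0"])
    show "(\<lambda>(x, y). 1 * x ^ 0 * y ^ (r + k)) \<in> H0 b r (b ^ (r + k))" by (rule H0_monomial) simp
  qed (use assms NF5 in simp_all)
qed

text \<open>Cramer's rule, with determinant |u|^2 + |v|^2 up to sign. Used with y^r in place of y,
  it shows that the entries in family (3) have no common zero.\<close>

lemma orthogonal_forms_zero:
  assumes "u \<noteq> 0 \<or> v \<noteq> 0" "u * x + v * y = 0" "cnj v * x - cnj u * y = 0"
  shows "x = 0 \<and> y = 0"
proof -
  have "(cnj u * u + cnj v * v) * x = cnj u * (u * x + v * y) + v * (cnj v * x - cnj u * y)"
    "(cnj u * u + cnj v * v) * y = cnj v * (u * x + v * y) - u * (cnj v * x - cnj u * y)"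
    by (simp_all add: algebra_simps)
  then have "(cnj u * u + cnj v * v) * x = 0" "(cnj u * u + cnj v * v) * y = 0"
    unfolding assms(2,3) by simp_all
  then show ?thesis using cnj_form_nz[OF assms(1)] by (simp only: mult_eq_0_iff) blast
qed

lemma H0_degree_r_y_zero:
  assumes "\<alpha> \<in> H0 b r (b ^ r)" "\<alpha> (1, 0) \<noteq> 0" "x \<noteq> 0"
  shows "\<alpha> (x, 0) \<noteq> 0"
proof -
  obtain u v where "\<And>x y. (x, y) \<in> punctured \<Longrightarrow> \<alpha> (x, y) = u * x + v * y ^ r"
    using H0_degree_r[OF assms(1)] by blast
  from this[of 1 0] this[of x 0] show ?thesis using assms(2,3) by (simp add: power_0_left)
qed

lemma nf_field_nowhere_vanishing:
  assumes "nf_admissible b r N"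
  shows "nowhere_vanishing (nf_field r N)"
  unfolding nowhere_vanishing_def
proof (intro ballI notI)
  fix z assume z: "z \<in> punctured" "nf_field r N z = 0"
  obtain x y where xy: "z = (x, y)" by (cases z)
  then have xy0: "x \<noteq> 0 \<or> y \<noteq> 0" using z by simp
  show False
  proof (cases N)
    case (NF1 s t u)
    then show False using z xy xy0 assms by (auto simp: power_0_left)
  next
    case (NF2 \<beta>)
    then show False using z by simp
  next
    case (NF3 k u v)
    then have "u * x + v * y ^ r = 0" "cnj v * x - cnj u * y ^ r = 0" using z xy by auto
    then show False using orthogonal_forms_zero[of u v x "y ^ r"] assms NF3 xy0 by auto
  next
    case (NF4 k s \<beta>)
    then show False using z xy xy0 assms by auto
  next
    case (NF5 k \<alpha>)
    then have "\<alpha> (x, 0) = 0" "y = 0" using z xy by auto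
    then show False using H0_degree_r_y_zero[of \<alpha> x] assms NF5 xy0 by simp
  qed
qed

subsection \<open>Uniqueness of the normal form\<close>

lemma H0_one:
  assumes "s \<in> H0 b r 1"
  obtains c where "\<And>z. z \<in> punctured \<Longrightarrow> s z = c"
proof -
  have "s \<in> H0 b r (b ^ 0)" using assms by simp
  then obtain c where "\<And>x y. (x, y) \<in> punctured \<Longrightarrow> s (x, y) = c * y ^ 0"
    using H0_small r_nz(2) by blast
  then show ?thesis using that[of c] by force
qed

lemma conjugate_trivialD:
  assumes "conjugate b r 1 \<phi> \<phi>'"
  obtains a e c d where "a * d - e * c \<noteq> 0"
    "\<And>z. z \<in> punctured \<Longrightarrow> \<phi>' z ** mat2 a e c d = mat2 a e c d ** \<phi> z"
proof -
  from assms obtain a e c d where H: "a \<in> H0 b r 1" "e \<in> H0 b r 1" "c \<in> H0 b r 1" "d \<in> H0 b r 1"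
    and eq: "\<And>z. z \<in> punctured \<Longrightarrow> a z * d z - e z * c z \<noteq> 0 \<and>
        \<phi>' z ** mat2 (a z) (e z) (c z) (d z) = mat2 (a z) (e z) (c z) (d z) ** \<phi> z"
    unfolding conjugate_iff by (metis div_by_1)
  obtain a' where "\<And>z. z \<in> punctured \<Longrightarrow> a z = a'" using H0_one[OF H(1)] by blast
  moreover obtain e' where "\<And>z. z \<in> punctured \<Longrightarrow> e z = e'" using H0_one[OF H(2)] by blast
  moreover obtain c' where "\<And>z. z \<in> punctured \<Longrightarrow> c z = c'" using H0_one[OF H(3)] by blast
  moreover obtain d' where "\<And>z. z \<in> punctured \<Longrightarrow> d z = d'" using H0_one[OF H(4)] by blast
  ultimately show ?thesis
    using that[of a' d' e' c'] eq eq[of "(1, 0)"] by (simp add: punctured_def)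
qed

text \<open>The lower left entry of an automorphism has negative weight and vanishes; the diagonal
  entries have weight 0, so they are constants with nonzero product.\<close>

lemma conjugate_negativeD:
  assumes "conjugate b r (b powi (- int k)) \<phi> \<phi>'" "k > 0"
  obtains a e d where "a \<noteq> 0" "d \<noteq> 0" "e \<in> H0 b r (b ^ k)"
    "\<And>z. z \<in> punctured \<Longrightarrow> \<phi>' z ** mat2 a (e z) 0 d = mat2 a (e z) 0 d ** \<phi> z"
proof -
  from assms(1) obtain a e c d where H: "a \<in> H0 b r 1" "e \<in> H0 b r (1 / b powi (- int k))"
      "c \<in> H0 b r (b powi (- int k))" "d \<in> H0 b r 1"
    and eq: "\<And>z. z \<in> punctured \<Longrightarrow> a z * d z - e z * c z \<noteq> 0 \<and>
        \<phi>' z ** mat2 (a z) (e z) (c z) (d z) = mat2 (a z) (e z) (c z) (d z) ** \<phi> z"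
    unfolding conjugate_iff by metis
  have e: "e \<in> H0 b r (b ^ k)" using H(2) unfolding inverse_powi_b .
  obtain a' where a': "\<And>z. z \<in> punctured \<Longrightarrow> a z = a'" using H0_one[OF H(1)] by blast
  obtain d' where d': "\<And>z. z \<in> punctured \<Longrightarrow> d z = d'" using H0_one[OF H(4)] by blast
  have c: "c z = 0" if "z \<in> punctured" for z
    using H0_negative[OF H(3) _ that] assms(2) by simp
  have z1: "(1, 0) \<in> punctured" by simp
  have "a' \<noteq> 0" "d' \<noteq> 0" using eq[OF z1] a'[OF z1] d'[OF z1] c[OF z1] by auto
  then show ?thesis
    using that[of a' d' e] e eq a' d' c by simp
qed

text \<open>With the Higgs field written x A + y^r B, the conjugating matrix is s + 2 t B: it commutes with B
  and takes the t-eigenvector of A to that of its counterpart for - t.\<close>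
lemma conjugate_NF1_neg:
  assumes "s\<^sup>2 - 4 * t\<^sup>2 * u \<noteq> 0"
  shows "conjugate b r 1 (nf_field r (NF1 s t u)) (nf_field r (NF1 s (- t) u))"
  by (rule conjugateI[of "\<lambda>_. s" "\<lambda>_. 2 * t * u" _ "\<lambda>_. 2 * t" "\<lambda>_. s"])
    (use assms in \<open>simp_all add: algebra_simps power2_eq_square\<close>)

lemma det_NF1: "det (nf_field r (NF1 s t u) (x, y)) = - (t\<^sup>2 * x\<^sup>2 + s * x * y ^ r + u * (y ^ r)\<^sup>2)"
  by (simp add: algebra_simps power2_eq_square)

lemma det_NF3: "det (nf_field r (NF3 k u v) (x, y)) = - (u * x + v * y ^ r)\<^sup>2"
  by (simp add: algebra_simps power2_eq_square)

lemma linear_forms_eqD: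
  assumes "\<And>x y. (x, y) \<in> punctured \<Longrightarrow> u * x + v * y ^ r = u' * x + v' * y ^ r"
  shows "u = u' \<and> v = v'"
  using assms[of 1 0] assms[of 0 1] by (simp add: power_0_left)

lemma quadratic_forms_eqD:
  assumes "\<And>x y. (x, y) \<in> punctured \<Longrightarrow>
    a * x\<^sup>2 + c * x * y ^ r + d * (y ^ r)\<^sup>2 = a' * x\<^sup>2 + c' * x * y ^ r + d' * (y ^ r)\<^sup>2"
  shows "a = a' \<and> c = c' \<and> d = d'"
  using assms[of 1 0] assms[of 0 1] assms[of 1 1] by (simp add: power_0_left)

text \<open>Minus the determinant is the square of a linear form in family (3), but a quadratic form
  of nonzero discriminant in family (1). This separates the two families on the trivial
  bundle.\<close>

lemma NF1_NF3_det:
  assumes "s\<^sup>2 - 4 * t\<^sup>2 * u \<noteq> 0"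
    and "\<And>z. z \<in> punctured \<Longrightarrow> det (nf_field r (NF1 s t u) z) = det (nf_field r (NF3 k u' v') z)"
  shows False
proof -
  have "t\<^sup>2 * x\<^sup>2 + s * x * y ^ r + u * (y ^ r)\<^sup>2 = u'\<^sup>2 * x\<^sup>2 + (2 * u' * v') * x * y ^ r + v'\<^sup>2 * (y ^ r)\<^sup>2"
    if "(x, y) \<in> punctured" for x y
    using assms(2)[OF that] unfolding det_NF1 det_NF3 by (simp add: power2_eq_square algebra_simps)
  from quadratic_forms_eqD[OF this] have "t\<^sup>2 = u'\<^sup>2" "s = 2 * u' * v'" "u = v'\<^sup>2" by auto
  then show False using assms(1) by (simp add: power_mult_distrib)
qed

lemma nf_conjugate_imp_same:
  assumes adm: "nf_admissible b r N" "nf_admissible b r N'" and wt: "nf_weight N = nf_weight N'"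
    and conj: "conjugate b r (nf_bundle b r N) (nf_field r N) (nf_field r N')"
  shows "nf_same N N'"
proof -
  note det = det_conjugate[OF conj]
  \<comment> \<open>Conjugation by an upper triangular matrix rescales the lower left entry by a
    nonzero constant.\<close>
  have lower: "\<exists>c. c \<noteq> 0 \<and> (\<forall>z\<in>punctured. nf_field r N' z $ 2 $ 1 = c * nf_field r N z $ 2 $ 1)"
    if pos: "nf_weight N > 0"
  proof -
    obtain a e d where ad: "a \<noteq> 0" "d \<noteq> 0"
      and eq: "\<And>z. z \<in> punctured \<Longrightarrow> nf_field r N' z ** mat2 a (e z) 0 d = mat2 a (e z) 0 d ** nf_field r N z"
      using conjugate_negativeD[OF conj[unfolded nf_bundle_eq_powi] pos] by metis
    have "nf_field r N' z $ 2 $ 1 * a = d * nf_field r N z $ 2 $ 1" if "z \<in> punctured" for z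
    proof -
      have "(nf_field r N' z ** mat2 a (e z) 0 d) $ 2 $ 1 = (mat2 a (e z) 0 d ** nf_field r N z) $ 2 $ 1"
        using eq[OF that] by simp
      then show ?thesis by (simp add: matrix_matrix_mult_def sum_2)
    qed
    then show ?thesis using ad by (intro exI[of _ "d / a"]) (simp add: field_simps)
  qed
  \<comment> \<open>For a triangular field the determinant yields the diagonal entry up to sign
    only; comparing the upper left entries fixes the sign.\<close>
  have upper: "\<forall>z\<in>punctured. nf_field r N' z $ 1 $ 1 = nf_field r N z $ 1 $ 1"
    if pos: "nf_weight N > 0" and 0: "\<And>z. nf_field r N z $ 2 $ 1 = 0"
  proof
    fix z assume z: "z \<in> punctured"
    obtain a e d where ad: "a \<noteq> 0" "d \<noteq> 0"
      and eq: "\<And>z. z \<in> punctured \<Longrightarrow> nf_field r N' z ** mat2 a (e z) 0 d = mat2 a (e z) 0 d ** nf_field r N z"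
      using conjugate_negativeD[OF conj[unfolded nf_bundle_eq_powi] pos] by metis
    have "(nf_field r N' z ** mat2 a (e z) 0 d) $ 1 $ 1 = (mat2 a (e z) 0 d ** nf_field r N z) $ 1 $ 1"
      using eq[OF z] by simp
    then show "nf_field r N' z $ 1 $ 1 = nf_field r N z $ 1 $ 1"
      using ad 0 by (simp add: matrix_matrix_mult_def sum_2)
  qed
  \<comment> \<open>At (0, 1) the lower left entry is 1 in families (2) and (4) and 0 in families
    (3) and (5), which separates families sharing a bundle.\<close>
  have lower01: "nf_field r N' (0, 1) $ 2 $ 1 = 0 \<longleftrightarrow> nf_field r N (0, 1) $ 2 $ 1 = 0" if pos: "nf_weight N > 0"
  proof -
    have "(0, 1) \<in> punctured" by simp
    then show ?thesis using lower[OF pos] by (metis mult_eq_0_iff)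
  qed
  show ?thesis
  proof (cases N)
    case N: (NF1 s t u)
    show ?thesis
    proof (cases N')
      case N': (NF1 s' t' u')
      have "t\<^sup>2 * x\<^sup>2 + s * x * y ^ r + u * (y ^ r)\<^sup>2 = t'\<^sup>2 * x\<^sup>2 + s' * x * y ^ r + u' * (y ^ r)\<^sup>2"
        if "(x, y) \<in> punctured" for x y
        using det[OF that, symmetric] unfolding N N' det_NF1 neg_equal_iff_equal .
      from quadratic_forms_eqD[OF this] show ?thesis by (auto simp: N N' power2_eq_iff)
    next
      case N': (NF3 k u' v')
      have False by (rule NF1_NF3_det[of s t u k u' v']) (use adm det in \<open>simp_all add: N N'\<close>)
      then show ?thesis ..
    qed (use wt adm r_nz N in auto)
  next
    case N: (NF2 \<beta>)
    show ?thesis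
    proof (cases N')
      case N': (NF2 \<beta>')
      then show ?thesis using det by (simp add: N)
    next
      case N': (NF3 k u v)
      then show ?thesis using lower01 by (simp add: N)
    qed (use wt adm r_nz N in auto)
  next
    case N: (NF3 k u v)
    show ?thesis
    proof (cases N')
      case N': (NF1 s' t' u')
      have False by (rule NF1_NF3_det[of s' t' u' k u v]) (use adm det in \<open>simp_all add: N N'\<close>)
      then show ?thesis ..
    next
      case N': (NF2 \<beta>')
      then show ?thesis using lower01 wt by (simp add: N)
    next
      case N': (NF3 k' u' v')
      have k': "k' = k" using wt N N' by simp
      have "u' * x + v' * y ^ r = u * x + v * y ^ r" if xy: "(x, y) \<in> punctured" for x y
      proof (cases "k = 0")
        case False
        then show ?thesis using bspec[OF upper xy] by (simp add: N N' split: prod.splits)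
      next
        case True
        have "conjugate b r 1 (nf_field r N) (nf_field r N')" using conj N True by simp
        then obtain a e c d where nz: "a * d - e * c \<noteq> 0"
          and eq: "\<And>z. z \<in> punctured \<Longrightarrow> nf_field r N' z ** mat2 a e c d = mat2 a e c d ** nf_field r N z"
          using conjugate_trivialD by metis
        define A where "A = (\<lambda>(x, y). u * x + v * y ^ r)"
        define A' where "A' = (\<lambda>(x, y). u' * x + v' * y ^ r)"
        define Q where "Q = (\<lambda>(x, y). cnj v * x - cnj u * y ^ r)"
        define Q' where "Q' = (\<lambda>(x, y). cnj v' * x - cnj u' * y ^ r)"
        have E: "A' z * a + Q' z * c = a * A z" "- A' z * c = c * A z" "- A' z * d = c * Q z - d * A z"
          if "z \<in> punctured" for z
          using eq[OF that] that by (cases z; simp add: N N' k' True A_def A'_def Q_def Q'_def algebra_simps)+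
        \<comment> \<open>For c nonzero the relations would give A' = - A and make Q a multiple of
          A, although A and Q have no common zero. With c = 0 the automorphism is triangular, and
          the upper left entries agree.\<close>
        have "c = 0"
        proof (rule ccontr)
          assume c: "c \<noteq> 0"
          have cQ: "c * Q z = 2 * d * A z" if "z \<in> punctured" for z
          proof -
            have "c * (A' z + A z) = 0" unfolding distrib_left E(2)[OF that, symmetric] by simp
            then have "A' z = - A z" using c by (simp add: eq_neg_iff_add_eq_0)
            then show ?thesis using E(3)[OF that] by (simp add: algebra_simps)
          qed
          obtain x y where z: "(x, y) \<in> punctured" "u * x + v * y ^ r = 0" by (rule linear_form_has_zero)
          have "Q (x, y) = 0" using cQ[OF z(1)] z(2) c by (simp add: A_def)
          then show False
            using orthogonal_forms_zero[of u v x "y ^ r"] z adm(1) by (auto simp: N Q_def)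
        qed
        then have "A' (x, y) = A (x, y)" using E(1)[OF xy] nz by simp
        then show ?thesis by (simp add: A_def A'_def)
      qed
      from linear_forms_eqD[OF this] show ?thesis by (simp add: N N' k')
    qed (use wt adm r_nz N in auto)
  next
    case N: (NF4 k s \<beta>)
    show ?thesis
    proof (cases N')
      case N': (NF4 k' s' \<beta>')
      have k': "k' = k" using wt N N' by simp
      have k: "0 < k" "k < r" using adm(1) N by simp_all
      obtain a e d where ad: "a \<noteq> 0" "d \<noteq> 0" and e: "e \<in> H0 b r (b ^ k)"
        and eq: "\<And>z. z \<in> punctured \<Longrightarrow> nf_field r N' z ** mat2 a (e z) 0 d = mat2 a (e z) 0 d ** nf_field r N z"
        using conjugate_negativeD[of k] conj N k by (metis nf_bundle.simps(4))
      obtain c where c: "\<And>x y. (x, y) \<in> punctured \<Longrightarrow> e (x, y) = c * y ^ k"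
        using H0_small[OF e k(2)] by blast
      \<comment> \<open>The relation at (0, 1) gives d = a and c = 0, and at (1, 0) it gives s' = s.
        The conjugating matrix is therefore scalar.\<close>
      have da: "d = a" using eq[of "(0, 1)"] by (simp add: N N')
      have s': "s' = s" using eq[of "(1, 0)"] k ad by (simp add: N N' k' power_0_left)
      have "c = 0" using eq[of "(0, 1)"] by (simp add: N N' c)
      then have e0: "e z = 0" if "z \<in> punctured" for z using c[of "fst z" "snd z"] that by simp
      have "\<beta> z = \<beta>' z" if z: "z \<in> punctured" for z
      proof (cases z)
        case (Pair x y)
        have "e (x, y) = 0" using e0[OF z] Pair by simp
        then show ?thesis using eq[OF z] ad by (simp add: N N' Pair da s')
      qed
      then show ?thesis by (simp add: N N' k' s')
    next
      case N': (NF5 k' \<alpha>')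
      then show ?thesis using lower01 adm(1) by (simp add: N)
    qed (use wt adm r_nz N in auto)
  next
    case N: (NF5 k \<alpha>)
    show ?thesis
    proof (cases N')
      case N': (NF4 k' s' \<beta>')
      then show ?thesis using lower01 wt adm by (simp add: N)
    next
      case N': (NF5 k' \<alpha>')
      have h: "\<forall>z\<in>punctured. nf_field r N' z $ 1 $ 1 = nf_field r N z $ 1 $ 1"
        using upper adm(1) by (simp add: N split: prod.splits)
      have "\<alpha> z = \<alpha>' z" if "z \<in> punctured" for z
        using bspec[OF h that] by (cases z) (simp add: N N')
      then show ?thesis using wt by (simp add: N N')
    qed (use wt adm r_nz N in auto)
  qed
qed

text \<open>Except for the sign of t in family (1), equal parameters give fields that agree on the
  punctured plane, so the identity conjugates them.\<close>

lemma nf_same_imp_conjugate: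
  assumes "nf_admissible b r N" "nf_same N N'"
  shows "nf_weight N = nf_weight N' \<and> conjugate b r (nf_bundle b r N) (nf_field r N) (nf_field r N')"
proof (cases N; cases N')
  fix s t u s' t' u' assume N: "N = NF1 s t u" and N': "N' = NF1 s' t' u'"
  then consider "N' = N" | "N' = NF1 s (- t) u" using assms(2) by auto
  then show ?thesis
  proof cases
    case 1 then show ?thesis using conjugate_refl_on by simp
  next
    case 2
    then show ?thesis using conjugate_NF1_neg[of s t u] assms(1) by (simp add: N)
  qed
qed (use assms(2) in \<open>auto intro!: conjugate_refl_on\<close>)

end


subsection \<open>Invariant sub-line bundles\<close>

text \<open>Holomorphic functions on a connected domain have no zero divisors: A vanishes on the
  nonempty open set where f does not.\<close>

lemma holo2_punctured_cancel:
  assumes "holo2_on punctured A" "holo2_on punctured f" and eq: "\<And>z. z \<in> punctured \<Longrightarrow> A z * f z = 0"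
    and z0: "z0 \<in> punctured" "f z0 \<noteq> 0" and z: "z \<in> punctured"
  shows "A z = 0"
proof (rule holo2_identity[OF open_punctured connected_punctured assms(1)])
  show "open {z \<in> punctured. f z \<noteq> 0}" by (rule open_nonzero_holo2[OF open_punctured assms(2)])
  show "A w = 0" if "w \<in> {z \<in> punctured. f z \<noteq> 0}" for w using eq[of w] that by simp
  show "{z \<in> punctured. f z \<noteq> 0} \<noteq> {}" using z0 by blast
  show "{z \<in> punctured. f z \<noteq> 0} \<subseteq> punctured" by blast
qed (rule z)

text \<open>The factor e is s1 / f where f is nonzero and s2 / g where g is. It serves both
  components because s1 g = s2 f, which holds where h is nonzero and extends by density.\<close>

lemma torsion_free_quotientI:
  assumes f: "holo2_on punctured f" and g: "holo2_on punctured g"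
    and nz: "\<And>z. z \<in> punctured \<Longrightarrow> f z \<noteq> 0 \<or> g z \<noteq> 0"
  shows "torsion_free_quotient f g"
  unfolding torsion_free_quotient_def
proof (intro allI impI ballI)
  fix U h s1 s2 m p
  assume H: "open U \<and> U \<subseteq> punctured \<and>
        holo2_on U h \<and> holo2_on U s1 \<and> holo2_on U s2 \<and> holo2_on U m \<and>
        (\<forall>W. open W \<and> W \<noteq> {} \<and> W \<subseteq> U \<longrightarrow> (\<exists>z\<in>W. h z \<noteq> 0)) \<and>
        (\<forall>z\<in>U. h z * s1 z = m z * f z \<and> h z * s2 z = m z * g z)" and p: "p \<in> U"
  then have U: "open U" "U \<subseteq> punctured" and s: "holo2_on U s1" "holo2_on U s2"
    and dense: "\<And>W. open W \<Longrightarrow> W \<noteq> {} \<Longrightarrow> W \<subseteq> U \<Longrightarrow> \<exists>z\<in>W. h z \<noteq> 0"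
    and eq: "\<And>z. z \<in> U \<Longrightarrow> h z * s1 z = m z * f z \<and> h z * s2 z = m z * g z"
    by blast+
  have fU: "holo2_on U f" and gU: "holo2_on U g" using f g U(2) holo2_on_subset by blast+
  have cross: "s1 z * g z = s2 z * f z" if "z \<in> U" for z
  proof (rule ccontr)
    assume ne: "s1 z * g z \<noteq> s2 z * f z"
    define W where "W = {z \<in> U. s1 z * g z - s2 z * f z \<noteq> 0}"
    have "open W"
      unfolding W_def by (intro open_nonzero_holo2 U holo2_on_diff holo2_on_mult s fU gU)
    moreover have "z \<in> W" using ne that by (simp add: W_def)
    moreover have "W \<subseteq> U" unfolding W_def by blast
    ultimately obtain w where w: "w \<in> W" "h w \<noteq> 0" using dense[of W] by blast
    have "h w * (s1 w * g w - s2 w * f w) = (h w * s1 w) * g w - (h w * s2 w) * f w"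
      by (simp add: algebra_simps)
    also have "\<dots> = 0" using eq[of w] w by (simp add: W_def)
    finally show False using w by (simp add: W_def)
  qed
  show "\<exists>V e. open V \<and> p \<in> V \<and> V \<subseteq> U \<and> holo2_on V e \<and> (\<forall>z\<in>V. s1 z = e z * f z \<and> s2 z = e z * g z)"
  proof (cases "f p = 0")
    case False
    let ?V = "{z \<in> U. f z \<noteq> 0}"
    have V: "?V \<subseteq> U" by blast
    have "holo2_on ?V (\<lambda>z. s1 z / f z)"
      by (rule holo2_on_divide[OF holo2_on_subset[OF s(1) V] holo2_on_subset[OF fU V]]) simp
    moreover have "s1 z = s1 z / f z * f z \<and> s2 z = s1 z / f z * g z" if "z \<in> ?V" for z
      using that cross[of z] by (simp add: field_simps)
    ultimately show ?thesis
      using open_nonzero_holo2[OF U(1) fU] False p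
      by (intro exI[of _ ?V] exI[of _ "\<lambda>z. s1 z / f z"]) blast
  next
    case True
    let ?V = "{z \<in> U. g z \<noteq> 0}"
    have V: "?V \<subseteq> U" by blast
    have "holo2_on ?V (\<lambda>z. s2 z / g z)"
      by (rule holo2_on_divide[OF holo2_on_subset[OF s(2) V] holo2_on_subset[OF gU V]]) simp
    moreover have "s1 z = s2 z / g z * f z \<and> s2 z = s2 z / g z * g z" if "z \<in> ?V" for z
      using that cross[of z] by (simp add: field_simps)
    moreover have "g p \<noteq> 0" using nz[of p] True p U(2) by blast
    ultimately show ?thesis
      using open_nonzero_holo2[OF U(1) gU] p
      by (intro exI[of _ ?V] exI[of _ "\<lambda>z. s2 z / g z"]) blast
  qed
qed

text \<open>Torsion-freeness with h = c, the section (f', g') and m = 1 gives (f', g') = e (f, g) =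
  e c (f', g') near each point, so c cannot vanish.\<close>

lemma torsion_free_quotient_factor_nz:
  assumes tf: "torsion_free_quotient f g" and c: "holo2_on punctured c"
    and f': "holo2_on punctured f'" and g': "holo2_on punctured g'"
    and eq: "\<And>z. z \<in> punctured \<Longrightarrow> f z = c z * f' z \<and> g z = c z * g' z"
    and nz': "\<And>z. z \<in> punctured \<Longrightarrow> f' z \<noteq> 0 \<or> g' z \<noteq> 0"
    and ex: "\<exists>z\<in>punctured. f z \<noteq> 0 \<or> g z \<noteq> 0" and z: "z \<in> punctured"
  shows "c z \<noteq> 0"
proof
  assume c0: "c z = 0"
  have dense: "\<exists>z\<in>W. c z \<noteq> 0" if W: "open W" "W \<noteq> {}" "W \<subseteq> punctured" for W
  proof (rule ccontr)
    assume "\<not> (\<exists>z\<in>W. c z \<noteq> 0)"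
    then have "c w = 0" if "w \<in> punctured" for w
      using holo2_identity[OF open_punctured connected_punctured c W _ that] by blast
    then show False using ex eq by auto
  qed
  have "\<forall>p\<in>punctured. \<exists>V e. open V \<and> p \<in> V \<and> V \<subseteq> punctured \<and> holo2_on V e \<and>
      (\<forall>z\<in>V. f' z = e z * f z \<and> g' z = e z * g z)"
    by (rule tf[unfolded torsion_free_quotient_def, rule_format, of punctured c f' g' "\<lambda>_. 1", THEN ballI])
      (use open_punctured c f' g' dense eq in auto)
  then obtain e :: "complex \<times> complex \<Rightarrow> complex" where "f' z = e z * f z \<and> g' z = e z * g z"
    using z by blast
  then show False using nz'[OF z] eq[OF z] c0 by simp
qed

context hopf_surface
begin

text \<open>Pointwise proportionality suffices: (f', g') has no zeros, so the quotients f / f' and g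
  / g' glue to a holomorphic c, and torsion-freeness of the given quotient makes c a unit.\<close>

lemma same_sub_line_bundleI:
  assumes M: "sub_line_bundle b r \<tau> (\<sigma>, f, g)"
    and N: "\<sigma>' \<noteq> 0" "f' \<in> H0 b r (inverse \<sigma>')" "g' \<in> H0 b r (inverse \<sigma>' * \<tau>)"
    and nz: "\<And>z. z \<in> punctured \<Longrightarrow> f' z \<noteq> 0 \<or> g' z \<noteq> 0"
    and cross: "\<And>z. z \<in> punctured \<Longrightarrow> f z * g' z = g z * f' z" and \<tau>: "\<tau> \<noteq> 0"
  shows "same_sub_line_bundle b r (\<sigma>, f, g) (\<sigma>', f', g')"
proof -
  have \<sigma>: "\<sigma> \<noteq> 0" and f: "f \<in> H0 b r (inverse \<sigma>)" and g: "g \<in> H0 b r (inverse \<sigma> * \<tau>)"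
    and ex: "\<exists>z\<in>punctured. f z \<noteq> 0 \<or> g z \<noteq> 0" and tf: "torsion_free_quotient f g"
    using M by (simp_all add: sub_line_bundle_def)
  define c where "c = (\<lambda>z. if f' z \<noteq> 0 then f z / f' z else g z / g' z)"
  have eq: "f z = c z * f' z \<and> g z = c z * g' z" if "z \<in> punctured" for z
  proof (cases "f' z = 0")
    case True
    then show ?thesis using nz[OF that] cross[OF that] by (simp add: c_def)
  next
    case False
    then show ?thesis using cross[OF that] by (simp add: c_def nonzero_eq_divide_eq)
  qed
  have holc: "holo2_on punctured c"
  proof (rule holo2_on_local)
    fix z assume z: "z \<in> punctured"
    show "\<exists>V. z \<in> V \<and> holo2_on V c"
    proof (cases "f' z = 0")
      case False
      let ?V = "{z \<in> punctured. f' z \<noteq> 0}"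
      have V: "?V \<subseteq> punctured" by blast
      have "holo2_on ?V (\<lambda>z. f z / f' z)"
        by (rule holo2_on_divide[OF holo2_on_subset[OF H0_holo[OF f] V] holo2_on_subset[OF H0_holo[OF N(2)] V]]) simp
      then have "holo2_on ?V c"
        by (rule holo2_on_cong[OF open_nonzero_holo2[OF open_punctured H0_holo[OF N(2)]], rotated])
          (simp add: c_def)
      then show ?thesis using False z by (intro exI[of _ ?V]) simp
    next
      case True
      let ?V = "{z \<in> punctured. g' z \<noteq> 0}"
      have V: "?V \<subseteq> punctured" by blast
      have h: "holo2_on ?V (\<lambda>z. g z / g' z)"
        by (rule holo2_on_divide[OF holo2_on_subset[OF H0_holo[OF g] V] holo2_on_subset[OF H0_holo[OF N(3)] V]]) simp
      have "g w / g' w = c w" if "w \<in> ?V" for w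
        using that eq[of w] by (simp add: nonzero_divide_eq_eq)
      then have "holo2_on ?V c"
        by (rule holo2_on_cong[OF open_nonzero_holo2[OF open_punctured H0_holo[OF N(3)]] _ h])
      moreover have "g' z \<noteq> 0" using nz[OF z] True by simp
      ultimately show ?thesis using z by (intro exI[of _ ?V]) simp
    qed
  qed
  have c_nz: "c z \<noteq> 0" if "z \<in> punctured" for z
    by (rule torsion_free_quotient_factor_nz[OF tf holc H0_holo[OF N(2)] H0_holo[OF N(3)] eq nz ex that])
  have "c (hopf_map b r z) = \<sigma>' / \<sigma> * c z" if z: "z \<in> punctured" for z
  proof -
    have "c (hopf_map b r z) * (inverse \<sigma>' * f' z) = c (hopf_map b r z) * f' (hopf_map b r z)"
      using N(2) z by (simp add: H0_def)
    also have "\<dots> = f (hopf_map b r z)" using eq[OF hopf_map_punctured[OF z]] by simp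
    also have "\<dots> = inverse \<sigma> * f z" using f z by (simp add: H0_def)
    also have "f z = c z * f' z" using eq[OF z] by simp
    finally have 1: "c (hopf_map b r z) * (inverse \<sigma>' * f' z) = inverse \<sigma> * (c z * f' z)" .
    have "c (hopf_map b r z) * (inverse \<sigma>' * \<tau> * g' z) = c (hopf_map b r z) * g' (hopf_map b r z)"
      using N(3) z by (simp add: H0_def)
    also have "\<dots> = g (hopf_map b r z)" using eq[OF hopf_map_punctured[OF z]] by simp
    also have "\<dots> = inverse \<sigma> * \<tau> * g z" using g z by (simp add: H0_def)
    also have "g z = c z * g' z" using eq[OF z] by simp
    finally have 2: "c (hopf_map b r z) * (inverse \<sigma>' * \<tau> * g' z) = inverse \<sigma> * \<tau> * (c z * g' z)" .
    show ?thesis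
    proof (cases "f' z = 0")
      case False
      then have "c (hopf_map b r z) * inverse \<sigma>' = inverse \<sigma> * c z" using 1 by simp
      then show ?thesis using N(1) \<sigma> by (simp add: field_simps)
    next
      case True
      then have "c (hopf_map b r z) * inverse \<sigma>' = inverse \<sigma> * c z" using 2 nz[OF z] \<tau> by simp
      then show ?thesis using N(1) \<sigma> by (simp add: field_simps)
    qed
  qed
  then have "c \<in> H0 b r (\<sigma>' / \<sigma>)" using holc by (simp add: H0_def)
  then show ?thesis unfolding same_sub_line_bundle_def prod.case using c_nz eq by blast
qed

lemma sub_line_bundle_of_same:
  assumes same: "same_sub_line_bundle b r (\<sigma>, f, g) (\<sigma>', f', g')"
    and N: "\<sigma>' \<noteq> 0" "f' \<in> H0 b r (inverse \<sigma>')" "g' \<in> H0 b r (inverse \<sigma>' * \<tau>)"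
    and nz: "\<And>z. z \<in> punctured \<Longrightarrow> f' z \<noteq> 0 \<or> g' z \<noteq> 0"
    and inv: "invariant_under b r \<mu> \<phi> (\<sigma>', f', g')"
  shows "sub_line_bundle b r \<tau> (\<sigma>, f, g) \<and> invariant_under b r \<mu> \<phi> (\<sigma>, f, g)"
proof -
  obtain c where c: "c \<in> H0 b r (\<sigma>' / \<sigma>)"
    and eq: "\<And>z. z \<in> punctured \<Longrightarrow> c z \<noteq> 0 \<and> f z = c z * f' z \<and> g z = c z * g' z"
    using same unfolding same_sub_line_bundle_def by auto
  have z1: "(1, 0) \<in> punctured" by simp
  \<comment> \<open>Division by zero yields 0, so for \<sigma> = 0 the equivariance of c would make
    it vanish at the image of (1, 0).\<close>
  have \<sigma>: "\<sigma> \<noteq> 0"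
  proof
    assume "\<sigma> = 0"
    then have "c (hopf_map b r (1, 0)) = 0" using c z1 by (simp add: H0_def del: hopf_map_Pair)
    then show False using eq[OF hopf_map_punctured[OF z1]] by simp
  qed
  have "(\<lambda>z. c z * f' z) \<in> H0 b r (inverse \<sigma>)"
    using H0_mult[OF c N(2)] N(1) by (simp add: field_simps)
  then have f: "f \<in> H0 b r (inverse \<sigma>)" by (rule H0_cong) (use eq in simp)
  have "(\<lambda>z. c z * g' z) \<in> H0 b r (inverse \<sigma> * \<tau>)"
    using H0_mult[OF c N(3)] N(1) by (simp add: field_simps)
  then have g: "g \<in> H0 b r (inverse \<sigma> * \<tau>)" by (rule H0_cong) (use eq in simp)
  have nz': "f z \<noteq> 0 \<or> g z \<noteq> 0" if "z \<in> punctured" for z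
    using eq[OF that] nz[OF that] by auto
  have "sub_line_bundle b r \<tau> (\<sigma>, f, g)"
    using \<sigma> f g nz' z1 torsion_free_quotientI[OF H0_holo[OF f] H0_holo[OF g] nz']
    by (auto simp: sub_line_bundle_def)
  moreover obtain m where m: "m \<in> H0 b r \<mu>"
    and ev: "\<And>z. z \<in> punctured \<Longrightarrow> \<phi> z *v vector [f' z, g' z] = m z *s vector [f' z, g' z]"
    using inv by (auto simp: invariant_under_def)
  have "\<phi> z *v vector [f z, g z] = m z *s vector [f z, g z]" if "z \<in> punctured" for z
  proof -
    have v: "vector [f z, g z] = c z *s (vector [f' z, g' z] :: complex^2)"
      using eq[OF that] by (simp add: vec_eq_iff forall_2)
    show ?thesis
      unfolding v vec.scale ev[OF that] by (simp add: vec_eq_iff)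
  qed
  then have "invariant_under b r \<mu> \<phi> (\<sigma>, f, g)" using m by (auto simp: invariant_under_def)
  ultimately show ?thesis by blast
qed

text \<open>The listed inclusions have no zeros, so for completeness of the list it is enough that
  each invariant (f, g) is pointwise proportional to one of them; the isomorphism of bundles
  follows.\<close>

lemma invariant_sub_line_bundles_areI:
  assumes \<tau>: "\<tau> \<noteq> 0"
    and S: "\<And>\<sigma>' f' g'. (\<sigma>', f', g') \<in> S \<Longrightarrow> \<sigma>' \<noteq> 0 \<and> f' \<in> H0 b r (inverse \<sigma>') \<and> g' \<in> H0 b r (inverse \<sigma>' * \<tau>) \<and>
        (\<forall>z\<in>punctured. f' z \<noteq> 0 \<or> g' z \<noteq> 0) \<and> invariant_under b r \<mu> \<phi> (\<sigma>', f', g')"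
    and M: "\<And>\<sigma> f g. sub_line_bundle b r \<tau> (\<sigma>, f, g) \<Longrightarrow> invariant_under b r \<mu> \<phi> (\<sigma>, f, g) \<Longrightarrow>
        \<exists>\<sigma>' f' g'. (\<sigma>', f', g') \<in> S \<and> (\<forall>z\<in>punctured. f z * g' z = g z * f' z)"
  shows "invariant_sub_line_bundles_are b r \<mu> \<tau> \<phi> S"
  unfolding invariant_sub_line_bundles_are_def
proof (intro allI iffI)
  fix M assume *: "sub_line_bundle b r \<tau> M \<and> invariant_under b r \<mu> \<phi> M"
  obtain \<sigma> f g where M_eq: "M = (\<sigma>, f, g)" by (cases M)
  obtain \<sigma>' f' g' where N: "(\<sigma>', f', g') \<in> S" and cross: "\<forall>z\<in>punctured. f z * g' z = g z * f' z"
    using M[of \<sigma> f g] * M_eq by blast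
  have "same_sub_line_bundle b r (\<sigma>, f, g) (\<sigma>', f', g')"
    by (rule same_sub_line_bundleI[of \<tau>]) (use * M_eq S[OF N] cross \<tau> in blast)+
  then show "\<exists>N\<in>S. same_sub_line_bundle b r M N" using N M_eq by blast
next
  fix M assume "\<exists>N\<in>S. same_sub_line_bundle b r M N"
  then obtain \<sigma>' f' g' where N: "(\<sigma>', f', g') \<in> S" "same_sub_line_bundle b r M (\<sigma>', f', g')" by (metis prod_cases3)
  obtain \<sigma> f g where M_eq: "M = (\<sigma>, f, g)" by (cases M)
  show "sub_line_bundle b r \<tau> M \<and> invariant_under b r \<mu> \<phi> M"
    unfolding M_eq by (rule sub_line_bundle_of_same[of _ _ _ \<sigma>' f' g']) (use N M_eq S[OF N(1)] in blast)+
qed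

lemma invariant_under_mat2_iff:
  assumes "\<forall>z\<in>punctured. \<phi> z = mat2 (p z) (q z) (w z) (- p z)"
  shows "invariant_under b r \<mu> \<phi> (\<sigma>, f, g) \<longleftrightarrow> (\<exists>m\<in>H0 b r \<mu>. \<forall>z\<in>punctured.
    p z * f z + q z * g z = m z * f z \<and> w z * f z - p z * g z = m z * g z)"
  using assms by (simp add: invariant_under_def mat2_mult_vector_eq_iff)

text \<open>Cayley-Hamilton: the square of a trace-free matrix is the scalar p^2 + q w. So the
  difference A annihilates f and g, one of which is not identically zero and can be
  cancelled.\<close>

lemma eigenvalue_squared:
  assumes p: "holo2_on punctured p" and q: "holo2_on punctured q" and w: "holo2_on punctured w"
    and M: "sub_line_bundle b r \<tau> (\<sigma>, f, g)" and m: "holo2_on punctured m"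
    and ev: "\<And>z. z \<in> punctured \<Longrightarrow> p z * f z + q z * g z = m z * f z \<and> w z * f z - p z * g z = m z * g z"
    and z: "z \<in> punctured"
  shows "(m z)\<^sup>2 = (p z)\<^sup>2 + q z * w z"
proof -
  define A where "A = (\<lambda>z. (m z)\<^sup>2 - ((p z)\<^sup>2 + q z * w z))"
  have A: "holo2_on punctured A"
    unfolding A_def by (intro holo2_on_diff holo2_on_add holo2_on_power holo2_on_mult p q w m)
  have f: "holo2_on punctured f" and g: "holo2_on punctured g" and ex: "\<exists>z\<in>punctured. f z \<noteq> 0 \<or> g z \<noteq> 0"
    using M by (auto simp: sub_line_bundle_def intro: H0_holo)
  have Af: "A z * f z = 0" and Ag: "A z * g z = 0" if "z \<in> punctured" for z
  proof -
    have e1: "m z * f z = p z * f z + q z * g z" and e2: "m z * g z = w z * f z - p z * g z"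
      using ev[OF that] by simp_all
    have "(m z)\<^sup>2 * f z = m z * (m z * f z)" by (simp add: power2_eq_square)
    also have "\<dots> = m z * (p z * f z + q z * g z)" by (simp only: e1)
    also have "\<dots> = p z * (m z * f z) + q z * (m z * g z)" by (simp add: algebra_simps)
    also have "\<dots> = p z * (p z * f z + q z * g z) + q z * (w z * f z - p z * g z)" by (simp only: e1 e2)
    finally show "A z * f z = 0" by (simp add: A_def algebra_simps power2_eq_square)
    have "(m z)\<^sup>2 * g z = m z * (m z * g z)" by (simp add: power2_eq_square)
    also have "\<dots> = m z * (w z * f z - p z * g z)" by (simp only: e2)
    also have "\<dots> = w z * (m z * f z) - p z * (m z * g z)" by (simp add: algebra_simps)
    also have "\<dots> = w z * (p z * f z + q z * g z) - p z * (w z * f z - p z * g z)" by (simp only: e1 e2)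
    finally show "A z * g z = 0" by (simp add: A_def algebra_simps power2_eq_square)
  qed
  have "A z = 0"
    using ex holo2_punctured_cancel[OF A f Af _ _ z] holo2_punctured_cancel[OF A g Ag _ _ z] by blast
  then show ?thesis by (simp add: A_def)
qed

text \<open>The product (m - d) (m + d) vanishes identically, hence one factor does: the sign is the
  same at all points.\<close>

lemma H0_degree_r_square_eq:
  assumes "m \<in> H0 b r (b ^ r)" "d \<in> H0 b r (b ^ r)" and eq: "\<And>z. z \<in> punctured \<Longrightarrow> (m z)\<^sup>2 = (d z)\<^sup>2"
  shows "(\<forall>z\<in>punctured. m z = d z) \<or> (\<forall>z\<in>punctured. m z = - d z)"
proof (cases "\<exists>z\<in>punctured. m z + d z \<noteq> 0")
  case True
  then obtain z0 where z0: "z0 \<in> punctured" "m z0 + d z0 \<noteq> 0" by blast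
  have "m z - d z = 0" if "z \<in> punctured" for z
  proof (rule holo2_punctured_cancel[where f = "\<lambda>z. m z + d z", OF _ _ _ z0 that])
    show "holo2_on punctured (\<lambda>z. m z - d z)" "holo2_on punctured (\<lambda>z. m z + d z)"
      by (intro holo2_on_diff holo2_on_add H0_holo[OF assms(1)] H0_holo[OF assms(2)])+
    show "(m z - d z) * (m z + d z) = 0" if "z \<in> punctured" for z
      using eq[OF that] by (simp add: algebra_simps power2_eq_square)
  qed
  then show ?thesis by simp
next
  case False
  then show ?thesis by (simp add: eq_neg_iff_add_eq_0)
qed

lemma invariant_eigenvalue_cases:
  assumes \<phi>: "\<forall>z\<in>punctured. \<phi> z = mat2 (p z) (q z) (w z) (- p z)"
    and p: "holo2_on punctured p" and q: "holo2_on punctured q" and w: "holo2_on punctured w"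
    and d: "d \<in> H0 b r (b ^ r)" and det: "\<forall>z\<in>punctured. (p z)\<^sup>2 + q z * w z = (d z)\<^sup>2"
    and M: "sub_line_bundle b r \<tau> (\<sigma>, f, g)" and inv: "invariant_under b r (b ^ r) \<phi> (\<sigma>, f, g)"
  obtains (plus) "\<And>z. z \<in> punctured \<Longrightarrow> p z * f z + q z * g z = d z * f z \<and> w z * f z - p z * g z = d z * g z"
    | (minus) "\<And>z. z \<in> punctured \<Longrightarrow> p z * f z + q z * g z = - d z * f z \<and> w z * f z - p z * g z = - d z * g z"
proof -
  from inv obtain m where m: "m \<in> H0 b r (b ^ r)" and
    ev: "\<And>z. z \<in> punctured \<Longrightarrow> p z * f z + q z * g z = m z * f z \<and> w z * f z - p z * g z = m z * g z"
    unfolding invariant_under_mat2_iff[OF \<phi>] by blast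
  have "(m z)\<^sup>2 = (d z)\<^sup>2" if "z \<in> punctured" for z
    using eigenvalue_squared[OF p q w M H0_holo[OF m] ev that] bspec[OF det that] by simp
  from H0_degree_r_square_eq[OF m d this] show thesis
  proof
    assume c: "\<forall>z\<in>punctured. m z = d z"
    show thesis
    proof (rule plus)
      fix z assume z: "z \<in> punctured"
      show "p z * f z + q z * g z = d z * f z \<and> w z * f z - p z * g z = d z * g z"
        using ev[OF z] unfolding bspec[OF c z] .
    qed
  next
    assume c: "\<forall>z\<in>punctured. m z = - d z"
    show thesis
    proof (rule minus)
      fix z assume z: "z \<in> punctured"
      show "p z * f z + q z * g z = - d z * f z \<and> w z * f z - p z * g z = - d z * g z"
        using ev[OF z] unfolding bspec[OF c z] .
    qed
  qed
qed

lemma inverse_powi_minus_b: "inverse (b powi (- int n)) = b ^ n"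
  by (simp add: power_int_minus)

lemma NF2_invariant_sub_line_bundles:
  assumes t: "t \<in> H0 b r (b ^ r)" and \<beta>: "\<And>z. z \<in> punctured \<Longrightarrow> \<beta> z = (t z)\<^sup>2" and hol: "\<beta> \<in> H0 b r \<sigma>0"
  shows "invariant_sub_line_bundles_are b r (b ^ r) (nf_bundle b r (NF2 \<beta>)) (nf_field r (NF2 \<beta>))
             {(b powi (- int r), t, \<lambda>_. 1), (b powi (- int r), \<lambda>z. - t z, \<lambda>_. 1)}"
proof (rule invariant_sub_line_bundles_areI[OF nf_bundle_nz])
  have \<phi>: "\<forall>z\<in>punctured. nf_field r (NF2 \<beta>) z = mat2 0 (\<beta> z) 1 (- 0)" by simp
  note inv = invariant_under_mat2_iff[of "nf_field r (NF2 \<beta>)" "\<lambda>_. 0" \<beta> "\<lambda>_. 1", OF \<phi>]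
  fix \<sigma>' and f' g' :: "complex \<times> complex \<Rightarrow> complex"
  assume "(\<sigma>', f', g') \<in> {(b powi (- int r), t, \<lambda>_. 1), (b powi (- int r), \<lambda>z. - t z, \<lambda>_. 1)}"
  then have N: "\<sigma>' = b powi (- int r)" "g' = (\<lambda>_. 1)" and f': "f' = t \<or> f' = (\<lambda>z. - t z)" by auto
  have "f' \<in> H0 b r (b ^ r)" using f' t H0_uminus[OF t] by auto
  moreover have "invariant_under b r (b ^ r) (nf_field r (NF2 \<beta>)) (\<sigma>', f', g')"
    unfolding inv using \<open>f' \<in> H0 b r (b ^ r)\<close> f'
    by (intro bexI[of _ f']) (auto simp: N \<beta> power2_eq_square)
  ultimately show "\<sigma>' \<noteq> 0 \<and> f' \<in> H0 b r (inverse \<sigma>') \<and> g' \<in> H0 b r (inverse \<sigma>' * nf_bundle b r (NF2 \<beta>)) \<and>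
        (\<forall>z\<in>punctured. f' z \<noteq> 0 \<or> g' z \<noteq> 0) \<and> invariant_under b r (b ^ r) (nf_field r (NF2 \<beta>)) (\<sigma>', f', g')"
    by (simp add: N power_int_minus)
next
  fix \<sigma> f g
  assume M: "sub_line_bundle b r (nf_bundle b r (NF2 \<beta>)) (\<sigma>, f, g)"
    and inv: "invariant_under b r (b ^ r) (nf_field r (NF2 \<beta>)) (\<sigma>, f, g)"
  have \<phi>: "\<forall>z\<in>punctured. nf_field r (NF2 \<beta>) z = mat2 0 (\<beta> z) 1 (- 0)" by simp
  let ?S = "{(b powi (- int r), t, \<lambda>_. 1), (b powi (- int r), \<lambda>z. - t z, \<lambda>_. 1)}"
  show "\<exists>\<sigma>' f' g'. (\<sigma>', f', g') \<in> ?S \<and> (\<forall>z\<in>punctured. f z * g' z = g z * f' z)"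
  proof (rule invariant_eigenvalue_cases[of _ "\<lambda>_. 0" \<beta> "\<lambda>_. 1", OF \<phi> _ H0_holo[OF hol] _ t _ M inv])
    assume "\<And>z. z \<in> punctured \<Longrightarrow> 0 * f z + \<beta> z * g z = t z * f z \<and> 1 * f z - 0 * g z = t z * g z"
    then show ?thesis by (intro exI[of _ "b powi (- int r)"] exI[of _ t] exI[of _ "\<lambda>_. 1"]) simp
  next
    assume "\<And>z. z \<in> punctured \<Longrightarrow> 0 * f z + \<beta> z * g z = - t z * f z \<and> 1 * f z - 0 * g z = - t z * g z"
    then show ?thesis by (intro exI[of _ "b powi (- int r)"] exI[of _ "\<lambda>z. - t z"] exI[of _ "\<lambda>_. 1"]) simp
  qed (simp_all add: \<beta>)
qed

text \<open>(1, 0) is an eigenvector for \<alpha> and (Q, -2 \<alpha>) for - \<alpha>. As the field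
  has no zeros, Q and \<alpha> have no common zero, so the second inclusion is already
  saturated.\<close>

lemma triangular_invariant_sub_line_bundles:
  assumes \<alpha>: "\<alpha> \<in> H0 b r (b ^ r)" and Q: "Q \<in> H0 b r (b ^ (r + k))"
    and \<phi>: "\<And>z. z \<in> punctured \<Longrightarrow> \<phi> z = mat2 (\<alpha> z) (Q z) 0 (- \<alpha> z)" and nv: "nowhere_vanishing \<phi>"
    and \<alpha>0: "\<exists>z\<in>punctured. \<alpha> z \<noteq> 0"
  shows "invariant_sub_line_bundles_are b r (b ^ r) (b powi (- int k)) \<phi>
          {(1, \<lambda>_. 1, \<lambda>_. 0), (b powi (- int (r + k)), Q, \<lambda>z. - 2 * \<alpha> z)}"
    (is "invariant_sub_line_bundles_are _ _ _ _ _ ?S")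
proof (rule invariant_sub_line_bundles_areI)
  have \<phi>': "\<forall>z\<in>punctured. \<phi> z = mat2 (\<alpha> z) (Q z) 0 (- \<alpha> z)" using \<phi> by blast
  note inv_iff = invariant_under_mat2_iff[of \<phi> \<alpha> Q "\<lambda>_. 0", OF \<phi>']
  have nz: "\<alpha> z \<noteq> 0 \<or> Q z \<noteq> 0" if "z \<in> punctured" for z
    using nowhere_vanishingD[OF nv that] \<phi>[OF that] by auto
  fix \<sigma>' and f' g' :: "complex \<times> complex \<Rightarrow> complex" assume "(\<sigma>', f', g') \<in> ?S"
  then consider "\<sigma>' = 1" "f' = (\<lambda>_. 1)" "g' = (\<lambda>_. 0)"
    | "\<sigma>' = b powi (- int (r + k))" "f' = Q" "g' = (\<lambda>z. - 2 * \<alpha> z)" by auto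
  then show "\<sigma>' \<noteq> 0 \<and> f' \<in> H0 b r (inverse \<sigma>') \<and> g' \<in> H0 b r (inverse \<sigma>' * b powi (- int k)) \<and>
        (\<forall>z\<in>punctured. f' z \<noteq> 0 \<or> g' z \<noteq> 0) \<and> invariant_under b r (b ^ r) \<phi> (\<sigma>', f', g')"
  proof cases
    case 1
    moreover have "invariant_under b r (b ^ r) \<phi> (\<sigma>', f', g')"
      unfolding inv_iff by (rule bexI[OF _ \<alpha>]) (simp add: 1)
    ultimately show ?thesis by simp
  next
    case 2
    have \<sigma>': "inverse \<sigma>' = b ^ (r + k)" "inverse \<sigma>' * b powi (- int k) = b ^ r"
      unfolding 2 inverse_powi_minus_b by (simp_all add: power_int_minus power_add)
    have "invariant_under b r (b ^ r) \<phi> (\<sigma>', f', g')"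
      unfolding inv_iff by (rule bexI[OF _ H0_uminus[OF \<alpha>]]) (simp add: 2 algebra_simps)
    moreover have "\<sigma>' \<noteq> 0" by (simp add: 2)
    moreover have "\<forall>z\<in>punctured. f' z \<noteq> 0 \<or> g' z \<noteq> 0" using nz by (auto simp: 2)
    ultimately show ?thesis unfolding \<sigma>'(2) unfolding \<sigma>'(1) using Q H0_cmult[OF \<alpha>, of "- 2"] by (simp add: 2)
  qed
next
  fix \<sigma> f g
  assume M: "sub_line_bundle b r (b powi (- int k)) (\<sigma>, f, g)" and inv: "invariant_under b r (b ^ r) \<phi> (\<sigma>, f, g)"
  have \<phi>': "\<forall>z\<in>punctured. \<phi> z = mat2 (\<alpha> z) (Q z) 0 (- \<alpha> z)" using \<phi> by blast
  obtain z0 where z0: "z0 \<in> punctured" "\<alpha> z0 \<noteq> 0" using \<alpha>0 by blast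
  show "\<exists>\<sigma>' f' g'. (\<sigma>', f', g') \<in> ?S \<and> (\<forall>z\<in>punctured. f z * g' z = g z * f' z)"
  proof (rule invariant_eigenvalue_cases[of _ \<alpha> Q "\<lambda>_. 0", OF \<phi>' H0_holo[OF \<alpha>] H0_holo[OF Q] _ \<alpha> _ M inv])
    assume ev: "\<And>z. z \<in> punctured \<Longrightarrow> \<alpha> z * f z + Q z * g z = \<alpha> z * f z \<and> 0 * f z - \<alpha> z * g z = \<alpha> z * g z"
    have holg: "holo2_on punctured g" using M by (auto simp: sub_line_bundle_def intro: H0_holo)
    have "g z * \<alpha> z = 0" if "z \<in> punctured" for z using conjunct2[OF ev[OF that]] by auto
    then have "g z = 0" if "z \<in> punctured" for z
      using holo2_punctured_cancel[OF holg H0_holo[OF \<alpha>] _ z0 that] by blast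
    then show ?thesis by (intro exI[of _ 1] exI[of _ "\<lambda>_. 1"] exI[of _ "\<lambda>_. 0"]) simp
  next
    assume ev: "\<And>z. z \<in> punctured \<Longrightarrow> \<alpha> z * f z + Q z * g z = - \<alpha> z * f z \<and> 0 * f z - \<alpha> z * g z = - \<alpha> z * g z"
    have "f z * (- 2 * \<alpha> z) = g z * Q z" if "z \<in> punctured" for z
      using conjunct1[OF ev[OF that]] by (simp add: algebra_simps) (metis add.commute minus_unique)
    then show ?thesis
      by (intro exI[of _ "b powi (- int (r + k))"] exI[of _ Q] exI[of _ "\<lambda>z. - 2 * \<alpha> z"]) simp
  qed simp_all
qed (simp add: power_int_eq_0_iff)

lemma NF3_invariant_sub_line_bundles:
  assumes adm: "nf_admissible b r (NF3 k u v)"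
  shows "invariant_sub_line_bundles_are b r (b ^ r) (nf_bundle b r (NF3 k u v)) (nf_field r (NF3 k u v))
          {(1, \<lambda>_. 1, \<lambda>_. 0),
           (b powi (- int (r * (1 + k))),
            \<lambda>(x, y). (cnj v * x - cnj u * y ^ r) ^ (1 + k),
            \<lambda>(x, y). - 2 * u * x - 2 * v * y ^ r)}"
proof -
  define Q where "Q = (\<lambda>(x, y). (cnj v * x - cnj u * y ^ r) ^ (1 + k))"
  define \<alpha> where "\<alpha> = (\<lambda>(x, y). u * x + v * y ^ r)"
  have Q: "Q \<in> H0 b r (b ^ (r + k * r))"
    using H0_power[OF H0_linear[of "cnj v" "- cnj u"], of "1 + k"]
    by (simp add: Q_def case_prod_beta' power_add power_mult[symmetric] mult.commute)
  have \<alpha>: "\<alpha> \<in> H0 b r (b ^ r)" unfolding \<alpha>_def by (rule H0_linear)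
  have "\<alpha> (1, 0) \<noteq> 0 \<or> \<alpha> (0, 1) \<noteq> 0" using adm by (auto simp: \<alpha>_def power_0_left)
  then have "\<exists>z\<in>punctured. \<alpha> z \<noteq> 0" by (auto intro: bexI[of _ "(1, 0)"] bexI[of _ "(0, 1)"])
  then have "invariant_sub_line_bundles_are b r (b ^ r) (b powi (- int (k * r))) (nf_field r (NF3 k u v))
      {(1, \<lambda>_. 1, \<lambda>_. 0), (b powi (- int (r + k * r)), Q, \<lambda>z. - 2 * \<alpha> z)}"
    by (rule triangular_invariant_sub_line_bundles[OF \<alpha> Q _ nf_field_nowhere_vanishing[OF adm], rotated])
      (auto simp: Q_def \<alpha>_def)
  moreover have "(\<lambda>z. - 2 * \<alpha> z) = (\<lambda>(x, y). - 2 * u * x - 2 * v * y ^ r)"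
    by (auto simp: \<alpha>_def algebra_simps)
  moreover have "r + k * r = r * (1 + k)" by simp
  ultimately show ?thesis by (simp only: Q_def nf_bundle.simps)
qed

lemma NF5_invariant_sub_line_bundles:
  assumes adm: "nf_admissible b r (NF5 k \<alpha>)"
  shows "invariant_sub_line_bundles_are b r (b ^ r) (nf_bundle b r (NF5 k \<alpha>)) (nf_field r (NF5 k \<alpha>))
          {(1, \<lambda>_. 1, \<lambda>_. 0),
           (b powi (- int (r + k)), \<lambda>(x, y). y ^ (r + k), \<lambda>z. - 2 * \<alpha> z)}"
proof -
  have Q: "(\<lambda>(x, y). y ^ (r + k)) \<in> H0 b r (b ^ (r + k))"
    using H0_monomial[of "r + k" 0 "r + k" 1] by simp
  have "\<exists>z\<in>punctured. \<alpha> z \<noteq> 0" using adm by (auto intro: bexI[of _ "(1, 0)"])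
  then show ?thesis
    unfolding nf_bundle.simps
    by (intro triangular_invariant_sub_line_bundles[OF _ Q _ nf_field_nowhere_vanishing[OF adm]])
      (use adm in auto)
qed

text \<open>Minus the determinant is the square of d = s x + t y^r. For d the eigenvector (d + p, w)
  has no zeros. For - d the eigenvector (p - d, w) = (- t y^r, y^(r - k)) is divisible by y^(r - k),
  and removing this factor leaves (t y^k, -1) up to sign.\<close>

lemma NF4_invariant_sub_line_bundles:
  assumes adm: "nf_admissible b r (NF4 k s \<beta>)"
    and \<beta>: "\<forall>(x, y)\<in>punctured. \<beta> (x, y) = 2 * s * t * x * y ^ k + t\<^sup>2 * y ^ (r + k)"
  shows "invariant_sub_line_bundles_are b r (b ^ r) (nf_bundle b r (NF4 k s \<beta>)) (nf_field r (NF4 k s \<beta>))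
             {(b powi (- int k), \<lambda>(x, y). t * y ^ k, \<lambda>_. - 1),
              (b powi (- int r), \<lambda>(x, y). 2 * s * x + t * y ^ r, \<lambda>(x, y). y ^ (r - k))}"
    (is "invariant_sub_line_bundles_are _ _ _ _ _ ?S")
proof (rule invariant_sub_line_bundles_areI[OF nf_bundle_nz])
  have k: "0 < k" "k < r" and s: "s \<noteq> 0" and hol: "\<beta> \<in> H0 b r (b ^ (r + k))" using adm by simp_all
  define p where "p = (\<lambda>(x::complex, y::complex). s * x)"
  define w where "w = (\<lambda>(x::complex, y::complex). y ^ (r - k))"
  define d where "d = (\<lambda>(x, y). s * x + t * y ^ r)"
  have \<phi>: "\<forall>z\<in>punctured. nf_field r (NF4 k s \<beta>) z = mat2 (p z) (\<beta> z) (w z) (- p z)"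
    by (simp add: p_def w_def split: prod.split)
  have hp: "p \<in> H0 b r (b ^ r)" using H0_linear[of s 0] by (simp add: p_def)
  have hw: "w \<in> H0 b r (b ^ (r - k))" using H0_monomial[of "r - k" 0 "r - k" 1] by (simp add: w_def)
  have hd: "d \<in> H0 b r (b ^ r)" unfolding d_def by (rule H0_linear)
  have yr: "y ^ (r - k) * y ^ k = y ^ r" for y :: complex using k by (simp add: power_add[symmetric])
  have \<beta>': "\<beta> (x, y) = 2 * s * t * x * y ^ k + t\<^sup>2 * y ^ (r + k)" if "(x, y) \<in> punctured" for x y
    using \<beta> that by blast
  note inv_iff = invariant_under_mat2_iff[of "nf_field r (NF4 k s \<beta>)" p \<beta> w, OF \<phi>]
  {
    fix \<sigma>' and f' g' :: "complex \<times> complex \<Rightarrow> complex" assume "(\<sigma>', f', g') \<in> ?S"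
    then consider "\<sigma>' = b powi (- int k)" "f' = (\<lambda>(x, y). t * y ^ k)" "g' = (\<lambda>_. - 1)"
      | "\<sigma>' = b powi (- int r)" "f' = (\<lambda>(x, y). 2 * s * x + t * y ^ r)" "g' = w" by (auto simp: w_def)
    then show "\<sigma>' \<noteq> 0 \<and> f' \<in> H0 b r (inverse \<sigma>') \<and> g' \<in> H0 b r (inverse \<sigma>' * nf_bundle b r (NF4 k s \<beta>)) \<and>
        (\<forall>z\<in>punctured. f' z \<noteq> 0 \<or> g' z \<noteq> 0) \<and> invariant_under b r (b ^ r) (nf_field r (NF4 k s \<beta>)) (\<sigma>', f', g')"
    proof cases
      case 1
      have \<sigma>': "inverse \<sigma>' = b ^ k" "inverse \<sigma>' * nf_bundle b r (NF4 k s \<beta>) = 1"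
        unfolding 1 inverse_powi_minus_b by (simp_all add: power_int_minus)
      have f': "f' \<in> H0 b r (b ^ k)" using H0_monomial[of k 0 k t] by (simp add: 1)
      have "p z * f' z + \<beta> z * g' z = - d z * f' z \<and> w z * f' z - p z * g' z = - d z * g' z" if "z \<in> punctured" for z
        using that by (cases z) (simp add: 1 p_def w_def d_def \<beta>' yr[symmetric] algebra_simps power_add power2_eq_square)
      then have "invariant_under b r (b ^ r) (nf_field r (NF4 k s \<beta>)) (\<sigma>', f', g')"
        unfolding inv_iff by (intro bexI[OF _ H0_uminus[OF hd]]) blast
      moreover have "\<sigma>' \<noteq> 0" by (simp add: 1)
      ultimately show ?thesis unfolding \<sigma>'(2) unfolding \<sigma>'(1) using f' by (simp add: 1)
    next
      case 2
      have "b ^ r * inverse (b ^ k) = b ^ (r - k)" using k by (simp add: power_diff divide_inverse)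
      then have \<sigma>': "inverse \<sigma>' = b ^ r" "inverse \<sigma>' * nf_bundle b r (NF4 k s \<beta>) = b ^ (r - k)"
        unfolding 2 inverse_powi_minus_b by (simp_all add: power_int_minus)
      have f': "f' \<in> H0 b r (b ^ r)" unfolding 2 by (rule H0_linear)
      have "p z * f' z + \<beta> z * g' z = d z * f' z \<and> w z * f' z - p z * g' z = d z * g' z" if "z \<in> punctured" for z
        using that by (cases z) (simp add: 2 p_def w_def d_def \<beta>' yr[symmetric] algebra_simps power_add power2_eq_square)
      then have "invariant_under b r (b ^ r) (nf_field r (NF4 k s \<beta>)) (\<sigma>', f', g')"
        unfolding inv_iff by (intro bexI[OF _ hd]) blast
      moreover have "\<sigma>' \<noteq> 0" by (simp add: 2)
      moreover have "f' z \<noteq> 0 \<or> g' z \<noteq> 0" if "z \<in> punctured" for z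
        using that s k by (cases z) (auto simp: 2 w_def power_0_left)
      ultimately show ?thesis unfolding \<sigma>'(2) unfolding \<sigma>'(1) using f' hw by (simp add: 2)
    qed
  }
  fix \<sigma> f g
  assume M: "sub_line_bundle b r (nf_bundle b r (NF4 k s \<beta>)) (\<sigma>, f, g)"
    and inv: "invariant_under b r (b ^ r) (nf_field r (NF4 k s \<beta>)) (\<sigma>, f, g)"
  have "(p z)\<^sup>2 + \<beta> z * w z = (d z)\<^sup>2" if "z \<in> punctured" for z
    using that by (cases z) (simp add: p_def w_def d_def \<beta>' yr[symmetric] algebra_simps power_add power2_eq_square)
  then have det: "\<forall>z\<in>punctured. (p z)\<^sup>2 + \<beta> z * w z = (d z)\<^sup>2" by blast
  have f: "holo2_on punctured f" and g: "holo2_on punctured g"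
    using M by (auto simp: sub_line_bundle_def intro: H0_holo)
  show "\<exists>\<sigma>' f' g'. (\<sigma>', f', g') \<in> ?S \<and> (\<forall>z\<in>punctured. f z * g' z = g z * f' z)"
  proof (rule invariant_eigenvalue_cases[of _ p \<beta> w, OF \<phi> H0_holo[OF hp] H0_holo[OF hol] H0_holo[OF hw] hd det M inv])
    assume ev: "\<And>z. z \<in> punctured \<Longrightarrow> p z * f z + \<beta> z * g z = d z * f z \<and> w z * f z - p z * g z = d z * g z"
    have "f z * w z = g z * (\<lambda>(x, y). 2 * s * x + t * y ^ r) z" if "z \<in> punctured" for z
    proof -
      have "f z * w z = g z * (d z + p z)" using conjunct2[OF ev[OF that]] by (simp add: algebra_simps)
      also have "d z + p z = (\<lambda>(x, y). 2 * s * x + t * y ^ r) z" by (simp add: d_def p_def split: prod.split)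
      finally show ?thesis .
    qed
    then show ?thesis
      by (intro exI[of _ "b powi (- int r)"] exI[of _ "\<lambda>(x, y). 2 * s * x + t * y ^ r"] exI[of _ w]) (simp add: w_def)
  next
    assume ev: "\<And>z. z \<in> punctured \<Longrightarrow> p z * f z + \<beta> z * g z = - d z * f z \<and> w z * f z - p z * g z = - d z * g z"
    \<comment> \<open>The goal is f = - t y^k g. The eigenvalue equation gives it only after
      multiplication by w = y^(r - k), which is then cancelled.\<close>
    define A where "A = (\<lambda>z. f z + g z * (t * snd z ^ k))"
    have A: "holo2_on punctured A" unfolding A_def by (intro holo2_on_intros f g)
    have "A z * w z = 0" if "z \<in> punctured" for z
    proof (cases z)
      case (Pair x y)
      have "w z * f z = g z * (p z - d z)" using conjunct2[OF ev[OF that]] by (simp add: algebra_simps)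
      also have "p z - d z = - (t * y ^ k * w z)" by (simp add: Pair d_def p_def w_def yr[symmetric] mult.commute)
      finally show ?thesis by (simp add: A_def Pair algebra_simps)
    qed
    then have "A z = 0" if "z \<in> punctured" for z
      by (rule holo2_punctured_cancel[OF A H0_holo[OF hw], of "(0, 1)", OF _ _ _ that]) (simp_all add: w_def)
    then have "f z * (- 1) = g z * (\<lambda>(x, y). t * y ^ k) z" if "z \<in> punctured" for z
      using that by (cases z) (auto simp: A_def add_eq_0_iff)
    then show ?thesis
      by (intro exI[of _ "b powi (- int k)"] exI[of _ "\<lambda>(x, y). t * y ^ k"] exI[of _ "\<lambda>_. - 1"]) simp
  qed
qed

end


subsection \<open>Spectral curves\<close>

lemma holo3_on_holo2:
  assumes "holo2_on V f" "fst ` U \<subseteq> V"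
  shows "holo3_on U (\<lambda>z. f (fst z))"
  unfolding holo3_on_def
proof
  fix z assume "z \<in> U"
  then have "fst z \<in> V" using assms(2) by blast
  then obtain c1 c2 where f: "(f has_derivative (\<lambda>(h, k). c1 * h + c2 * k)) (at (fst z))"
    using assms(1) unfolding holo2_on_def by meson
  have "((\<lambda>z. f (fst z)) has_derivative (\<lambda>((h, k), l). c1 * h + c2 * k + 0 * l)) (at z)"
    by (rule has_derivative_eq_rhs[OF has_derivative_compose[OF has_derivative_fst[OF has_derivative_ident] f]])
      (auto simp: fun_eq_iff)
  then show "\<exists>c1 c2 c3. ((\<lambda>z. f (fst z)) has_derivative (\<lambda>((h, k), l). c1 * h + c2 * k + c3 * l)) (at z)"
    by blast
qed

lemma holo3_on_square_minus:
  assumes "holo3_on U f"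
  shows "holo3_on U (\<lambda>z. (snd z)\<^sup>2 - f z)"
  unfolding holo3_on_def
proof
  fix z assume "z \<in> U"
  then obtain c1 c2 c3 where f: "(f has_derivative (\<lambda>((h, k), l). c1 * h + c2 * k + c3 * l)) (at z)"
    using assms unfolding holo3_on_def by meson
  have "((\<lambda>z. snd z * snd z) has_derivative (\<lambda>h. snd z * snd h + snd h * snd z)) (at z)"
    by (intro has_derivative_mult has_derivative_snd has_derivative_ident)
  from has_derivative_diff[OF this f]
  have "((\<lambda>z. snd z * snd z - f z) has_derivative
      (\<lambda>((h, k), l). (- c1) * h + (- c2) * k + (2 * snd z - c3) * l)) (at z)"
    by (rule has_derivative_eq_rhs) (auto simp: fun_eq_iff algebra_simps)
  then show "\<exists>c1 c2 c3. ((\<lambda>z. (snd z)\<^sup>2 - f z) has_derivative (\<lambda>((h, k), l). c1 * h + c2 * k + c3 * l)) (at z)"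
    unfolding power2_eq_square by blast
qed

lemma holo3_on_compose:
  assumes f: "holo3_on U f" and X: "holo2_on V X" and Y: "holo2_on V Y" and E: "holo2_on V E"
    and in_U: "\<And>z. z \<in> V \<Longrightarrow> ((X z, Y z), E z) \<in> U"
  shows "holo2_on V (\<lambda>z. f ((X z, Y z), E z))"
  unfolding holo2_on_def
proof
  fix z assume z: "z \<in> V"
  obtain x1 x2 where x: "(X has_derivative (\<lambda>(h, k). x1 * h + x2 * k)) (at z)"
    using X z unfolding holo2_on_def by meson
  obtain y1 y2 where y: "(Y has_derivative (\<lambda>(h, k). y1 * h + y2 * k)) (at z)"
    using Y z unfolding holo2_on_def by meson
  obtain e1 e2 where e: "(E has_derivative (\<lambda>(h, k). e1 * h + e2 * k)) (at z)"
    using E z unfolding holo2_on_def by meson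
  obtain c1 c2 c3 where c: "(f has_derivative (\<lambda>((h, k), l). c1 * h + c2 * k + c3 * l)) (at ((X z, Y z), E z))"
    using f in_U[OF z] unfolding holo3_on_def by meson
  have "((\<lambda>z. f ((X z, Y z), E z)) has_derivative
      (\<lambda>(h, k). (c1 * x1 + c2 * y1 + c3 * e1) * h + (c1 * x2 + c2 * y2 + c3 * e2) * k)) (at z)"
    by (rule has_derivative_eq_rhs[OF has_derivative_compose[OF
          has_derivative_Pair[OF has_derivative_Pair[OF x y] e] c]])
      (auto simp: fun_eq_iff algebra_simps)
  then show "\<exists>c1 c2. ((\<lambda>z. f ((X z, Y z), E z)) has_derivative (\<lambda>(h, k). c1 * h + c2 * k)) (at z)"
    by blast
qed

section \<open>The total space of a line bundle as a quotient\<close>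

lemma total_space_rel_equiv: "equiv UNIV (total_space_rel b r \<mu>)"
  unfolding total_space_rel_def Let_def
  by (intro equivI refl_rtrancl sym_rtrancl sym_Un_converse trans_rtrancl) (auto intro: refl_rtrancl)

lemma total_space_rel_saturated:
  assumes "\<And>p v. p \<in> punctured \<Longrightarrow> (p, v) \<in> C \<longleftrightarrow> (hopf_map b r p, \<mu> * v) \<in> C"
    and "(x, y) \<in> total_space_rel b r \<mu>" "x \<in> C"
  shows "y \<in> C"
  using assms(2) unfolding total_space_rel_def Let_def
proof (induction rule: rtrancl_induct)
  case base
  then show ?case by (rule assms(3))
next
  case (step y z)
  then show ?case using assms(1) by auto
qed

lemma Union_quotient_saturated:
  assumes "equiv UNIV R" "\<And>x y. (x, y) \<in> R \<Longrightarrow> x \<in> C \<Longrightarrow> y \<in> C"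
  shows "\<Union> (C // R) = C"
proof
  show "\<Union> (C // R) \<subseteq> C" using assms(2) by (auto simp: quotient_def)
  show "C \<subseteq> \<Union> (C // R)"
  proof
    fix x assume "x \<in> C"
    then show "x \<in> \<Union> (C // R)"
      using equiv_class_self[OF assms(1), of x] quotientI[of x C R] by blast
  qed
qed

text \<open>Distinct classes are disjoint, so a set of classes is determined by its union. This
  carries inclusions on the cover back to the total space.\<close>

lemma quotient_subset_of_Union:
  assumes R: "equiv UNIV R" and Z: "Z \<subseteq> C // R" and C: "C \<subseteq> \<Union> Z"
  shows "Z = C // R"
proof
  show "C // R \<subseteq> Z"
  proof
    fix c assume "c \<in> C // R"
    then obtain x where x: "x \<in> C" "c = R `` {x}" by (rule quotientE)
    then obtain c' where c': "c' \<in> Z" "x \<in> c'" using C by blast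
    obtain x' where x': "c' = R `` {x'}" using Z c'(1) by (meson quotientE subsetD)
    then have "(x', x) \<in> R" using c'(2) by simp
    then have "c' = c" using equiv_class_eq[OF R] x x' by blast
    then show "c \<in> Z" using c' by simp
  qed
qed (rule Z)

section \<open>Analytic sets pulled back along a parametrisation\<close>

context
  fixes X Y E :: "complex \<times> complex \<Rightarrow> complex"
  assumes X: "holo2_on punctured X" and Y: "holo2_on punctured Y" and E: "holo2_on punctured E"
    and XY: "\<And>z. z \<in> punctured \<Longrightarrow> (X z, Y z) \<in> punctured"
begin

lemma analytic_subset3_pullback:
  assumes A: "analytic_subset3 (punctured \<times> UNIV) A" and z: "z \<in> punctured"
  shows "\<exists>V fs. open V \<and> z \<in> V \<and> V \<subseteq> punctured \<and> (\<forall>f\<in>fs. holo2_on V f) \<and>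
    {z. ((X z, Y z), E z) \<in> A} \<inter> V = {z \<in> V. \<forall>f\<in>fs. f z = 0}"
proof -
  define P where "P = (\<lambda>z. ((X z, Y z), E z))"
  have "P z \<in> punctured \<times> UNIV" using XY[OF z] by (simp add: P_def del: in_punctured)
  with A[unfolded analytic_subset3_def, THEN conjunct2] obtain U fs
    where U: "open U \<and> P z \<in> U \<and> U \<subseteq> punctured \<times> UNIV \<and> finite fs \<and> (\<forall>f\<in>fs. holo3_on U f) \<and>
        A \<inter> U = {z \<in> U. \<forall>f\<in>fs. f z = 0}" by (elim ballE exE) auto
  define V where "V = punctured \<inter> P -` U"
  have "continuous_on punctured P"
    unfolding P_def by (intro continuous_intros holo2_on_continuous X Y E)
  then have "open V" unfolding V_def using U by (intro continuous_open_preimage open_punctured) simp_all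
  moreover have "z \<in> V" using z U by (simp add: V_def)
  moreover have V: "V \<subseteq> punctured" by (auto simp: V_def)
  moreover have "\<forall>f\<in>(\<lambda>f z. f (P z)) ` fs. holo2_on V f"
  proof
    fix g assume "g \<in> (\<lambda>f z. f (P z)) ` fs"
    then obtain f where f: "f \<in> fs" "g = (\<lambda>z. f (P z))" by blast
    have "holo3_on U f" using U f(1) by blast
    then show "holo2_on V g"
      unfolding f(2) P_def
      by (rule holo3_on_compose[OF _ holo2_on_subset[OF X V] holo2_on_subset[OF Y V] holo2_on_subset[OF E V]])
        (simp add: V_def P_def)
  qed
  moreover have "{z. ((X z, Y z), E z) \<in> A} \<inter> V = {z \<in> V. \<forall>f\<in>(\<lambda>f z. f (P z)) ` fs. f z = 0}"
  proof -
    have "P z \<in> A \<longleftrightarrow> (\<forall>f\<in>fs. f (P z) = 0)" if "z \<in> V" for z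
      using U that unfolding V_def by blast
    then show ?thesis by (auto simp: P_def)
  qed
  ultimately show ?thesis by (intro exI[of _ V] exI[of _ "(\<lambda>f z. f (P z)) ` fs"]) blast
qed

text \<open>If the preimage of A2 misses a point, it misses a neighbourhood of it, which then lies
  in the preimage of A1; an analytic set with interior points fills a connected domain.\<close>

lemma analytic_cover_pullback:
  assumes A1: "analytic_subset3 (punctured \<times> UNIV) A1" and A2: "analytic_subset3 (punctured \<times> UNIV) A2"
    and cover: "\<And>z. z \<in> punctured \<Longrightarrow> ((X z, Y z), E z) \<in> A1 \<union> A2"
  shows "(\<forall>z\<in>punctured. ((X z, Y z), E z) \<in> A1) \<or> (\<forall>z\<in>punctured. ((X z, Y z), E z) \<in> A2)"
proof (rule disjCI)
  let ?S1 = "{z. ((X z, Y z), E z) \<in> A1}"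
  let ?S2 = "{z. ((X z, Y z), E z) \<in> A2}"
  assume "\<not> (\<forall>z\<in>punctured. ((X z, Y z), E z) \<in> A2)"
  then obtain z0 where z0: "z0 \<in> punctured" "z0 \<notin> ?S2" by blast
  from analytic_subset3_pullback[OF A2 z0(1)] obtain V fs
    where V: "open V \<and> z0 \<in> V \<and> V \<subseteq> punctured \<and> (\<forall>f\<in>fs. holo2_on V f) \<and>
      ?S2 \<inter> V = {z \<in> V. \<forall>f\<in>fs. f z = 0}" by (elim exE)
  then obtain f where f: "f \<in> fs" "f z0 \<noteq> 0" using z0(2) by blast
  define W where "W = {z \<in> V. f z \<noteq> 0}"
  have "open W" unfolding W_def using V f(1) by (intro open_nonzero_holo2) blast+
  moreover have "z0 \<in> W" using V f by (simp add: W_def)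
  moreover have "W \<subseteq> ?S1 \<inter> punctured"
  proof
    fix w assume w: "w \<in> W"
    then have wp: "w \<in> punctured" using V by (auto simp: W_def)
    moreover have "w \<notin> ?S2" using V f(1) w unfolding W_def by blast
    ultimately show "w \<in> ?S1 \<inter> punctured" using cover[OF wp] by blast
  qed
  ultimately have "punctured \<subseteq> ?S1"
    using analytic_subset_with_interior[OF open_punctured connected_punctured analytic_subset3_pullback[OF A1]]
    by blast
  then show "\<forall>z\<in>punctured. ((X z, Y z), E z) \<in> A1" by blast
qed

end

text \<open>A quadratic cone over the (x, y^r)-plane is rational, and so is its r-fold cyclic cover; a
  parametrisation by the punctured plane makes irreducibility a consequence of the identity theorem.\<close>
lemma quadric_parametrisation_generic:
  fixes a c d :: complex
  assumes disc: "c\<^sup>2 - 4 * a * d \<noteq> 0" and a: "a \<noteq> 0" and r: "r > 0"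
  obtains X Y E where "holo2_on punctured X" "holo2_on punctured Y" "holo2_on punctured E"
    "\<And>z. z \<in> punctured \<Longrightarrow> (X z, Y z) \<in> punctured"
    "\<And>z. (E z)\<^sup>2 = a * (X z)\<^sup>2 + c * X z * Y z ^ r + d * (Y z ^ r)\<^sup>2"
    "\<And>x y \<eta>. (x, y) \<in> punctured \<Longrightarrow> \<eta>\<^sup>2 = a * x\<^sup>2 + c * x * y ^ r + d * (y ^ r)\<^sup>2 \<Longrightarrow>
       \<exists>z\<in>punctured. X z = x \<and> Y z = y \<and> E z = \<eta>"
proof -
  define \<delta> where "\<delta> = csqrt (c\<^sup>2 - 4 * a * d)"
  have \<delta>: "\<delta>\<^sup>2 = c\<^sup>2 - 4 * a * d" and \<delta>0: "\<delta> \<noteq> 0" using disc by (auto simp: \<delta>_def)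
  define s where "s = csqrt a"
  have s: "s\<^sup>2 = a" and s0: "s \<noteq> 0" using a by (auto simp: s_def)
  \<comment> \<open>With m, n = 2 a x + c y^r -+ 2 s \<eta> and s^2 = a, the equation of the cone
    becomes m n = \<delta>^2 y^(2 r). It is solved by m = \<delta> p^(2 r), n = \<delta> q^(2 r), y
    = p q; solving for x and \<eta> gives X and E.\<close>
  define X where "X = (\<lambda>z::complex \<times> complex. (\<delta> * ((fst z ^ r)\<^sup>2 + (snd z ^ r)\<^sup>2) - 2 * c * (fst z ^ r * snd z ^ r)) / (4 * a))"
  define Y where "Y = (\<lambda>z::complex \<times> complex. fst z * snd z)"
  define E where "E = (\<lambda>z::complex \<times> complex. \<delta> * ((snd z ^ r)\<^sup>2 - (fst z ^ r)\<^sup>2) / (4 * s))"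
  show thesis
  proof (rule that[of X Y E])
    show "holo2_on punctured X" unfolding X_def using a by (intro holo2_on_divide holo2_on_intros) simp
    show "holo2_on punctured Y" unfolding Y_def by (intro holo2_on_intros)
    show "holo2_on punctured E" unfolding E_def using s0 by (intro holo2_on_divide holo2_on_intros) simp
    \<comment> \<open>If p q = 0, exactly one of p and q vanishes, and X is a nonzero multiple of a
      power of the other.\<close>
    show "(X z, Y z) \<in> punctured" if z: "z \<in> punctured" for z
    proof (cases z)
      case (Pair p q)
      then consider "p \<noteq> 0" "q \<noteq> 0" | "p = 0" "q \<noteq> 0" | "p \<noteq> 0" "q = 0" using z by auto
      then show ?thesis
        by cases (use r a \<delta>0 in \<open>simp_all add: Pair X_def Y_def power_0_left\<close>)
    qed
    show "(E z)\<^sup>2 = a * (X z)\<^sup>2 + c * X z * Y z ^ r + d * (Y z ^ r)\<^sup>2" for z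
    proof -
      define u v where "u = fst z ^ r" and "v = snd z ^ r"
      define T where "T = \<delta> * (u\<^sup>2 + v\<^sup>2)"
      have "16 * a * (a * (X z)\<^sup>2 + c * X z * Y z ^ r + d * (Y z ^ r)\<^sup>2) =
          (4 * a * X z)\<^sup>2 + 4 * c * (4 * a * X z) * (u * v) + 16 * a * d * (u * v)\<^sup>2"
        by (simp add: Y_def u_def v_def power_mult_distrib algebra_simps power2_eq_square)
      also have "4 * a * X z = T - 2 * c * (u * v)" using a by (simp add: X_def T_def u_def v_def)
      also have "(T - 2 * c * (u * v))\<^sup>2 + 4 * c * (T - 2 * c * (u * v)) * (u * v) + 16 * a * d * (u * v)\<^sup>2 =
          T\<^sup>2 - 4 * (c\<^sup>2 - 4 * a * d) * (u * v)\<^sup>2"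
        by (simp add: algebra_simps power2_eq_square)
      also have "\<dots> = \<delta>\<^sup>2 * (v\<^sup>2 - u\<^sup>2)\<^sup>2"
        unfolding \<delta>[symmetric] T_def by (simp add: algebra_simps power2_eq_square)
      also have "\<dots> = 16 * s\<^sup>2 * (E z)\<^sup>2"
        using s0 by (simp add: E_def u_def v_def power_divide power_mult_distrib)
      finally show ?thesis unfolding s using a by simp
    qed
    fix x y \<eta> :: complex
    assume xy: "(x, y) \<in> punctured" and \<eta>: "\<eta>\<^sup>2 = a * x\<^sup>2 + c * x * y ^ r + d * (y ^ r)\<^sup>2"
    define m n where "m = 2 * a * x + c * y ^ r - 2 * s * \<eta>" and "n = 2 * a * x + c * y ^ r + 2 * s * \<eta>"
    have "m * n = (2 * a * x + c * y ^ r)\<^sup>2 - 4 * s\<^sup>2 * \<eta>\<^sup>2"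
      by (simp add: m_def n_def algebra_simps power2_eq_square)
    also have "\<dots> = \<delta>\<^sup>2 * (y ^ r)\<^sup>2" unfolding \<eta> s \<delta> by (simp add: algebra_simps power2_eq_square)
    finally have mn: "m * n = \<delta>\<^sup>2 * (y ^ r)\<^sup>2" .
    \<comment> \<open>The roots have to satisfy p q = y exactly. For p nonzero, q = y / p works
      because of \<open>mn\<close>; for p = 0 also y = 0, and any root q will do.\<close>
    have pq: "\<exists>p q. \<delta> * (p ^ r)\<^sup>2 = m \<and> \<delta> * (q ^ r)\<^sup>2 = n \<and> p * q = y"
    proof -
      obtain p where p: "csqrt (m / \<delta>) = p ^ r" using exists_complex_root[of r] r by auto
      have pm: "\<delta> * (p ^ r)\<^sup>2 = m" unfolding p[symmetric] using \<delta>0 by simp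
      show ?thesis
      proof (cases "p = 0")
        case True
        then have "m = 0" using pm r by (simp add: power_0_left)
        then have "y = 0" using mn \<delta>0 by simp
        obtain q where q: "csqrt (n / \<delta>) = q ^ r" using exists_complex_root[of r] r by auto
        have "\<delta> * (q ^ r)\<^sup>2 = n" unfolding q[symmetric] using \<delta>0 by simp
        then show ?thesis using pm True \<open>y = 0\<close> by auto
      next
        case False
        then have "m \<noteq> 0" using pm \<delta>0 by auto
        have "m * (\<delta> * ((y / p) ^ r)\<^sup>2) = \<delta> * (p ^ r)\<^sup>2 * (\<delta> * ((y / p) ^ r)\<^sup>2)" using pm by simp
        also have "\<dots> = \<delta>\<^sup>2 * (y ^ r)\<^sup>2"
          using False by (simp add: power_divide power2_eq_square)
        also have "\<dots> = m * n" by (rule mn[symmetric])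
        finally have "\<delta> * ((y / p) ^ r)\<^sup>2 = n" using \<open>m \<noteq> 0\<close> by simp
        then show ?thesis using pm False by (intro exI[of _ p] exI[of _ "y / p"]) simp
      qed
    qed
    then obtain p q where p: "\<delta> * (p ^ r)\<^sup>2 = m" and q: "\<delta> * (q ^ r)\<^sup>2 = n" and y: "p * q = y" by blast
    have pqy: "p ^ r * q ^ r = y ^ r" by (simp add: y[symmetric] power_mult_distrib)
    have X': "X (p, q) = x"
    proof -
      have "X (p, q) = (m + n - 2 * c * y ^ r) / (4 * a)"
        unfolding X_def p[symmetric] q[symmetric] pqy[symmetric] by (simp add: algebra_simps)
      then show ?thesis using a by (simp add: m_def n_def)
    qed
    have E': "E (p, q) = \<eta>"
    proof -
      have "E (p, q) = (n - m) / (4 * s)"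
        unfolding E_def p[symmetric] q[symmetric] by (simp add: algebra_simps)
      then show ?thesis using s0 by (simp add: m_def n_def)
    qed
    have "(p, q) \<in> punctured"
    proof (rule ccontr)
      assume "(p, q) \<notin> punctured"
      then have "p = 0" "q = 0" by auto
      then show False using xy X' y r by (simp add: X_def power_0_left)
    qed
    then show "\<exists>z\<in>punctured. X z = x \<and> Y z = y \<and> E z = \<eta>"
      using X' E' y by (intro bexI[of _ "(p, q)"]) (auto simp: Y_def)
  qed
qed

text \<open>For a = 0, where the generic formulas would divide by zero, the form factors as y^r (c x
  + d y^r). The equation is then solved by y = p^2, c x + d y^r = q^2, \<eta> = p^r q.\<close>

lemma quadric_parametrisation_tangent:
  fixes c d :: complex
  assumes c: "c \<noteq> 0" and r: "r > 0"
  obtains X Y E where "holo2_on punctured X" "holo2_on punctured Y" "holo2_on punctured E"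
    "\<And>z. z \<in> punctured \<Longrightarrow> (X z, Y z) \<in> punctured"
    "\<And>z. (E z)\<^sup>2 = c * X z * Y z ^ r + d * (Y z ^ r)\<^sup>2"
    "\<And>x y \<eta>. (x, y) \<in> punctured \<Longrightarrow> \<eta>\<^sup>2 = c * x * y ^ r + d * (y ^ r)\<^sup>2 \<Longrightarrow>
       \<exists>z\<in>punctured. X z = x \<and> Y z = y \<and> E z = \<eta>"
proof -
  define X where "X = (\<lambda>z::complex \<times> complex. ((snd z)\<^sup>2 - d * (fst z ^ r)\<^sup>2) / c)"
  define Y where "Y = (\<lambda>z::complex \<times> complex. (fst z)\<^sup>2)"
  define E where "E = (\<lambda>z::complex \<times> complex. fst z ^ r * snd z)"
  have Yr: "Y z ^ r = (fst z ^ r)\<^sup>2" for z by (simp add: Y_def power_mult[symmetric] mult.commute)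
  show thesis
  proof (rule that[of X Y E])
    show "holo2_on punctured X" unfolding X_def using c by (intro holo2_on_divide holo2_on_intros) simp
    show "holo2_on punctured Y" unfolding Y_def by (intro holo2_on_intros)
    show "holo2_on punctured E" unfolding E_def by (intro holo2_on_intros)
    show "(X z, Y z) \<in> punctured" if "z \<in> punctured" for z
      using that c r by (cases z) (auto simp: X_def Y_def power_0_left)
    show "(E z)\<^sup>2 = c * X z * Y z ^ r + d * (Y z ^ r)\<^sup>2" for z
    proof -
      have sq: "(snd z)\<^sup>2 = c * X z + d * (fst z ^ r)\<^sup>2" using c by (simp add: X_def)
      have "(E z)\<^sup>2 = (fst z ^ r)\<^sup>2 * (snd z)\<^sup>2" by (simp add: E_def power_mult_distrib)
      then show ?thesis unfolding sq Yr by (simp add: algebra_simps power2_eq_square)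
    qed
    fix x y \<eta> :: complex
    assume xy: "(x, y) \<in> punctured" and \<eta>: "\<eta>\<^sup>2 = c * x * y ^ r + d * (y ^ r)\<^sup>2"
    define p where "p = csqrt y"
    have p2: "p\<^sup>2 = y" by (simp add: p_def)
    have pr: "(p ^ r)\<^sup>2 = y ^ r" unfolding p2[symmetric] by (simp add: power_mult[symmetric] mult.commute)
    \<comment> \<open>Where y \<noteq> 0, q is forced by \<eta> = p^r q; where y = 0, both sides of
      that equation vanish and any square root of c x will do.\<close>
    have "\<exists>q. q\<^sup>2 = c * x + d * y ^ r \<and> p ^ r * q = \<eta>"
    proof (cases "y = 0")
      case True
      then show ?thesis using \<eta> r by (intro exI[of _ "csqrt (c * x)"]) (simp add: p_def power_0_left)
    next
      case False
      then have "p \<noteq> 0" by (simp add: p_def)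
      have "(\<eta> / p ^ r)\<^sup>2 = (c * x * y ^ r + d * (y ^ r)\<^sup>2) / y ^ r"
        by (simp add: power_divide pr \<eta>)
      also have "\<dots> = c * x + d * y ^ r" using False by (simp add: add_divide_distrib power2_eq_square)
      finally show ?thesis using \<open>p \<noteq> 0\<close> by (intro exI[of _ "\<eta> / p ^ r"]) simp
    qed
    then obtain q where q: "q\<^sup>2 = c * x + d * y ^ r" and e: "p ^ r * q = \<eta>" by blast
    have "X (p, q) = x" using c by (simp add: X_def q pr)
    moreover have "(p, q) \<in> punctured"
    proof (rule ccontr)
      assume "(p, q) \<notin> punctured"
      then have "p = 0" "q = 0" by auto
      then show False using xy p2 q c r by (auto simp: power_0_left)
    qed
    ultimately show "\<exists>z\<in>punctured. X z = x \<and> Y z = y \<and> E z = \<eta>"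
      using p2 e by (intro bexI[of _ "(p, q)"]) (auto simp: Y_def E_def)
  qed
qed

section \<open>Irreducibility when the discriminant is nonzero\<close>

context hopf_surface
begin

text \<open>A decomposition in the total space lifts to one of the preimage C of the curve, and C is
  the image of the connected punctured plane under (X, Y, E). Irreducibility thus holds already for
  the lift.\<close>

lemma spectral_curve_irreducible:
  assumes disc: "c\<^sup>2 - 4 * a * d \<noteq> 0"
    and \<phi>: "\<And>x y. (x, y) \<in> punctured \<Longrightarrow> \<phi> (x, y) = mat2 (p (x, y)) (q (x, y)) (w (x, y)) (- p (x, y))"
    and D: "\<And>x y. (x, y) \<in> punctured \<Longrightarrow> (p (x, y))\<^sup>2 + q (x, y) * w (x, y) =
      a * x\<^sup>2 + c * x * y ^ r + d * (y ^ r)\<^sup>2"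
  shows "irreducible_in_tot b r (b ^ r) (spectral_curve b r (b ^ r) \<phi>)"
proof -
  let ?R = "total_space_rel b r (b ^ r)"
  define Q where "Q = (\<lambda>z. a * (fst z)\<^sup>2 + c * fst z * snd z ^ r + d * (snd z ^ r)\<^sup>2)"
  define C where "C = {(p, \<eta>). p \<in> punctured \<and> det (mat \<eta> - \<phi> p) = 0}"
  have det: "det (mat \<eta> - \<phi> z) = \<eta>\<^sup>2 - Q z" if "z \<in> punctured" for z \<eta>
  proof (cases z)
    case (Pair x y)
    have xy: "(x, y) \<in> punctured" using that Pair by simp
    have "det (mat \<eta> - \<phi> z) = \<eta>\<^sup>2 - ((p z)\<^sup>2 + q z * w z)"
      unfolding Pair \<phi>[OF xy] mat_minus_mat2 by (simp add: algebra_simps power2_eq_square)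
    then show ?thesis unfolding Pair D[OF xy] by (simp add: Q_def)
  qed
  have C: "(z, \<eta>) \<in> C \<longleftrightarrow> z \<in> punctured \<and> \<eta>\<^sup>2 = Q z" for z \<eta>
    by (cases "z \<in> punctured") (simp_all add: C_def det del: in_punctured)
  \<comment> \<open>Q has weight 2 r, matching the square of the multiplier b^r on the fibre
    coordinate; hence C is a union of classes.\<close>
  have Q_hopf: "Q (hopf_map b r z) = (b ^ r)\<^sup>2 * Q z" for z
    by (cases z) (simp add: Q_def power_mult_distrib algebra_simps power2_eq_square)
  have hopf_punctured_iff: "hopf_map b r z \<in> punctured \<longleftrightarrow> z \<in> punctured" for z
    by (cases z) simp
  have sat: "(z, \<eta>) \<in> C \<longleftrightarrow> (hopf_map b r z, b ^ r * \<eta>) \<in> C" for z \<eta>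
    unfolding C hopf_punctured_iff Q_hopf by (simp add: power_mult_distrib)
  have Union: "\<Union> (C // ?R) = C"
    by (rule Union_quotient_saturated[OF total_space_rel_equiv total_space_rel_saturated]) (use sat in blast)+
  have spec: "spectral_curve b r (b ^ r) \<phi> = C // ?R"
    by (simp add: spectral_curve_def C_def)
  have holQ: "holo2_on punctured Q" unfolding Q_def by (intro holo2_on_intros)
  have "\<exists>X Y E. holo2_on punctured X \<and> holo2_on punctured Y \<and> holo2_on punctured E \<and>
    (\<forall>z\<in>punctured. (X z, Y z) \<in> punctured) \<and>
    (\<forall>z. (E z)\<^sup>2 = a * (X z)\<^sup>2 + c * X z * Y z ^ r + d * (Y z ^ r)\<^sup>2) \<and>
    (\<forall>x y \<eta>. (x, y) \<in> punctured \<longrightarrow> \<eta>\<^sup>2 = a * x\<^sup>2 + c * x * y ^ r + d * (y ^ r)\<^sup>2 \<longrightarrow>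
       (\<exists>z\<in>punctured. X z = x \<and> Y z = y \<and> E z = \<eta>))"
  proof (cases "a = 0")
    case True
    then have "c \<noteq> 0" using disc by auto
    then show ?thesis
    proof (rule quadric_parametrisation_tangent[OF _ r_nz(2), of c d])
      fix X Y E
      assume "holo2_on punctured X" "holo2_on punctured Y" "holo2_on punctured E"
        "\<And>z. z \<in> punctured \<Longrightarrow> (X z, Y z) \<in> punctured"
        "\<And>z. (E z)\<^sup>2 = c * X z * Y z ^ r + d * (Y z ^ r)\<^sup>2"
        "\<And>x y \<eta>. (x, y) \<in> punctured \<Longrightarrow> \<eta>\<^sup>2 = c * x * y ^ r + d * (y ^ r)\<^sup>2 \<Longrightarrow>
          \<exists>z\<in>punctured. X z = x \<and> Y z = y \<and> E z = \<eta>"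
      then show ?thesis
        by (intro exI[of _ X] exI[of _ Y] exI[of _ E] conjI ballI allI impI)
          (simp_all add: True del: in_punctured split_paired_All)
    qed
  next
    case False
    show ?thesis
    proof (rule quadric_parametrisation_generic[OF disc False r_nz(2)])
      fix X Y E
      assume "holo2_on punctured X" "holo2_on punctured Y" "holo2_on punctured E"
        "\<And>z. z \<in> punctured \<Longrightarrow> (X z, Y z) \<in> punctured"
        "\<And>z. (E z)\<^sup>2 = a * (X z)\<^sup>2 + c * X z * Y z ^ r + d * (Y z ^ r)\<^sup>2"
        "\<And>x y \<eta>. (x, y) \<in> punctured \<Longrightarrow> \<eta>\<^sup>2 = a * x\<^sup>2 + c * x * y ^ r + d * (y ^ r)\<^sup>2 \<Longrightarrow>
          \<exists>z\<in>punctured. X z = x \<and> Y z = y \<and> E z = \<eta>"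
      then show ?thesis by blast
    qed
  qed
  then obtain X Y E where X: "holo2_on punctured X" and Y: "holo2_on punctured Y" and E: "holo2_on punctured E"
    and XY: "\<And>z. z \<in> punctured \<Longrightarrow> (X z, Y z) \<in> punctured"
    and eq: "\<And>z. (E z)\<^sup>2 = a * (X z)\<^sup>2 + c * X z * Y z ^ r + d * (Y z ^ r)\<^sup>2"
    and surj: "\<And>x y \<eta>. (x, y) \<in> punctured \<Longrightarrow> \<eta>\<^sup>2 = a * x\<^sup>2 + c * x * y ^ r + d * (y ^ r)\<^sup>2 \<Longrightarrow>
       \<exists>z\<in>punctured. X z = x \<and> Y z = y \<and> E z = \<eta>"
    by blast
  have in_C: "((X z, Y z), E z) \<in> C" if "z \<in> punctured" for z
    using XY[OF that] eq[of z] by (simp add: C Q_def del: in_punctured)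
  have an: "analytic_subset_tot b r (b ^ r) (C // ?R)"
    unfolding analytic_subset_tot_def Union
  proof
    show "C // ?R \<subseteq> total_space b r (b ^ r)"
      unfolding total_space_def C_def quotient_def by blast
    show "analytic_subset3 (punctured \<times> UNIV) C"
      unfolding analytic_subset3_def
    proof (intro conjI ballI exI)
      show "C \<subseteq> punctured \<times> UNIV" by (auto simp: C_def)
      show "open (punctured \<times> (UNIV :: complex set))" by (intro open_Times open_punctured open_UNIV)
      show "finite {\<lambda>z::(complex \<times> complex) \<times> complex. (snd z)\<^sup>2 - Q (fst z)}" by simp
      show "holo3_on (punctured \<times> UNIV) f" if "f \<in> {\<lambda>z. (snd z)\<^sup>2 - Q (fst z)}" for f
        using that holo3_on_square_minus[OF holo3_on_holo2[OF holQ]] by (simp add: fst_image_times)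
      show "C \<inter> punctured \<times> UNIV = {z \<in> punctured \<times> UNIV. \<forall>f\<in>{\<lambda>z. (snd z)\<^sup>2 - Q (fst z)}. f z = 0}"
        using C by auto
    qed auto
  qed
  have z1: "(1, 0) \<in> punctured" by simp
  show ?thesis
    unfolding irreducible_in_tot_def spec
  proof (intro conjI allI impI an)
    show "C // ?R \<noteq> {}" using in_C[OF z1] by (auto simp: quotient_def)
    fix Z1 Z2
    assume *: "analytic_subset_tot b r (b ^ r) Z1 \<and> analytic_subset_tot b r (b ^ r) Z2 \<and> C // ?R = Z1 \<union> Z2"
    then have an12: "analytic_subset3 (punctured \<times> UNIV) (\<Union> Z1)" "analytic_subset3 (punctured \<times> UNIV) (\<Union> Z2)"
      by (simp_all add: analytic_subset_tot_def)
    have "C = \<Union> Z1 \<union> \<Union> Z2" using * Union by (metis Union_Un_distrib)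
    then have cover: "((X z, Y z), E z) \<in> \<Union> Z1 \<union> \<Union> Z2" if "z \<in> punctured" for z
      using in_C[OF that] by simp
    have C_sub: "C \<subseteq> A" if "\<forall>z\<in>punctured. ((X z, Y z), E z) \<in> A" for A
    proof
      fix c' assume c': "c' \<in> C"
      obtain x y \<eta> where c'_eq: "c' = ((x, y), \<eta>)" by (metis prod.exhaust)
      then have "(x, y) \<in> punctured" "\<eta>\<^sup>2 = a * x\<^sup>2 + c * x * y ^ r + d * (y ^ r)\<^sup>2"
        using c' C[of "(x, y)" \<eta>] by (simp_all add: Q_def del: in_punctured)
      then obtain z where "z \<in> punctured" "X z = x" "Y z = y" "E z = \<eta>" using surj by blast
      then show "c' \<in> A" using that c'_eq by blast
    qed
    from analytic_cover_pullback[OF X Y E XY an12 cover]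
    show "C // ?R = Z1 \<or> C // ?R = Z2"
    proof
      assume "\<forall>z\<in>punctured. ((X z, Y z), E z) \<in> \<Union> Z1"
      then have "Z1 = C // ?R" using * by (intro quotient_subset_of_Union[OF total_space_rel_equiv] C_sub) blast+
      then show ?thesis by simp
    next
      assume "\<forall>z\<in>punctured. ((X z, Y z), E z) \<in> \<Union> Z2"
      then have "Z2 = C // ?R" using * by (intro quotient_subset_of_Union[OF total_space_rel_equiv] C_sub) blast+
      then show ?thesis by simp
    qed
  qed
qed

lemma NF1_irreducible:
  assumes "nf_admissible b r (NF1 s t u)"
  shows "irreducible_in_tot b r (b ^ r) (spectral_curve b r (b ^ r) (nf_field r (NF1 s t u)))"
  by (rule spectral_curve_irreducible[of s "t\<^sup>2" u _ "\<lambda>(x, y). t * x" "\<lambda>(x, y). s * x + u * y ^ r" "\<lambda>(x, y). y ^ r"])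
    (use assms in \<open>simp_all add: algebra_simps power2_eq_square\<close>)

text \<open>For a nonzero one completes the square; for a = 0 the vanishing discriminant removes the
  mixed term as well.\<close>

lemma H0_degree_2r_square:
  assumes "\<And>x y. (x, y) \<in> punctured \<Longrightarrow> \<beta> (x, y) = a * x\<^sup>2 + c * x * y ^ r + d * (y ^ r)\<^sup>2"
    and disc: "c\<^sup>2 - 4 * a * d = 0"
  shows "\<exists>t\<in>H0 b r (b ^ r). \<forall>z\<in>punctured. \<beta> z = (t z)\<^sup>2"
proof -
  have "\<exists>u v. u\<^sup>2 = a \<and> 2 * u * v = c \<and> v\<^sup>2 = d"
  proof (cases "a = 0")
    case True
    then show ?thesis using disc by (intro exI[of _ 0] exI[of _ "csqrt d"]) simp
  next
    case False
    have "(c / (2 * csqrt a))\<^sup>2 = c\<^sup>2 / (4 * a)" by (simp add: power_divide power_mult_distrib)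
    also have "c\<^sup>2 = 4 * a * d" using disc by simp
    finally have "(c / (2 * csqrt a))\<^sup>2 = d" using False by simp
    then show ?thesis
      using False by (intro exI[of _ "csqrt a"] exI[of _ "c / (2 * csqrt a)"]) simp
  qed
  then obtain u v where uv: "u\<^sup>2 = a" "2 * u * v = c" "v\<^sup>2 = d" by blast
  have "\<beta> z = ((\<lambda>(x, y). u * x + v * y ^ r) z)\<^sup>2" if "z \<in> punctured" for z
  proof (cases z)
    case (Pair x y)
    then show ?thesis
      using assms(1)[of x y] that unfolding uv[symmetric] by (simp add: algebra_simps power2_eq_square)
  qed
  then show ?thesis using H0_linear[of u v] by blast
qed

lemma NF2_irreducible:
  assumes "nf_admissible b r (NF2 \<beta>)"
    and ns: "\<not> (\<exists>t\<in>H0 b r (b ^ r). \<forall>z\<in>punctured. \<beta> z = (t z)\<^sup>2)"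
  shows "irreducible_in_tot b r (b ^ r) (spectral_curve b r (b ^ r) (nf_field r (NF2 \<beta>)))"
proof -
  have "\<beta> \<in> H0 b r (b ^ (2 * r))" using assms(1) by simp
  then obtain a c d where \<beta>: "\<And>x y. (x, y) \<in> punctured \<Longrightarrow> \<beta> (x, y) = a * x\<^sup>2 + c * x * y ^ r + d * (y ^ r)\<^sup>2"
    using H0_degree_2r by blast
  have "c\<^sup>2 - 4 * a * d \<noteq> 0" using H0_degree_2r_square[OF \<beta>] ns by blast
  then show ?thesis
    by (rule spectral_curve_irreducible[where p = "\<lambda>_. 0" and q = \<beta> and w = "\<lambda>_. 1"]) (simp_all add: \<beta>)
qed

lemma NF4_irreducible:
  assumes adm: "nf_admissible b r (NF4 k s \<beta>)"
    and ns: "\<not> (\<exists>t. \<forall>(x, y)\<in>punctured. \<beta> (x, y) = 2 * s * t * x * y ^ k + t\<^sup>2 * y ^ (r + k))"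
  shows "irreducible_in_tot b r (b ^ r) (spectral_curve b r (b ^ r) (nf_field r (NF4 k s \<beta>)))"
proof -
  have k: "0 < k" "k < r" and s: "s \<noteq> 0" and hol: "\<beta> \<in> H0 b r (b ^ (r + k))" using adm by simp_all
  obtain c d where \<beta>: "\<And>x y. (x, y) \<in> punctured \<Longrightarrow> \<beta> (x, y) = c * x * y ^ (r + k - r) + d * y ^ (r + k)"
    using H0_middle[OF hol] k by auto
  have yr: "y ^ (r - k) * y ^ k = y ^ r" for y :: complex using k by (simp add: power_add[symmetric])
  have "c\<^sup>2 - 4 * s\<^sup>2 * d \<noteq> 0"
  proof
    assume disc: "c\<^sup>2 - 4 * s\<^sup>2 * d = 0"
    \<comment> \<open>The only candidate, read off from the coefficient 2 s t of x y^k. Vanishing of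
      the discriminant of s^2 x^2 + y^(r - k) \<beta> then says t^2 = d.\<close>
    define t where "t = c / (2 * s)"
    have "t\<^sup>2 = c\<^sup>2 / (4 * s\<^sup>2)" by (simp add: t_def power_divide power_mult_distrib)
    also have "c\<^sup>2 = 4 * s\<^sup>2 * d" using disc by simp
    finally have "t\<^sup>2 = d" using s by simp
    moreover have "2 * s * t = c" using s by (simp add: t_def)
    ultimately have "\<forall>(x, y)\<in>punctured. \<beta> (x, y) = 2 * s * t * x * y ^ k + t\<^sup>2 * y ^ (r + k)"
      using \<beta> by auto
    then show False using ns by blast
  qed
  then show ?thesis
  proof (rule spectral_curve_irreducible[where p = "\<lambda>(x, y). s * x" and q = \<beta> and w = "\<lambda>(x, y). y ^ (r - k)"])
    fix x y :: complex assume xy: "(x, y) \<in> punctured"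
    show "((\<lambda>(x, y). s * x) (x, y))\<^sup>2 + \<beta> (x, y) * (\<lambda>(x, y). y ^ (r - k)) (x, y) =
        s\<^sup>2 * x\<^sup>2 + c * x * y ^ r + d * (y ^ r)\<^sup>2"
      by (simp add: \<beta>[OF xy] yr[symmetric] power_add algebra_simps power2_eq_square)
  qed simp
qed

end

theorem proposition5p7:
  fixes b :: complex and r :: nat
  assumes b: "0 < cmod b" "cmod b < 1" and r: "r > 1"
  shows
    "(\<forall>N. nf_admissible b r N \<longrightarrow>
        nf_bundle b r N \<noteq> 0 \<and> lb_degree b (nf_bundle b r N) \<le> 0 \<and>
        higgs_field b r (b ^ r) (nf_bundle b r N) (nf_field r N) \<and>
        nowhere_vanishing (nf_field r N)) \<and>
     (\<forall>\<tau> \<phi>. \<tau> \<noteq> 0 \<and> lb_degree b \<tau> \<le> 0 \<and> higgs_field b r (b ^ r) \<tau> \<phi> \<and> nowhere_vanishing \<phi> \<longrightarrow>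
        (\<exists>N. nf_admissible b r N \<and> \<tau> = nf_bundle b r N \<and> conjugate b r \<tau> \<phi> (nf_field r N))) \<and>
     (\<forall>N N'. nf_admissible b r N \<and> nf_admissible b r N' \<longrightarrow>
        (nf_bundle b r N = nf_bundle b r N' \<and>
           conjugate b r (nf_bundle b r N) (nf_field r N) (nf_field r N')
         \<longleftrightarrow> nf_same N N')) \<and>

     (\<forall>s t u. nf_admissible b r (NF1 s t u) \<longrightarrow>
        irreducible_in_tot b r (b ^ r) (spectral_curve b r (b ^ r) (nf_field r (NF1 s t u)))) \<and>

     (\<forall>\<beta>. nf_admissible b r (NF2 \<beta>) \<longrightarrow>
        (\<not> (\<exists>t\<in>H0 b r (b ^ r). \<forall>z\<in>punctured. \<beta> z = (t z)\<^sup>2) \<longrightarrow>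
           irreducible_in_tot b r (b ^ r) (spectral_curve b r (b ^ r) (nf_field r (NF2 \<beta>)))) \<and>
        (\<forall>t\<in>H0 b r (b ^ r). (\<forall>z\<in>punctured. \<beta> z = (t z)\<^sup>2) \<longrightarrow>
           invariant_sub_line_bundles_are b r (b ^ r) (nf_bundle b r (NF2 \<beta>)) (nf_field r (NF2 \<beta>))
             {(b powi (- int r), t, \<lambda>_. 1),
              (b powi (- int r), \<lambda>z. - t z, \<lambda>_. 1)})) \<and>

     (\<forall>k u v. nf_admissible b r (NF3 k u v) \<longrightarrow>
        invariant_sub_line_bundles_are b r (b ^ r) (nf_bundle b r (NF3 k u v)) (nf_field r (NF3 k u v))
          {(1, \<lambda>_. 1, \<lambda>_. 0),
           (b powi (- int (r * (1 + k))),
            \<lambda>(x, y). (cnj v * x - cnj u * y ^ r) ^ (1 + k),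
            \<lambda>(x, y). - 2 * u * x - 2 * v * y ^ r)}) \<and>

     (\<forall>k s \<beta>. nf_admissible b r (NF4 k s \<beta>) \<longrightarrow>
        (\<not> (\<exists>t. \<forall>(x, y)\<in>punctured. \<beta> (x, y) = 2 * s * t * x * y ^ k + t\<^sup>2 * y ^ (r + k)) \<longrightarrow>
           irreducible_in_tot b r (b ^ r) (spectral_curve b r (b ^ r) (nf_field r (NF4 k s \<beta>)))) \<and>
        (\<forall>t. (\<forall>(x, y)\<in>punctured. \<beta> (x, y) = 2 * s * t * x * y ^ k + t\<^sup>2 * y ^ (r + k)) \<longrightarrow>
           invariant_sub_line_bundles_are b r (b ^ r) (nf_bundle b r (NF4 k s \<beta>)) (nf_field r (NF4 k s \<beta>))
             {(b powi (- int k), \<lambda>(x, y). t * y ^ k, \<lambda>_. - 1),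
              (b powi (- int r), \<lambda>(x, y). 2 * s * x + t * y ^ r, \<lambda>(x, y). y ^ (r - k))})) \<and>

     (\<forall>k \<alpha>. nf_admissible b r (NF5 k \<alpha>) \<longrightarrow>
        invariant_sub_line_bundles_are b r (b ^ r) (nf_bundle b r (NF5 k \<alpha>)) (nf_field r (NF5 k \<alpha>))
          {(1, \<lambda>_. 1, \<lambda>_. 0),
           (b powi (- int (r + k)), \<lambda>(x, y). y ^ (r + k), \<lambda>z. - 2 * \<alpha> z)})"
proof -
  interpret hopf_surface b r
    using b r by unfold_locales
  show ?thesis
  proof (intro conjI allI impI ballI)
    fix N assume adm: "nf_admissible b r N"
    show "nf_bundle b r N \<noteq> 0" by (rule nf_bundle_nz)
    show "lb_degree b (nf_bundle b r N) \<le> 0" by (rule nf_bundle_degree)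
    show "higgs_field b r (b ^ r) (nf_bundle b r N) (nf_field r N)" by (rule nf_field_higgs[OF adm])
    show "nowhere_vanishing (nf_field r N)" by (rule nf_field_nowhere_vanishing[OF adm])
  next
    fix \<tau> \<phi>
    assume "\<tau> \<noteq> 0 \<and> lb_degree b \<tau> \<le> 0 \<and> higgs_field b r (b ^ r) \<tau> \<phi> \<and> nowhere_vanishing \<phi>"
    then have "has_normal_form \<tau> \<phi>" by (intro normal_form_exists) blast+
    then show "\<exists>N. nf_admissible b r N \<and> \<tau> = nf_bundle b r N \<and> conjugate b r \<tau> \<phi> (nf_field r N)"
      unfolding has_normal_form_def .
  next
    fix N N' assume adm: "nf_admissible b r N \<and> nf_admissible b r N'"
    show "(nf_bundle b r N = nf_bundle b r N' \<and>
        conjugate b r (nf_bundle b r N) (nf_field r N) (nf_field r N')) = nf_same N N'"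
      unfolding nf_bundle_eq_iff
      using nf_conjugate_imp_same[of N N'] nf_same_imp_conjugate[of N N'] adm by blast
  next
    fix \<beta> t
    assume "nf_admissible b r (NF2 \<beta>)" and t: "t \<in> H0 b r (b ^ r)" "\<forall>z\<in>punctured. \<beta> z = (t z)\<^sup>2"
    then have "\<beta> \<in> H0 b r (b ^ (2 * r))" by simp
    then show "invariant_sub_line_bundles_are b r (b ^ r) (nf_bundle b r (NF2 \<beta>)) (nf_field r (NF2 \<beta>))
        {(b powi (- int r), t, \<lambda>_. 1), (b powi (- int r), \<lambda>z. - t z, \<lambda>_. 1)}"
      using NF2_invariant_sub_line_bundles[OF t(1)] t(2) by blast
  qed (fact NF1_irreducible NF2_irreducible NF4_irreducible NF3_invariant_sub_line_bundles
      NF4_invariant_sub_line_bundles NF5_invariant_sub_line_bundles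
    | erule (1) NF2_irreducible NF4_irreducible NF4_invariant_sub_line_bundles
    | erule NF1_irreducible NF3_invariant_sub_line_bundles NF5_invariant_sub_line_bundles)+
qed

end
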